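(* Let $(X,\mathcal{A})$ be a measurable space endowed with a finite measure $\mu$. Assume that the $\mathbb{C}^n$-reproducing kernel $K:X\times X\to M_n(\mathbb{C})$ is measurable and $\mathcal{H}_K$ is separable. Let $\nu$ be the finite measure on $\mathcal{A}$ defined by $$\nu(A)=\int_A\frac{1}{1+\|K(x,x)\|}\,d\mu(x),\qquad A\in\mathcal{A},$$ and let $L_\nu:L^2(X,\nu;\mathbb{C}^n)\to L^2(X,\nu;\mathbb{C}^n)$ be the integral operator $(L_\nu f)(x)=\int_XK(x,t)f(t)\,d\nu(t)$. Then there exists a countable family $\{f_i\}_{i\in I}$ of functions from $X$ to $\mathbb{C}^n$ such that: (a) for all $i\in I$ the function $f_i$ is continuous with respect to $\tau_K$; (b) the family $\{f_i\}_{i\in I}$ is an orthonormal basis of $(\ker L_\nu)^\perp\subset L^2(X,\nu;\mathbb{C}^n)$ and, for all $i\in I$, $L_\nu f_i=\sigma_if_i$ for some $\sigma_i\in(0,+\infty)$. Given any family $\{f_i\}_{i\in I}$ satisfying (a) and (b), then: (i) for all $x,t\in\operatorname{supp}\mu$ and $j,l=1,\dots,n$, $$K(x,t)_{lj}=\sum_{i\in I}\sigma_i\,f_i^j(t)\,\overline{f_i^l(x)},$$ where the convergence is uniform on compact subsets of $\operatorname{supp}\mu\times\operatorname{supp}\mu$; (ii) the family $\{\sqrt{\sigma_i}f_i\}_{i\in I}$ is orthonormal in $\mathcal{H}_K$; (iii) if $\operatorname{supp}\mu=X$, then $\{\sqrt{\sigma_i}f_i\}_{i\in I}$ is an orthonormal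 basis of $\mathcal{H}_K$; (iv) for $j=1,\dots,n$, the family $\{\sqrt{\sigma_i}f_i^j\}_{i\in I}$ is a Parseval frame in the scalar reproducing kernel Hilbert space $\mathcal{H}_{K_j}$ with reproducing kernel $K_j$ given by $K_j(x,t)=K(x,t)_{jj}$, $x,t\in X$; that is, $\|f\|_{K_j}^2=\sum_{i\in I}\sigma_i|\langle f,f_i^j\rangle_{K_j}|^2$ for all $f\in\mathcal{H}_{K_j}$.
   Context: $n\ge 1$ is an integer; $\mathbb{C}^n$ has its Euclidean norm and inner product $\langle\cdot,\cdot\rangle$ and canonical basis $e_1,\dots,e_n$; $M_n(\mathbb{C})$ is the space of complex $n\times n$ matrices with the operator norm $\|\cdot\|$. For $f:X\to\mathbb{C}^n$, $f^j$ denotes its $j$-th component. $L^2(X,\nu;\mathbb{C}^n)$ is the Hilbert space of (equivalence classes of) $\nu$-square-integrable functions from $X$ to $\mathbb{C}^n$. A map $K:X\times X\to M_n(\mathbb{C})$ is a $\mathbb{C}^n$-reproducing kernel if $K(x,t)^*=K(t,x)$ for all $x,t\in X$, and $\sum_{i,j=1}^m\langle K(x_i,x_j)y_j,y_i\rangle\ge 0$ for all $m\ge1$, $x_1,\dots,x_m\in X$, $y_1,\dots,y_m\in\mathbb{C}^n$. For $x\in X$, $y\in\mathbb{C}^n$ let $K_xy:X\to\mathbb{C}^n$ be $(K_xy)(t)=K(t,x)y$, and $K_x^j=K_xe_j$. The reproducing kernel Hilbert space $\mathcal{H}_K$, with inner product $\langle\cdot,\cdot\rangle_K$ and norm $\|\cdot\|_K$,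 is the unique Hilbert space of functions $X\to\mathbb{C}^n$ containing all $K_x^j$ and such that $f(x)=(\langle f,K_x^1\rangle_K,\dots,\langle f,K_x^n\rangle_K)$ for all $f\in\mathcal{H}_K$, $x\in X$. For $n=1$ this is the scalar notion. $\tau_K$ is the topology on $X$ whose basis consists of the open balls of the pseudo-metric $d(x,t)=\sup_{\|y\|\le1}\|K_xy-K_ty\|_K$; when $\mathcal{H}_K$ is separable and $K$ is measurable, it is second countable and its Borel sets belong to $\mathcal{A}$. $\operatorname{supp}\mu$ is the smallest $\tau_K$-closed subset $C$ of $X$ with $\mu(C)=\mu(X)$ (it exists under these assumptions). Compactness refers to $\tau_K$ (and the product topology on $X\times X$). Under the stated hypotheses $\int_X\operatorname{Tr}K(x,x)\,d\nu(x)<\infty$ and $L_\nu$ is a well-defined, positive and compact operator.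
   Formalization: In (i) the conjugate is moved to f_i^j(t), the printed sum being the conjugate of K(x,t)_{lj}; (ii) assumes L_ν f_i = σ_i f_i at every point of X, not just a.e.; (iv) assumes supp μ = X (it fails for μ = 0, K ≠ 0). *)

theory Defs
  imports "HOL-Analysis.Analysis"
begin

section \<open>The Hermitian space of complex vectors and matrices\<close>

text \<open>The library inner product on \<^typ>\<open>complex^'n\<close> is the real one, so the complex
  inner product (linear in its first argument) is introduced here; its norm is the library norm.\<close>

definition cinner :: "complex^'n \<Rightarrow> complex^'n \<Rightarrow> complex" where
  "cinner u v = (\<Sum>i\<in>UNIV. u $ i * cnj (v $ i))"

definition adjoint_matrix :: "complex^'n^'m \<Rightarrow> complex^'m^'n" where
  "adjoint_matrix A = (\<chi> i j. cnj (A $ j $ i))"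

definition matrix_opnorm :: "complex^'n^'m \<Rightarrow> real" where
  "matrix_opnorm A = onorm (\<lambda>v. A *v v)"

section \<open>Families of vector-valued functions\<close>

text \<open>The following notions are used both for Hilbert spaces of functions and, through
  representatives, for \<open>L\<^sup>2\<close>; \<open>ip\<close> is a positive semidefinite Hermitian form on \<open>S\<close>.\<close>

definition ip_norm ::
  "(('a \<Rightarrow> complex^'n) \<Rightarrow> ('a \<Rightarrow> complex^'n) \<Rightarrow> complex) \<Rightarrow> ('a \<Rightarrow> complex^'n) \<Rightarrow> real" where
  "ip_norm ip f = sqrt (Re (ip f f))"

definition orthonormal_family ::
  "('a \<Rightarrow> complex^'n) set \<Rightarrow> (('a \<Rightarrow> complex^'n) \<Rightarrow> ('a \<Rightarrow> complex^'n) \<Rightarrow> complex)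
    \<Rightarrow> 'i set \<Rightarrow> ('i \<Rightarrow> 'a \<Rightarrow> complex^'n) \<Rightarrow> bool" where
  "orthonormal_family S ip I f \<longleftrightarrow>
     (\<forall>i\<in>I. f i \<in> S) \<and> (\<forall>i\<in>I. \<forall>k\<in>I. ip (f i) (f k) = (if i = k then 1 else 0))"

text \<open>An orthonormal basis is an orthonormal family with dense linear span.\<close>

definition orthonormal_basis ::
  "('a \<Rightarrow> complex^'n) set \<Rightarrow> (('a \<Rightarrow> complex^'n) \<Rightarrow> ('a \<Rightarrow> complex^'n) \<Rightarrow> complex)
    \<Rightarrow> 'i set \<Rightarrow> ('i \<Rightarrow> 'a \<Rightarrow> complex^'n) \<Rightarrow> bool" where
  "orthonormal_basis S ip I f \<longleftrightarrow>
     orthonormal_family S ip I f \<and>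
     (\<forall>g\<in>S. \<forall>e>0. \<exists>F c. finite F \<and> F \<subseteq> I \<and>
        ip_norm ip (\<lambda>x. g x - (\<Sum>i\<in>F. c i *s f i x)) < e)"

definition parseval_frame ::
  "('a \<Rightarrow> complex^'n) set \<Rightarrow> (('a \<Rightarrow> complex^'n) \<Rightarrow> ('a \<Rightarrow> complex^'n) \<Rightarrow> complex)
    \<Rightarrow> 'i set \<Rightarrow> ('i \<Rightarrow> 'a \<Rightarrow> complex^'n) \<Rightarrow> bool" where
  "parseval_frame S ip I f \<longleftrightarrow>
     (\<forall>i\<in>I. f i \<in> S) \<and>
     (\<forall>g\<in>S. ((\<lambda>i. (cmod (ip g (f i)))\<^sup>2) has_sum (ip_norm ip g)\<^sup>2) I)"

section \<open>Reproducing kernels and their Hilbert spaces\<close>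

text \<open>A function from a set \<open>X\<close> to \<^typ>\<open>complex^'n\<close> is represented by its extension by zero.\<close>

definition functions_on :: "'a set \<Rightarrow> ('a \<Rightarrow> complex^'n) set" where
  "functions_on X = {f. \<forall>x. x \<notin> X \<longrightarrow> f x = 0}"

definition reproducing_kernel :: "'a set \<Rightarrow> ('a \<Rightarrow> 'a \<Rightarrow> complex^'n^'n) \<Rightarrow> bool" where
  "reproducing_kernel X K \<longleftrightarrow>
     (\<forall>x\<in>X. \<forall>t\<in>X. adjoint_matrix (K x t) = K t x) \<and>
     (\<forall>m\<ge>1. \<forall>(x :: nat \<Rightarrow> 'a) (y :: nat \<Rightarrow> complex^'n). (\<forall>i<m. x i \<in> X) \<longrightarrow>
        (\<Sum>i<m. \<Sum>j<m. cinner (K (x i) (x j) *v y j) (y i)) \<in> \<real>\<^sub>\<ge>\<^sub>0)"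

text \<open>The function \<open>K\<^sub>x y\<close>.\<close>

definition kernel_section ::
  "'a set \<Rightarrow> ('a \<Rightarrow> 'a \<Rightarrow> complex^'n^'n) \<Rightarrow> 'a \<Rightarrow> complex^'n \<Rightarrow> 'a \<Rightarrow> complex^'n" where
  "kernel_section X K x y = (\<lambda>t. if t \<in> X then K t x *v y else 0)"

locale hilbert_function_space =
  fixes X :: "'a set"
    and H :: "('a \<Rightarrow> complex^'n) set"
    and ip :: "('a \<Rightarrow> complex^'n) \<Rightarrow> ('a \<Rightarrow> complex^'n) \<Rightarrow> complex"
  assumes subset_functions: "H \<subseteq> functions_on X"
    and zero_in: "(\<lambda>x. 0) \<in> H"
    and add_in: "f \<in> H \<Longrightarrow> g \<in> H \<Longrightarrow> (\<lambda>x. f x + g x) \<in> H"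
    and scale_in: "f \<in> H \<Longrightarrow> (\<lambda>x. c *s f x) \<in> H"
    and ip_add: "f \<in> H \<Longrightarrow> g \<in> H \<Longrightarrow> h \<in> H \<Longrightarrow> ip (\<lambda>x. f x + g x) h = ip f h + ip g h"
    and ip_scale: "f \<in> H \<Longrightarrow> h \<in> H \<Longrightarrow> ip (\<lambda>x. c *s f x) h = c * ip f h"
    and ip_sym: "f \<in> H \<Longrightarrow> g \<in> H \<Longrightarrow> ip g f = cnj (ip f g)"
    and ip_nonneg: "f \<in> H \<Longrightarrow> ip f f \<in> \<real>\<^sub>\<ge>\<^sub>0"
    and ip_definite: "f \<in> H \<Longrightarrow> ip f f = 0 \<Longrightarrow> f = (\<lambda>x. 0)"
    and complete: "(\<And>k. s k \<in> H) \<Longrightarrow>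
       (\<And>e. e > 0 \<Longrightarrow> \<exists>N::nat. \<forall>k\<ge>N. \<forall>m\<ge>N. ip_norm ip (\<lambda>x. s k x - s m x) < e) \<Longrightarrow>
       \<exists>f\<in>H. (\<lambda>k. ip_norm ip (\<lambda>x. s k x - f x)) \<longlonglongrightarrow> 0"

text \<open>\<open>rkhs X K H ip\<close>: the functions in \<open>H\<close> with the inner product \<open>ip\<close> are the reproducing
  kernel Hilbert space of \<open>K\<close>. For a given reproducing kernel, \<open>H\<close> exists and is unique, and so is
  \<open>ip\<close> on \<open>H\<close>.\<close>

locale rkhs = hilbert_function_space X H ip
  for X :: "'a set"
    and K :: "'a \<Rightarrow> 'a \<Rightarrow> complex^'n^'n"
    and H :: "('a \<Rightarrow> complex^'n) set"
    and ip :: "('a \<Rightarrow> complex^'n) \<Rightarrow> ('a \<Rightarrow> complex^'n) \<Rightarrow> complex" +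
  assumes section_in: "x \<in> X \<Longrightarrow> kernel_section X K x (axis j 1) \<in> H"
    and reproducing: "f \<in> H \<Longrightarrow> x \<in> X \<Longrightarrow> f x = (\<chi> j. ip f (kernel_section X K x (axis j 1)))"

definition separable_function_space ::
  "('a \<Rightarrow> complex^'n) set \<Rightarrow> (('a \<Rightarrow> complex^'n) \<Rightarrow> ('a \<Rightarrow> complex^'n) \<Rightarrow> complex) \<Rightarrow> bool" where
  "separable_function_space H ip \<longleftrightarrow>
     (\<exists>D. countable D \<and> D \<subseteq> H \<and> (\<forall>f\<in>H. \<forall>e>0. \<exists>g\<in>D. ip_norm ip (\<lambda>x. f x - g x) < e))"

text \<open>The scalar kernel \<open>K\<^sub>j\<close> is a kernel with values in the matrices of size one, and
  correspondingly for the scalar function \<open>f\<^sup>j\<close>.\<close>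

definition component_kernel ::
  "('a \<Rightarrow> 'a \<Rightarrow> complex^'n^'n) \<Rightarrow> 'n \<Rightarrow> 'a \<Rightarrow> 'a \<Rightarrow> complex^1^1" where
  "component_kernel K j x t = (\<chi> k l. K x t $ j $ j)"

definition component_fun :: "('a \<Rightarrow> complex^'n) \<Rightarrow> 'n \<Rightarrow> 'a \<Rightarrow> complex^1" where
  "component_fun f j x = (\<chi> k. f x $ j)"

section \<open>The topology of a kernel and the support of a measure\<close>

definition kernel_dist ::
  "'a set \<Rightarrow> ('a \<Rightarrow> 'a \<Rightarrow> complex^'n^'n) \<Rightarrow>
    (('a \<Rightarrow> complex^'n) \<Rightarrow> ('a \<Rightarrow> complex^'n) \<Rightarrow> complex) \<Rightarrow> 'a \<Rightarrow> 'a \<Rightarrow> real" where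
  "kernel_dist X K ip x t =
     (SUP y\<in>{y. norm y \<le> 1}. ip_norm ip (\<lambda>s. kernel_section X K x y s - kernel_section X K t y s))"

text \<open>The library's metric spaces are separated, hence do not apply to a pseudo-metric.\<close>

definition pseudometric_topology :: "'a set \<Rightarrow> ('a \<Rightarrow> 'a \<Rightarrow> real) \<Rightarrow> 'a topology" where
  "pseudometric_topology X d =
     topology (\<lambda>U. U \<subseteq> X \<and> (\<forall>x\<in>U. \<exists>r>0. {t\<in>X. d x t < r} \<subseteq> U))"

lemma openin_pseudometric_topology:
  "openin (pseudometric_topology X d) U \<longleftrightarrow>
     U \<subseteq> X \<and> (\<forall>x\<in>U. \<exists>r>0. {t\<in>X. d x t < r} \<subseteq> U)"
proof -
  have "istopology (\<lambda>U. U \<subseteq> X \<and> (\<forall>x\<in>U. \<exists>r>0. {t\<in>X. d x t < r} \<subseteq> U))"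
    unfolding istopology_def
  proof (intro conjI allI impI)
    fix S T
    assume S: "S \<subseteq> X \<and> (\<forall>x\<in>S. \<exists>r>0. {t\<in>X. d x t < r} \<subseteq> S)"
      and T: "T \<subseteq> X \<and> (\<forall>x\<in>T. \<exists>r>0. {t\<in>X. d x t < r} \<subseteq> T)"
    show "S \<inter> T \<subseteq> X" using S by blast
    show "\<forall>x\<in>S \<inter> T. \<exists>r>0. {t\<in>X. d x t < r} \<subseteq> S \<inter> T"
    proof
      fix x assume "x \<in> S \<inter> T"
      then obtain r s where "r > 0" "{t\<in>X. d x t < r} \<subseteq> S" "s > 0" "{t\<in>X. d x t < s} \<subseteq> T"
        using S T by blast
      then show "\<exists>r>0. {t\<in>X. d x t < r} \<subseteq> S \<inter> T"
        by (intro exI[of _ "min r s"]) auto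
    qed
  next
    fix \<K> :: "'a set set"
    assume *: "\<forall>S\<in>\<K>. S \<subseteq> X \<and> (\<forall>x\<in>S. \<exists>r>0. {t\<in>X. d x t < r} \<subseteq> S)"
    show "\<Union>\<K> \<subseteq> X" using * by blast
    show "\<forall>x\<in>\<Union>\<K>. \<exists>r>0. {t\<in>X. d x t < r} \<subseteq> \<Union>\<K>"
      using * by (meson UnionE Union_upper subset_trans)
  qed
  then show ?thesis
    unfolding pseudometric_topology_def by (simp add: topology_inverse')
qed

abbreviation kernel_topology ::
  "'a set \<Rightarrow> ('a \<Rightarrow> 'a \<Rightarrow> complex^'n^'n) \<Rightarrow>
    (('a \<Rightarrow> complex^'n) \<Rightarrow> ('a \<Rightarrow> complex^'n) \<Rightarrow> complex) \<Rightarrow> 'a topology" where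
  "kernel_topology X K ip \<equiv> pseudometric_topology X (kernel_dist X K ip)"

text \<open>\<open>LEAST\<close> refers to the order by inclusion.\<close>

definition measure_support :: "'a topology \<Rightarrow> 'a measure \<Rightarrow> 'a set" where
  "measure_support T M = (LEAST C. closedin T C \<and> emeasure M C = emeasure M (space M))"

section \<open>Square-integrable functions and the integral operator\<close>

text \<open>Elements of \<open>L\<^sup>2\<close> are given by representatives: functions equal almost everywhere are
  not identified, so equations between elements of \<open>L\<^sup>2\<close> are stated almost everywhere.\<close>

definition L2 :: "'a measure \<Rightarrow> ('a \<Rightarrow> complex^'n) set" where
  "L2 N = {f. f \<in> borel_measurable N \<and> integrable N (\<lambda>x. (norm (f x))\<^sup>2)}"

definition L2_inner :: "'a measure \<Rightarrow> ('a \<Rightarrow> complex^'n) \<Rightarrow> ('a \<Rightarrow> complex^'n) \<Rightarrow> complex" where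
  "L2_inner N f g = (\<integral>x. cinner (f x) (g x) \<partial>N)"

definition kernel_measure :: "'a measure \<Rightarrow> ('a \<Rightarrow> 'a \<Rightarrow> complex^'n^'n) \<Rightarrow> 'a measure" where
  "kernel_measure M K = density M (\<lambda>x. ennreal (1 / (1 + matrix_opnorm (K x x))))"

definition integral_operator ::
  "'a measure \<Rightarrow> ('a \<Rightarrow> 'a \<Rightarrow> complex^'n^'n) \<Rightarrow> ('a \<Rightarrow> complex^'n) \<Rightarrow> 'a \<Rightarrow> complex^'n" where
  "integral_operator N K f x = (\<integral>t. K x t *v f t \<partial>N)"

definition operator_kernel :: "'a measure \<Rightarrow> ('a \<Rightarrow> 'a \<Rightarrow> complex^'n^'n) \<Rightarrow> ('a \<Rightarrow> complex^'n) set" where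
  "operator_kernel N K = {f \<in> L2 N. AE x in N. integral_operator N K f x = 0}"

definition L2_orthogonal :: "'a measure \<Rightarrow> ('a \<Rightarrow> complex^'n) set \<Rightarrow> ('a \<Rightarrow> complex^'n) set" where
  "L2_orthogonal N S = {g \<in> L2 N. \<forall>f\<in>S. L2_inner N g f = 0}"

definition mercer_family ::
  "'a measure \<Rightarrow> ('a \<Rightarrow> 'a \<Rightarrow> complex^'n^'n) \<Rightarrow>
    (('a \<Rightarrow> complex^'n) \<Rightarrow> ('a \<Rightarrow> complex^'n) \<Rightarrow> complex) \<Rightarrow>
    'i set \<Rightarrow> ('i \<Rightarrow> 'a \<Rightarrow> complex^'n) \<Rightarrow> ('i \<Rightarrow> real) \<Rightarrow> bool" where
  "mercer_family M K ip I f \<sigma> \<longleftrightarrow>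
     (let N = kernel_measure M K in
       (\<forall>i\<in>I. f i \<in> functions_on (space M)) \<and>
       (\<forall>i\<in>I. continuous_map (kernel_topology (space M) K ip) euclidean (f i)) \<and>
       orthonormal_basis (L2_orthogonal N (operator_kernel N K)) (L2_inner N) I f \<and>
       (\<forall>i\<in>I. \<sigma> i > 0 \<and> (AE x in N. integral_operator N K (f i) x = \<sigma> i *\<^sub>R f i x)))"

text \<open>The eigenvalue equation at every point. For a family as above it holds at every point of
  the support of \<open>M\<close>, but off the support it is not implied: there the functions are
  constrained only by continuity.\<close>

definition pointwise_eigenfamily ::
  "'a measure \<Rightarrow> ('a \<Rightarrow> 'a \<Rightarrow> complex^'n^'n) \<Rightarrow>
    'i set \<Rightarrow> ('i \<Rightarrow> 'a \<Rightarrow> complex^'n) \<Rightarrow> ('i \<Rightarrow> real) \<Rightarrow> bool" where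
  "pointwise_eigenfamily M K I f \<sigma> \<longleftrightarrow>
     (\<forall>i\<in>I. \<forall>x\<in>space M. integral_operator (kernel_measure M K) K (f i) x = \<sigma> i *\<^sub>R f i x)"

end

theory Submission
  imports Defs "HOL-Library.Function_Algebras" "HOL-Complex_Analysis.Great_Picard"
begin

text \<open>The inclusion \<open>A\<close> of \<open>H\<close> into \<open>L\<^sup>2\<close> has the integral operator, taken with values in
  \<open>H\<close>, as its adjoint: \<open>\<langle>A\<^sup>* g, h\<rangle> = \<langle>g, h\<rangle>\<close>. Hence \<open>L = A A\<^sup>*\<close>, and an orthonormal family of
  eigenvectors \<open>u\<close> of the positive compact operator \<open>A\<^sup>* A\<close> on \<open>H\<close> yields the eigenfunctions \<open>u / \<surd>\<sigma>\<close>
  of \<open>L\<close>. Conversely, for any family as in the theorem the functions \<open>v\<^sub>i = A\<^sup>* f\<^sub>i / \<surd>\<sigma>\<^sub>i\<close> are orthonormal in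
  \<open>H\<close> and agree with \<open>\<surd>\<sigma>\<^sub>i f\<^sub>i\<close> almost everywhere, hence by continuity on the support. A function in \<open>H\<close>
  orthogonal to all \<open>v\<^sub>i\<close> is orthogonal in \<open>L\<^sup>2\<close> to all \<open>f\<^sub>i\<close>, so it vanishes on the support. Therefore the
  residual of a section \<open>K\<^sub>x\<^sup>j\<close>, for \<open>x\<close> in the support, along the \<open>v\<^sub>i\<close> tends to zero.\<close>

section \<open>Hilbert spaces of vectors in a carrier set\<close>

text \<open>The operator is diagonalized on \<open>H\<close> rather than on L2: there weak
  compactness and domination by the trace of \<open>K x x\<close> supply the compactness that a
  maximizer of the Rayleigh quotient needs, and the eigenvectors are genuine functions, continuous
  for the kernel topology. The weight in \<nu> serves two ends: it leaves the null sets of \<mu>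
  unchanged, and it makes the trace integrable, so that the inclusion of \<open>H\<close> into L2 is
  Hilbert--Schmidt. The obstacle is that off the support a member of a given family may be any
  continuous extension, so it need not lie in \<open>H\<close>; every statement about the kernel is
  therefore proved for the substitutes \<open>v i\<close>. Passing from almost everywhere to the
  support rests on a countable base, which separability of \<open>H\<close> provides: it makes the
  union of all null open sets null. The truncation error of the expansion is an inner product of two
  residuals, which reduces uniform convergence to that of residuals. For the scalar kernels, taking
  a component is the adjoint of an isometry, and such a map sends an orthonormal basis to a Parseval
  frame.\<close>

lemma mult_cnj_cmod: "z * cnj z = (complex_of_real (cmod z))\<^sup>2"
  by (metis complex_norm_square of_real_power)

text \<open>The Cauchy criterion for unordered sums. It lets \<open>riesz_fischer\<close> pass from
  an index set of any cardinality to a sequence of finite sets, to which completeness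
  applies.\<close>

lemma summable_on_small_tail:
  fixes f :: "'i \<Rightarrow> real"
  assumes f: "f summable_on I" and "e > 0"
  shows "\<exists>F. finite F \<and> F \<subseteq> I \<and> (\<forall>G. finite G \<and> G \<subseteq> I \<and> G \<inter> F = {} \<longrightarrow> sum f G < e)"
proof -
  obtain s where "(f has_sum s) I" using f unfolding summable_on_def by (rule exE)
  then have "\<forall>\<^sub>F F in finite_subsets_at_top I. dist (sum f F) s < e / 2"
    unfolding has_sum_def by (rule tendstoD) (use assms in simp)
  then obtain F where F: "finite F" "F \<subseteq> I"
    "\<And>G. finite G \<Longrightarrow> F \<subseteq> G \<Longrightarrow> G \<subseteq> I \<Longrightarrow> dist (sum f G) s < e / 2"
    unfolding eventually_finite_subsets_at_top by meson
  have "sum f G < e" if "finite G" "G \<subseteq> I" "G \<inter> F = {}" for G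
  proof -
    have "sum f (F \<union> G) = sum f F + sum f G"
      using that F by (intro sum.union_disjoint) auto
    then show ?thesis
      using F(3)[of F] F(3)[of "F \<union> G"] F(1,2) that unfolding dist_real_def by (simp add: abs_if split: if_splits)
  qed
  then show ?thesis using F(1,2) by blast
qed

text \<open>The form is only semidefinite, and vectors live in a carrier \<open>S\<close>, so that both \<open>H\<close> and
  \<open>L\<^sup>2\<close>, whose elements are representatives, are instances.\<close>

locale semi_inner = vector_space scale
  for scale :: "complex \<Rightarrow> 'v::ab_group_add \<Rightarrow> 'v" (infixr "\<odot>" 75) +
  fixes S :: "'v set" and ip :: "'v \<Rightarrow> 'v \<Rightarrow> complex"
  assumes subspace_S: "subspace S"
    and ip_add_left: "f \<in> S \<Longrightarrow> g \<in> S \<Longrightarrow> h \<in> S \<Longrightarrow> ip (f + g) h = ip f h + ip g h"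
    and ip_scale_left: "f \<in> S \<Longrightarrow> h \<in> S \<Longrightarrow> ip (c \<odot> f) h = c * ip f h"
    and ip_commute: "f \<in> S \<Longrightarrow> g \<in> S \<Longrightarrow> ip g f = cnj (ip f g)"
    and ip_self_nonneg: "f \<in> S \<Longrightarrow> ip f f \<in> \<real>\<^sub>\<ge>\<^sub>0"
begin

definition nrm :: "'v \<Rightarrow> real" where
  "nrm f = sqrt (Re (ip f f))"

definition orthonormal :: "'i set \<Rightarrow> ('i \<Rightarrow> 'v) \<Rightarrow> bool" where
  "orthonormal I v \<longleftrightarrow> (\<forall>i\<in>I. v i \<in> S) \<and> (\<forall>i\<in>I. \<forall>k\<in>I. ip (v i) (v k) = (if i = k then 1 else 0))"

definition proj :: "('i \<Rightarrow> 'v) \<Rightarrow> 'i set \<Rightarrow> 'v \<Rightarrow> 'v" where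
  "proj v F f = (\<Sum>i\<in>F. ip f (v i) \<odot> v i)"

lemma S_zero [simp, intro]: "0 \<in> S" using subspace_S subspace_0 by blast
lemma S_add [simp, intro]: "f \<in> S \<Longrightarrow> g \<in> S \<Longrightarrow> f + g \<in> S" using subspace_S subspace_add by blast
lemma S_diff [simp, intro]: "f \<in> S \<Longrightarrow> g \<in> S \<Longrightarrow> f - g \<in> S" using subspace_S subspace_diff by blast
lemma S_scale [simp, intro]: "f \<in> S \<Longrightarrow> c \<odot> f \<in> S" using subspace_S subspace_scale by blast
lemma S_sum [intro]: "(\<And>i. i \<in> F \<Longrightarrow> v i \<in> S) \<Longrightarrow> (\<Sum>i\<in>F. c i \<odot> v i) \<in> S"
  using subspace_S by (intro subspace_sum subspace_scale) auto

lemma ip_add_right: "f \<in> S \<Longrightarrow> g \<in> S \<Longrightarrow> h \<in> S \<Longrightarrow> ip h (f + g) = ip h f + ip h g"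
  using ip_commute[of "f + g" h] ip_commute[of f h] ip_commute[of g h] ip_add_left[of f g h] S_add
  by (simp add: S_add)

lemma ip_scale_right: "f \<in> S \<Longrightarrow> h \<in> S \<Longrightarrow> ip h (c \<odot> f) = cnj c * ip h f"
  using ip_commute[of "c \<odot> f" h] ip_commute[of f h] ip_scale_left[of f h c] by (simp add: S_scale)

lemma ip_zero_left [simp]: "h \<in> S \<Longrightarrow> ip 0 h = 0"
  using ip_scale_left[of 0 h 0] by simp

lemma ip_zero_right [simp]: "h \<in> S \<Longrightarrow> ip h 0 = 0"
  using ip_scale_right[of 0 h 0] by simp

lemma ip_diff_left: "f \<in> S \<Longrightarrow> g \<in> S \<Longrightarrow> h \<in> S \<Longrightarrow> ip (f - g) h = ip f h - ip g h"
  using ip_add_left[of "f - g" g h] by (simp add: S_diff)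

lemma ip_diff_right: "f \<in> S \<Longrightarrow> g \<in> S \<Longrightarrow> h \<in> S \<Longrightarrow> ip h (f - g) = ip h f - ip h g"
  using ip_add_right[of "f - g" g h] by (simp add: S_diff)

lemma ip_sum_left:
  assumes "\<And>i. i \<in> F \<Longrightarrow> v i \<in> S" "h \<in> S"
  shows "ip (\<Sum>i\<in>F. c i \<odot> v i) h = (\<Sum>i\<in>F. c i * ip (v i) h)"
  using assms
proof (induction F rule: infinite_finite_induct)
  case (insert x F)
  then show ?case by (simp add: ip_add_left ip_scale_left S_scale S_sum)
qed simp_all

lemma ip_sum_right:
  assumes "\<And>i. i \<in> F \<Longrightarrow> v i \<in> S" "h \<in> S"
  shows "ip h (\<Sum>i\<in>F. c i \<odot> v i) = (\<Sum>i\<in>F. cnj (c i) * ip h (v i))"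
  using assms
proof (induction F rule: infinite_finite_induct)
  case (insert x F)
  then show ?case by (simp add: ip_add_right ip_scale_right S_scale S_sum)
qed simp_all

lemma ip_self: "f \<in> S \<Longrightarrow> ip f f = complex_of_real ((nrm f)\<^sup>2)"
  using ip_self_nonneg[of f] unfolding nrm_def by (auto elim!: nonneg_Reals_cases simp flip: of_real_power)

lemma Re_ip_self: "f \<in> S \<Longrightarrow> Re (ip f f) = (nrm f)\<^sup>2"
  by (simp add: ip_self)

lemma nrm_nonneg [simp]: "f \<in> S \<Longrightarrow> 0 \<le> nrm f"
  using ip_self_nonneg[of f] unfolding nrm_def by (auto elim!: nonneg_Reals_cases)

lemma nrm_zero [simp]: "nrm 0 = 0"
  unfolding nrm_def by simp

lemma nrm_diff_sq:
  assumes "f \<in> S" "g \<in> S"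
  shows "(nrm (f - g))\<^sup>2 = (nrm f)\<^sup>2 - 2 * Re (ip f g) + (nrm g)\<^sup>2"
proof -
  have "ip (f - g) (f - g) = ip f f - ip f g - cnj (ip f g) + ip g g"
    using assms ip_commute[of f g] by (simp add: ip_diff_left ip_diff_right S_diff)
  then show ?thesis
    using assms by (simp flip: Re_ip_self add: S_diff)
qed

lemma nrm_add_sq:
  assumes "f \<in> S" "g \<in> S"
  shows "(nrm (f + g))\<^sup>2 = (nrm f)\<^sup>2 + 2 * Re (ip f g) + (nrm g)\<^sup>2"
proof -
  have "ip (f + g) (f + g) = ip f f + ip f g + cnj (ip f g) + ip g g"
    using assms ip_commute[of f g] by (simp add: ip_add_left ip_add_right S_add)
  then show ?thesis
    using assms by (simp flip: Re_ip_self add: S_add)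
qed

lemma nrm_scale: "f \<in> S \<Longrightarrow> nrm (c \<odot> f) = cmod c * nrm f"
proof -
  assume f: "f \<in> S"
  have "ip (c \<odot> f) (c \<odot> f) = complex_of_real ((cmod c * nrm f)\<^sup>2)"
    using f by (simp add: ip_scale_left ip_scale_right ip_self[OF f] power_mult_distrib mult.assoc[symmetric] mult_cnj_cmod mult.commute[of "cnj c"])
  then have "(nrm (c \<odot> f))\<^sup>2 = (cmod c * nrm f)\<^sup>2"
    using f by (metis Re_ip_self Re_complex_of_real S_scale)
  then show ?thesis
    using f by (metis S_scale nrm_nonneg norm_ge_zero mult_nonneg_nonneg power2_eq_imp_eq)
qed

lemma nrm_minus_commute:
  assumes "f \<in> S" "g \<in> S"
  shows "nrm (f - g) = nrm (g - f)"
proof -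
  have "nrm ((-1) \<odot> (g - f)) = nrm (g - f)" using assms by (subst nrm_scale) auto
  moreover have "(-1) \<odot> (g - f) = f - g" by (simp add: scale_minus_left)
  ultimately show ?thesis by simp
qed

text \<open>The square of \<open>nrm (f - (s * z) \<odot> g)\<close> with \<open>z = ip f g\<close>
  is a quadratic in the real number \<open>s\<close>. As the form is only semidefinite,
  \<open>nrm g\<close> may vanish for a nonzero \<open>g\<close>; the expression is then affine in
  \<open>s\<close>, and nonnegativity forces \<open>z = 0\<close>.\<close>

lemma cauchy_schwarz:
  assumes "f \<in> S" "g \<in> S"
  shows "cmod (ip f g) \<le> nrm f * nrm g"
proof -
  define z where "z = ip f g"
  have main: "0 \<le> (nrm f)\<^sup>2 - 2 * s * (cmod z)\<^sup>2 + s\<^sup>2 * (cmod z)\<^sup>2 * (nrm g)\<^sup>2" for s :: real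
  proof -
    have "ip f ((of_real s * z) \<odot> g) = complex_of_real (s * (cmod z)\<^sup>2)"
      using assms by (simp add: ip_scale_right z_def[symmetric] mult.assoc) (metis complex_norm_square mult.commute of_real_power)
    then have "(nrm (f - (of_real s * z) \<odot> g))\<^sup>2 = (nrm f)\<^sup>2 - 2 * (s * (cmod z)\<^sup>2) + (cmod (of_real s * z) * nrm g)\<^sup>2"
      using assms by (subst nrm_diff_sq) (auto simp: nrm_scale S_scale)
    moreover have "0 \<le> (nrm (f - (of_real s * z) \<odot> g))\<^sup>2" by simp
    ultimately show ?thesis
      by (simp add: power_mult_distrib norm_mult mult.assoc)
  qed
  have "(cmod z)\<^sup>2 \<le> (nrm f)\<^sup>2 * (nrm g)\<^sup>2"
  proof (cases "nrm g = 0")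
    case True
    show ?thesis
    proof (rule ccontr)
      assume "\<not> ?thesis"
      then have z: "(cmod z)\<^sup>2 > 0" using True by simp
      \<comment> \<open>This \<open>s\<close> makes the affine expression equal to -1.\<close>
      show False
        using main[of "((nrm f)\<^sup>2 + 1) / (2 * (cmod z)\<^sup>2)"] True z by simp
    qed
  next
    case False
    then have "(nrm g)\<^sup>2 > 0" by simp
    then show ?thesis
      using main[of "1 / (nrm g)\<^sup>2"] False by (simp add: power2_eq_square[of "1 / (nrm g)\<^sup>2"] field_simps)
  qed
  then have "(cmod z)\<^sup>2 \<le> (nrm f * nrm g)\<^sup>2" by (simp add: power_mult_distrib)
  then show ?thesis
    unfolding z_def using assms by (auto elim: power2_le_imp_le)
qed

lemma nrm_triangle: 
  assumes "f \<in> S" "g \<in> S" shows "nrm (f + g) \<le> nrm f + nrm g"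
proof (rule power2_le_imp_le)
  have "Re (ip f g) \<le> nrm f * nrm g"
    using cauchy_schwarz[OF assms] complex_Re_le_cmod[of "ip f g"] by linarith
  then show "(nrm (f + g))\<^sup>2 \<le> (nrm f + nrm g)\<^sup>2"
    using assms by (simp add: nrm_add_sq power2_sum)
qed (use assms in auto)

lemma nrm_triangle_diff: "f \<in> S \<Longrightarrow> g \<in> S \<Longrightarrow> h \<in> S \<Longrightarrow> nrm (f - h) \<le> nrm (f - g) + nrm (g - h)"
  using nrm_triangle[of "f - g" "g - h"] by (simp add: S_diff)

lemma nrm_sum_le:
  assumes "\<And>i. i \<in> F \<Longrightarrow> v i \<in> S"
  shows "nrm (\<Sum>i\<in>F. c i \<odot> v i) \<le> (\<Sum>i\<in>F. cmod (c i) * nrm (v i))"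
  using assms
proof (induction F rule: infinite_finite_induct)
  case (insert x F)
  have "nrm (c x \<odot> v x + (\<Sum>i\<in>F. c i \<odot> v i)) \<le> nrm (c x \<odot> v x) + nrm (\<Sum>i\<in>F. c i \<odot> v i)"
    using insert by (intro nrm_triangle) auto
  then show ?case using insert by (fastforce simp: nrm_scale)
qed simp_all

section \<open>Orthonormal families, finite projections and Bessel's inequality\<close>

lemma orthonormalD:
  assumes "orthonormal I v"
  shows "i \<in> I \<Longrightarrow> v i \<in> S" "i \<in> I \<Longrightarrow> k \<in> I \<Longrightarrow> ip (v i) (v k) = (if i = k then 1 else 0)"
  using assms by (auto simp: orthonormal_def)

lemma ip_orthonormal_sum:
  assumes "orthonormal I v" "finite F" "F \<subseteq> I" "k \<in> I"
  shows "ip (\<Sum>i\<in>F. c i \<odot> v i) (v k) = (if k \<in> F then c k else 0)"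
proof -
  have "ip (\<Sum>i\<in>F. c i \<odot> v i) (v k) = (\<Sum>i\<in>F. c i * ip (v i) (v k))"
    using assms by (intro ip_sum_left) (auto dest: orthonormalD)
  also have "\<dots> = (\<Sum>i\<in>F. if i = k then c k else 0)"
    using assms by (intro sum.cong) (auto simp: orthonormalD(2)[OF assms(1)] subset_iff)
  finally show ?thesis using assms by simp
qed

lemma nrm_sq_orthonormal_sum:
  assumes "orthonormal I v" "finite F" "F \<subseteq> I"
  shows "(nrm (\<Sum>i\<in>F. c i \<odot> v i))\<^sup>2 = (\<Sum>i\<in>F. (cmod (c i))\<^sup>2)"
proof -
  let ?s = "\<Sum>i\<in>F. c i \<odot> v i"
  have s: "?s \<in> S" using assms by (auto dest: orthonormalD)
  have "ip ?s ?s = (\<Sum>i\<in>F. cnj (c i) * ip ?s (v i))"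
    using assms s by (intro ip_sum_right) (auto dest: orthonormalD)
  also have "\<dots> = (\<Sum>i\<in>F. cnj (c i) * c i)"
    using assms by (intro sum.cong) (auto simp: ip_orthonormal_sum subset_iff)
  also have "\<dots> = of_real (\<Sum>i\<in>F. (cmod (c i))\<^sup>2)"
    by (simp add: mult_cnj_cmod mult.commute[of "cnj _"])
  finally show ?thesis
    using s by (metis Re_ip_self Re_complex_of_real)
qed

lemma proj_in [intro]:
  assumes "orthonormal I v" "F \<subseteq> I" shows "proj v F f \<in> S"
  unfolding proj_def using assms by (intro S_sum) (auto dest: orthonormalD)

lemma ip_proj:
  assumes "orthonormal I v" "finite F" "F \<subseteq> I" "k \<in> F"
  shows "ip (proj v F f) (v k) = ip f (v k)"
  unfolding proj_def using assms ip_orthonormal_sum[OF assms(1-3), of k] by auto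

lemma ip_proj_left:
  assumes "orthonormal I v" "F \<subseteq> I" "h \<in> S"
  shows "ip (proj v F f) h = (\<Sum>i\<in>F. ip f (v i) * ip (v i) h)"
  unfolding proj_def using assms by (intro ip_sum_left) (auto dest: orthonormalD)

lemma ip_residual_left:
  assumes "orthonormal I v" "finite F" "F \<subseteq> I" "k \<in> F" "f \<in> S"
  shows "ip (f - proj v F f) (v k) = 0"
  using assms ip_proj[OF assms(1-4), of f] proj_in[OF assms(1,3), of f]
  by (subst ip_diff_left) (auto dest: orthonormalD)

lemma ip_residual_sum:
  assumes "orthonormal I v" "finite F" "F \<subseteq> I" "f \<in> S"
  shows "ip (f - proj v F f) (\<Sum>i\<in>F. c i \<odot> v i) = 0"
proof -
  have "ip (f - proj v F f) (\<Sum>i\<in>F. c i \<odot> v i) = (\<Sum>i\<in>F. cnj (c i) * ip (f - proj v F f) (v i))"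
    using assms by (intro ip_sum_right S_diff proj_in) (auto dest: orthonormalD)
  then show ?thesis using ip_residual_left[OF assms(1-3) _ assms(4)] by simp
qed

lemma bessel_eq:
  assumes "orthonormal I v" "finite F" "F \<subseteq> I" "f \<in> S"
  shows "(nrm (f - proj v F f))\<^sup>2 = (nrm f)\<^sup>2 - (\<Sum>i\<in>F. (cmod (ip f (v i)))\<^sup>2)"
proof -
  let ?p = "proj v F f"
  have p: "?p \<in> S" using assms by blast
  have "(nrm (f - ?p + ?p))\<^sup>2 = (nrm (f - ?p))\<^sup>2 + 2 * Re (ip (f - ?p) ?p) + (nrm ?p)\<^sup>2"
    using assms p by (intro nrm_add_sq) auto
  moreover have "ip (f - ?p) ?p = 0"
    using ip_residual_sum[OF assms, of "\<lambda>i. ip f (v i)"] by (simp add: proj_def)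
  moreover have "(nrm ?p)\<^sup>2 = (\<Sum>i\<in>F. (cmod (ip f (v i)))\<^sup>2)"
    unfolding proj_def using assms(1-3) by (rule nrm_sq_orthonormal_sum)
  ultimately show ?thesis by simp
qed

lemma bessel:
  assumes "orthonormal I v" "finite F" "F \<subseteq> I" "f \<in> S"
  shows "(\<Sum>i\<in>F. (cmod (ip f (v i)))\<^sup>2) \<le> (nrm f)\<^sup>2"
  using bessel_eq[OF assms] zero_le_power2[of "nrm (f - proj v F f)"] by linarith

lemma residual_antimono:
  assumes "orthonormal I v" "finite G" "F \<subseteq> G" "G \<subseteq> I" "f \<in> S"
  shows "nrm (f - proj v G f) \<le> nrm (f - proj v F f)"
proof (rule power2_le_imp_le)
  have "finite F" "F \<subseteq> I" using assms finite_subset by auto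
  moreover have "(\<Sum>i\<in>F. (cmod (ip f (v i)))\<^sup>2) \<le> (\<Sum>i\<in>G. (cmod (ip f (v i)))\<^sup>2)"
    using assms by (intro sum_mono2) auto
  ultimately show "(nrm (f - proj v G f))\<^sup>2 \<le> (nrm (f - proj v F f))\<^sup>2"
    using assms by (simp add: bessel_eq[OF assms(1)])
  show "0 \<le> nrm (f - proj v F f)" using assms \<open>F \<subseteq> I\<close> by (simp add: proj_in[of I])
qed

lemma residual_le:
  assumes "orthonormal I v" "finite F" "F \<subseteq> I" "f \<in> S"
  shows "nrm (f - proj v F f) \<le> nrm f"
  using residual_antimono[OF assms(1,2) _ assms(3,4), of "{}"] by (simp add: proj_def)

lemma residual_minimal:
  assumes "orthonormal I v" "finite F" "F \<subseteq> I" "f \<in> S"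
  shows "nrm (f - proj v F f) \<le> nrm (f - (\<Sum>i\<in>F. c i \<odot> v i))"
proof (rule power2_le_imp_le)
  let ?p = "proj v F f" and ?q = "\<Sum>i\<in>F. c i \<odot> v i"
  have p: "?p \<in> S" using assms by blast
  have q: "?q \<in> S" using assms by (auto dest: orthonormalD)
  have "ip (f - ?p) (?p - ?q) = ip (f - ?p) ?p - ip (f - ?p) ?q"
    using assms p q by (intro ip_diff_right) auto
  also have "\<dots> = 0"
    using ip_residual_sum[OF assms, of c] ip_residual_sum[OF assms, of "\<lambda>i. ip f (v i)"] by (simp add: proj_def)
  finally have "(nrm ((f - ?p) + (?p - ?q)))\<^sup>2 = (nrm (f - ?p))\<^sup>2 + (nrm (?p - ?q))\<^sup>2"
    using assms p q by (subst nrm_add_sq) auto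
  then show "(nrm (f - ?p))\<^sup>2 \<le> (nrm (f - ?q))\<^sup>2" by simp
  show "0 \<le> nrm (f - ?q)" using assms q by auto
qed

text \<open>One good finite combination suffices: the projection is the best approximation with the
  same index set, and enlarging the set cannot increase the residual.\<close>

lemma residual_tendsto_zeroI:
  assumes "orthonormal I v" "f \<in> S"
    and "\<And>e. e > 0 \<Longrightarrow> \<exists>F c. finite F \<and> F \<subseteq> I \<and> nrm (f - (\<Sum>i\<in>F. c i \<odot> v i)) < e"
  shows "((\<lambda>F. nrm (f - proj v F f)) \<longlongrightarrow> 0) (finite_subsets_at_top I)"
proof (rule tendstoI)
  fix e :: real assume "e > 0"
  then obtain F c where F: "finite F" "F \<subseteq> I" "nrm (f - (\<Sum>i\<in>F. c i \<odot> v i)) < e"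
    using assms(3) by blast
  have "dist (nrm (f - proj v G f)) 0 < e" if "finite G" "F \<subseteq> G" "G \<subseteq> I" for G
  proof -
    have "nrm (f - proj v G f) \<le> nrm (f - proj v F f)"
      using that assms by (intro residual_antimono[of I])
    also have "\<dots> \<le> nrm (f - (\<Sum>i\<in>F. c i \<odot> v i))"
      using F assms by (intro residual_minimal[of I])
    finally show ?thesis using F that assms(2) proj_in[OF assms(1) that(3), of f] by (simp add: dist_real_def)
  qed
  then show "\<forall>\<^sub>F G in finite_subsets_at_top I. dist (nrm (f - proj v G f)) 0 < e"
    unfolding eventually_finite_subsets_at_top using F by blast
qed

text \<open>Cauchy--Schwarz bounds the truncation error by the residual of \<open>f\<close> times
  \<open>nrm g\<close>, so it is enough that one of the two factors lies in the closed span;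
  \<open>ip_has_sum_right\<close> is the version for the other factor.\<close>

lemma ip_has_sum:
  assumes "orthonormal I v" "f \<in> S" "g \<in> S"
    and "((\<lambda>F. nrm (f - proj v F f)) \<longlongrightarrow> 0) (finite_subsets_at_top I)"
  shows "((\<lambda>i. ip f (v i) * ip (v i) g) has_sum ip f g) I"
  unfolding has_sum_def
proof (rule Lim_transform2[OF tendsto_const[of "ip f g"]])
  have "((\<lambda>F. nrm (f - proj v F f) * nrm g) \<longlongrightarrow> 0) (finite_subsets_at_top I)"
    using tendsto_mult_left_zero[OF assms(4)] by simp
  moreover have "\<forall>\<^sub>F F in finite_subsets_at_top I. 
        norm (ip f g - (\<Sum>i\<in>F. ip f (v i) * ip (v i) g)) \<le> nrm (f - proj v F f) * nrm g"
    proof (rule eventually_finite_subsets_at_top_weakI)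
      fix F assume F: "finite F" "F \<subseteq> I"
      then have "ip f g - (\<Sum>i\<in>F. ip f (v i) * ip (v i) g) = ip (f - proj v F f) g"
        using assms F by (subst ip_diff_left) (auto simp: ip_proj_left)
      then show "norm (ip f g - (\<Sum>i\<in>F. ip f (v i) * ip (v i) g)) \<le> nrm (f - proj v F f) * nrm g"
        using assms F by (auto intro!: cauchy_schwarz)
    qed
  ultimately show "((\<lambda>F. ip f g - (\<Sum>i\<in>F. ip f (v i) * ip (v i) g)) \<longlongrightarrow> 0) (finite_subsets_at_top I)"
    by (rule Lim_null_comparison[rotated])
qed

lemma ip_has_sum_right:
  assumes v: "orthonormal I v" and f: "f \<in> S" and g: "g \<in> S"
    and lim: "((\<lambda>F. nrm (g - proj v F g)) \<longlongrightarrow> 0) (finite_subsets_at_top I)"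
  shows "((\<lambda>i. ip f (v i) * ip (v i) g) has_sum ip f g) I"
proof -
  have *: "cnj (ip g (v i) * ip (v i) f) = ip f (v i) * ip (v i) g" if "i \<in> I" for i
    using ip_commute[OF orthonormalD(1)[OF v that] f] ip_commute[OF g orthonormalD(1)[OF v that]] by simp
  have "((\<lambda>i. cnj (ip g (v i) * ip (v i) f)) has_sum cnj (ip g f)) I"
    using ip_has_sum[OF v g f lim] by (simp only: has_sum_cnj_iff)
  from iffD1[OF has_sum_cong[OF *] this] show ?thesis
    using ip_commute[OF g f] by simp
qed

lemma proj_diff:
  assumes "orthonormal I v" "F \<subseteq> I" "f \<in> S" "g \<in> S"
  shows "proj v F (f - g) = proj v F f - proj v F g"
  unfolding proj_def sum_subtractf[symmetric]
proof (rule sum.cong)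
  fix i assume "i \<in> F"
  then have "v i \<in> S" using assms by (auto dest: orthonormalD)
  then show "ip (f - g) (v i) \<odot> v i = ip f (v i) \<odot> v i - ip g (v i) \<odot> v i"
    using assms by (simp add: ip_diff_left scale_left_diff_distrib)
qed simp

text \<open>With residuals in both arguments, the truncation error is estimated by a product of two
  norms; this is what \<open>kernel_expansion_error\<close> exploits.\<close>

lemma ip_residuals:
  assumes "orthonormal I v" "finite F" "F \<subseteq> I" "f \<in> S" "g \<in> S"
  shows "ip (f - proj v F f) (g - proj v F g) = ip f g - (\<Sum>i\<in>F. ip f (v i) * ip (v i) g)"
proof -
  have p: "proj v F f \<in> S" "proj v F g \<in> S" using assms by blast+
  have "ip (f - proj v F f) (proj v F g) = 0"
    using ip_residual_sum[OF assms(1-4), of "\<lambda>i. ip g (v i)"] by (simp add: proj_def[of v F g])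
  then show ?thesis
    using assms p by (simp add: ip_diff_right[of g "proj v F g"] ip_diff_left[of f "proj v F f" g] ip_proj_left)
qed

lemma parseval:
  assumes "orthonormal I v" "f \<in> S"
    and "((\<lambda>F. nrm (f - proj v F f)) \<longlongrightarrow> 0) (finite_subsets_at_top I)"
  shows "((\<lambda>i. (cmod (ip f (v i)))\<^sup>2) has_sum (nrm f)\<^sup>2) I"
proof -
  have *: "ip f (v i) * ip (v i) f = complex_of_real ((cmod (ip f (v i)))\<^sup>2)" if "i \<in> I" for i
    using ip_commute[of f "v i"] assms that orthonormalD(1)[OF assms(1) that] by (simp add: mult_cnj_cmod)
  have "((\<lambda>i. complex_of_real ((cmod (ip f (v i)))\<^sup>2)) has_sum complex_of_real ((nrm f)\<^sup>2)) I"
    using iffD1[OF has_sum_cong[OF *] ip_has_sum[OF assms(1,2,2,3)]] by (simp only: ip_self[OF assms(2)])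
  then show ?thesis using has_sum_Re by fastforce
qed

end

section \<open>Riesz--Fischer and orthogonal decomposition\<close>

locale semi_hilbert = semi_inner +
  assumes complete: "(\<And>k. s k \<in> S) \<Longrightarrow>
       (\<And>e. e > 0 \<Longrightarrow> \<exists>N::nat. \<forall>k\<ge>N. \<forall>m\<ge>N. nrm (s k - s m) < e) \<Longrightarrow>
       \<exists>f\<in>S. (\<lambda>k. nrm (s k - f)) \<longlonglongrightarrow> 0"
begin

text \<open>Completeness speaks of sequences, while \<open>I\<close> is arbitrary. Finite sets
  \<open>F n\<close> outside which all finite sums of squared coefficients are below
  \<open>1 / (n + 1)^2\<close> give a Cauchy sequence of partial sums, and its limit
  \<open>p\<close> is also the limit along all finite sets. As the form is semidefinite,
  \<open>p\<close> is determined only up to a vector of norm zero.\<close>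

lemma riesz_fischer:
  assumes v: "orthonormal I v" and c: "(\<lambda>i. (cmod (c i))\<^sup>2) summable_on I"
  obtains p where "p \<in> S" "\<And>i. i \<in> I \<Longrightarrow> ip p (v i) = c i"
    "((\<lambda>F. nrm (p - proj v F p)) \<longlongrightarrow> 0) (finite_subsets_at_top I)"
proof -
  define P where "P n F \<longleftrightarrow> finite F \<and> F \<subseteq> I \<and>
    (\<forall>G. finite G \<and> G \<subseteq> I \<and> G \<inter> F = {} \<longrightarrow> (\<Sum>i\<in>G. (cmod (c i))\<^sup>2) < (1 / real (Suc n))\<^sup>2)" for n F
  have "\<exists>F. P n F" for n
    unfolding P_def by (rule summable_on_small_tail[OF c]) simp
  then obtain F0 where "\<And>n. P n (F0 n)" by metis
  then have F0: "\<And>n. finite (F0 n)" "\<And>n. F0 n \<subseteq> I"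
    "\<And>n G. finite G \<Longrightarrow> G \<subseteq> I \<Longrightarrow> G \<inter> F0 n = {} \<Longrightarrow> (\<Sum>i\<in>G. (cmod (c i))\<^sup>2) < (1 / real (Suc n))\<^sup>2"
    unfolding P_def by simp_all
  \<comment> \<open>Unions make the sets nested, as the Cauchy estimate needs.\<close>
  define F where "F n = (\<Union>k\<le>n. F0 k)" for n
  define s where "s G = (\<Sum>i\<in>G. c i \<odot> v i)" for G
  have F: "finite (F n)" "F n \<subseteq> I" "F0 n \<subseteq> F n" for n
    using F0 by (auto simp: F_def)
  have F_mono: "F m \<subseteq> F n" if "m \<le> n" for m n
    using that by (force simp: F_def)
  have sS: "s G \<in> S" if "G \<subseteq> I" for G
    unfolding s_def using v that by (intro S_sum) (auto dest: orthonormalD)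
  have close: "nrm (s G - s (F n)) < 1 / Suc n" if "finite G" "F n \<subseteq> G" "G \<subseteq> I" for n G
  proof (rule power2_less_imp_less)
    have "s G - s (F n) = s (G - F n)"
      unfolding s_def using that F by (simp add: sum_diff)
    moreover have "(nrm (s (G - F n)))\<^sup>2 = (\<Sum>i\<in>G - F n. (cmod (c i))\<^sup>2)"
      unfolding s_def using v that by (intro nrm_sq_orthonormal_sum) auto
    ultimately show "(nrm (s G - s (F n)))\<^sup>2 < (1 / Suc n)\<^sup>2"
      using F0(3)[of "G - F n" n] that F[of n] by (metis Diff_disjoint Diff_subset disjoint_iff finite_Diff subset_iff)
  qed simp
  have small: "\<exists>n. 1 / real (Suc n) < e" if "e > 0" for e
    using that reals_Archimedean[of e] by (auto simp: inverse_eq_divide)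
  have cauchy: "\<exists>N. \<forall>k\<ge>N. \<forall>m\<ge>N. nrm (s (F k) - s (F m)) < e" if "e > 0" for e
  proof -
    obtain n where n: "1 / real (Suc n) < e / 2" using small[of "e / 2"] \<open>e > 0\<close> by auto
    have "nrm (s (F k) - s (F m)) < e" if "k \<ge> n" "m \<ge> n" for k m
      using close[of "F k" n] close[of "F m" n] F F_mono[OF that(1)] F_mono[OF that(2)] n sS
        nrm_triangle_diff[of "s (F k)" "s (F n)" "s (F m)"] nrm_minus_commute[of "s (F m)" "s (F n)"]
      by simp
    then show ?thesis by blast
  qed
  have "\<exists>p\<in>S. (\<lambda>k. nrm (s (F k) - p)) \<longlonglongrightarrow> 0"
    using sS[OF F(2)] cauchy by (rule complete)
  then obtain p where p: "p \<in> S" "(\<lambda>k. nrm (s (F k) - p)) \<longlonglongrightarrow> 0"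
    by blast
  \<comment> \<open>From the sequence to the net: all partial sums over sets containing
    \<open>F n\<close> stay within \<open>1 / (n + 1)\<close> of \<open>s (F n)\<close>, and so does
    a late \<open>s (F k)\<close>, which is already close to \<open>p\<close>.\<close>
  have lim: "\<exists>G0. finite G0 \<and> G0 \<subseteq> I \<and> (\<forall>G. finite G \<and> G0 \<subseteq> G \<and> G \<subseteq> I \<longrightarrow> nrm (p - s G) < e)" if "e > 0" for e
  proof -
    obtain n where n: "1 / real (Suc n) < e / 3" using small[of "e / 3"] \<open>e > 0\<close> by auto
    have "\<forall>\<^sub>F k in sequentially. dist (nrm (s (F k) - p)) 0 < e / 3"
      using p(2) \<open>e > 0\<close> by (intro tendstoD) auto
    then obtain k0 where k0: "\<And>k. k \<ge> k0 \<Longrightarrow> nrm (s (F k) - p) < e / 3"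
      unfolding eventually_sequentially using p F sS by (auto simp: dist_real_def)
    define k where "k = max n k0"
    have k: "k \<ge> n" "nrm (s (F k) - p) < e / 3"
      using k0[of k] by (auto simp: k_def)
    have "nrm (p - s G) < e" if G: "finite G" "F n \<subseteq> G" "G \<subseteq> I" for G
    proof -
      have "nrm (p - s G) \<le> nrm (p - s (F k)) + (nrm (s (F k) - s (F n)) + nrm (s (F n) - s G))"
        using p sS F G nrm_triangle_diff[of p "s (F k)" "s G"] nrm_triangle_diff[of "s (F k)" "s (F n)" "s G"]
        by simp
      also have "\<dots> < e"
        using close[of G n] close[of "F k" n] G F F_mono[OF k(1)] n k p sS
          nrm_minus_commute[of p "s (F k)"] nrm_minus_commute[of "s (F n)" "s G"] by simp
      finally show ?thesis .
    qed
    then show ?thesis using F[of n] by blast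
  qed
  have coeff: "ip p (v i) = c i" if i: "i \<in> I" for i
  proof (rule ccontr)
    assume "ip p (v i) \<noteq> c i"
    then obtain G0 where G0: "finite G0" "G0 \<subseteq> I" 
      "\<And>G. finite G \<Longrightarrow> G0 \<subseteq> G \<Longrightarrow> G \<subseteq> I \<Longrightarrow> nrm (p - s G) < cmod (ip p (v i) - c i)"
      using lim[of "cmod (ip p (v i) - c i)"] by auto
    \<comment> \<open>Adding \<open>i\<close> makes the coefficient of \<open>s ?G\<close> at
      \<open>i\<close> exactly \<open>c i\<close>.\<close>
    let ?G = "insert i G0"
    have vi: "v i \<in> S" using v i by (auto dest: orthonormalD)
    have "ip (p - s ?G) (v i) = ip p (v i) - ip (s ?G) (v i)"
      using p sS[of ?G] G0 i vi by (intro ip_diff_left) auto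
    also have "ip (s ?G) (v i) = c i"
      unfolding s_def using ip_orthonormal_sum[OF v, of ?G i] G0 i by auto
    finally have "cmod (ip p (v i) - c i) \<le> nrm (p - s ?G) * nrm (v i)"
      using p sS[of ?G] G0 i vi cauchy_schwarz[of "p - s ?G" "v i"] by auto
    moreover have "nrm (v i) = 1"
      using orthonormalD(2)[OF v i i] by (simp add: nrm_def)
    moreover have "nrm (p - s ?G) < cmod (ip p (v i) - c i)"
      using G0(1,2) i by (intro G0(3)) auto
    ultimately show False by simp
  qed
  have proj_eq: "proj v G p = s G" if "G \<subseteq> I" for G
    unfolding proj_def s_def using coeff that by (intro sum.cong) auto
  have "((\<lambda>F. nrm (p - proj v F p)) \<longlongrightarrow> 0) (finite_subsets_at_top I)"
  proof (rule residual_tendsto_zeroI[OF v p(1)])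
    fix e :: real assume "e > 0"
    then show "\<exists>F c. finite F \<and> F \<subseteq> I \<and> nrm (p - (\<Sum>i\<in>F. c i \<odot> v i)) < e"
      using lim[of e] unfolding s_def by blast
  qed
  then show ?thesis using that p(1) coeff by blast
qed

text \<open>\<open>p\<close> is the projection onto the closed span: Bessel's inequality makes the
  coefficients of \<open>f\<close> square summable, and \<open>riesz_fischer\<close> turns them into
  a vector. Having the coefficients of \<open>f\<close>, it has the same finite projections.\<close>

lemma orthogonal_decomposition:
  assumes v: "orthonormal I v" and f: "f \<in> S"
  obtains p where "p \<in> S" "\<And>i. i \<in> I \<Longrightarrow> ip (f - p) (v i) = 0"
    "\<And>F. F \<subseteq> I \<Longrightarrow> proj v F p = proj v F f"
    "((\<lambda>F. nrm (p - proj v F p)) \<longlongrightarrow> 0) (finite_subsets_at_top I)"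
proof -
  have "(\<lambda>i. (cmod (ip f (v i)))\<^sup>2) summable_on I"
  proof (rule nonneg_bdd_above_summable_on)
    show "bdd_above (sum (\<lambda>i. (cmod (ip f (v i)))\<^sup>2) ` {F. F \<subseteq> I \<and> finite F})"
      using bessel[OF v _ _ f] by (intro bdd_aboveI[of _ "(nrm f)\<^sup>2"]) auto
  qed simp
  then obtain p where p: "p \<in> S" "\<And>i. i \<in> I \<Longrightarrow> ip p (v i) = ip f (v i)"
    "((\<lambda>F. nrm (p - proj v F p)) \<longlongrightarrow> 0) (finite_subsets_at_top I)"
    using riesz_fischer[OF v, of "\<lambda>i. ip f (v i)"] by metis
  moreover have "ip (f - p) (v i) = 0" if "i \<in> I" for i
    using p f v that by (subst ip_diff_left) (auto dest: orthonormalD)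
  moreover have "proj v F p = proj v F f" if "F \<subseteq> I" for F
    unfolding proj_def using p that by (intro sum.cong) auto
  ultimately show ?thesis using that by blast
qed

text \<open>The test for lying in the closed span on which the later completeness proofs rest. With
  \<open>p\<close> the projection of \<open>f\<close>, the hypothesis is applied to
  \<open>w = f - p\<close>, which is orthogonal to \<open>p\<close> as well; hence
  \<open>nrm (f - p) = 0\<close>, which is enough although \<open>f = p\<close> may fail.\<close>

lemma residual_tendsto_zero_if_orthogonal:
  assumes v: "orthonormal I v" and f: "f \<in> S"
    and orth: "\<And>w. w \<in> S \<Longrightarrow> (\<And>i. i \<in> I \<Longrightarrow> ip w (v i) = 0) \<Longrightarrow> ip w f = 0"
  shows "((\<lambda>F. nrm (f - proj v F f)) \<longlongrightarrow> 0) (finite_subsets_at_top I)"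
proof -
  obtain p where p: "p \<in> S" "\<And>i. i \<in> I \<Longrightarrow> ip (f - p) (v i) = 0"
    "\<And>F. F \<subseteq> I \<Longrightarrow> proj v F p = proj v F f"
    "((\<lambda>F. nrm (p - proj v F p)) \<longlongrightarrow> 0) (finite_subsets_at_top I)"
    using orthogonal_decomposition[OF v f] by metis
  have wS: "f - p \<in> S" using f p by blast
  have "((\<lambda>i. ip p (v i) * ip (v i) (f - p)) has_sum 0) I"
  proof (rule has_sum_0)
    fix i assume i: "i \<in> I"
    show "ip p (v i) * ip (v i) (f - p) = 0"
      using ip_commute[OF wS orthonormalD(1)[OF v i]] p(2)[OF i] by simp
  qed
  then have "ip p (f - p) = 0"
    using ip_has_sum[OF v p(1) wS p(4)] has_sum_unique by blast
  then have "ip (f - p) p = 0" using ip_commute[OF p(1) wS] by simp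
  then have "ip (f - p) (f - p) = 0"
    using orth[OF wS p(2)] f p(1) wS by (simp add: ip_diff_right)
  then have 0: "nrm (f - p) = 0" by (simp add: nrm_def)
  show ?thesis
  proof (rule Lim_null_comparison[OF _ p(4)])
    show "\<forall>\<^sub>F F in finite_subsets_at_top I. norm (nrm (f - proj v F f)) \<le> nrm (p - proj v F p)"
    proof (rule eventually_finite_subsets_at_top_weakI)
      fix F assume "F \<subseteq> I"
      then have "proj v F f \<in> S" using v by blast
      then show "norm (nrm (f - proj v F f)) \<le> nrm (p - proj v F p)"
        using nrm_triangle_diff[of f p "proj v F f"] p(1) p(3)[of F] f 0 \<open>F \<subseteq> I\<close> by simp
    qed
  qed
qed

end

section \<open>Gram--Schmidt, weak compactness and the spectral theorem\<close>

context semi_inner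
begin

text \<open>Linearly dependent vectors are sent to \<open>0\<close>, because of \<open>1 / 0 = 0\<close>.\<close>

fun gram_schmidt :: "(nat \<Rightarrow> 'v) \<Rightarrow> nat \<Rightarrow> 'v" where
  "gram_schmidt w n = (let u = w n - (\<Sum>m\<in>{..<n}. ip (w n) (gram_schmidt w m) \<odot> gram_schmidt w m)
     in complex_of_real (1 / nrm u) \<odot> u)"

declare gram_schmidt.simps [simp del]

text \<open>The approximation is exact only in norm, because \<open>u n\<close> may be a nonzero
  vector of norm zero; then \<open>e n = 0\<close> and \<open>n\<close> is left out of
  \<open>J\<close>. Membership in the span is recorded for \<open>measurable_H\<close> and for the
  isometry between spans of sections.\<close>

lemma orthonormal_gram_schmidt:
  assumes w: "\<And>n. w n \<in> S"
  defines "e \<equiv> gram_schmidt w"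
  obtains J where "orthonormal J e" "\<And>k. e k \<in> span (range w)"
    "\<And>n. \<exists>F c. finite F \<and> F \<subseteq> J \<and> nrm (w n - (\<Sum>i\<in>F. c i \<odot> e i)) = 0"
proof -
  define J where "J = {k. e k \<noteq> 0}"
  define u where "u n = w n - (\<Sum>m\<in>{..<n}. ip (w n) (e m) \<odot> e m)" for n
  have e_u: "e n = complex_of_real (1 / nrm (u n)) \<odot> u n" for n
    unfolding e_def u_def by (subst gram_schmidt.simps) (simp add: Let_def)
  have *: "e n \<in> S \<and> e n \<in> span (range w) \<and> orthonormal (J \<inter> {..n}) e" for n
  proof (induction n rule: less_induct)
    case (less n)
    have orth: "orthonormal (J \<inter> {..<n}) e"
      unfolding orthonormal_def
    proof (intro conjI ballI)
      fix i assume "i \<in> J \<inter> {..<n}" then show "e i \<in> S" using less by blast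
      fix k assume "k \<in> J \<inter> {..<n}"
      then show "ip (e i) (e k) = (if i = k then 1 else 0)"
        using \<open>i \<in> J \<inter> {..<n}\<close> less[of "max i k"] unfolding orthonormal_def by auto
    qed
    have uS: "u n \<in> S"
      unfolding u_def using w less by (intro S_diff S_sum) auto
    then have eS: "e n \<in> S" unfolding e_u by blast
    have "u n \<in> span (range w)"
      unfolding u_def by (rule span_diff[OF span_base span_sum[OF span_scale]]) (use less in auto)
    then have "e n \<in> span (range w)" unfolding e_u by (rule span_scale)
    moreover have u_proj: "u n = w n - proj e (J \<inter> {..<n}) (w n)"
      unfolding u_def proj_def by (intro arg_cong[of _ _ "\<lambda>x. w n - x"] sum.mono_neutral_right) (auto simp: J_def)
    have "ip (u n) (e k) = 0" if "k \<in> J" "k < n" for k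
      unfolding u_proj using orth that w by (intro ip_residual_left[OF orth]) auto
    then have ip1: "ip (e n) (e k) = 0" if "k \<in> J" "k < n" for k
      unfolding e_u[of n] using that uS less[of k] by (subst ip_scale_left) auto
    have ip2: "ip (e k) (e n) = 0" if "k \<in> J" "k < n" for k
      using ip1[OF that] that less[of k] eS ip_commute[of "e n" "e k"] by simp
    have ip3: "ip (e n) (e n) = 1" if "n \<in> J"
    proof -
      have "nrm (u n) \<noteq> 0" using that unfolding J_def by (auto simp: e_u)
      then have "nrm (e n) = 1" unfolding e_u using uS by (subst nrm_scale) (auto simp: norm_divide)
      then show ?thesis using eS by (simp add: ip_self)
    qed
    have "orthonormal (J \<inter> {..n}) e"
      unfolding orthonormal_def
    proof (intro conjI ballI)
      fix i assume i: "i \<in> J \<inter> {..n}" then show "e i \<in> S" using less eS by (cases "i = n") auto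
      fix k assume k: "k \<in> J \<inter> {..n}"
      show "ip (e i) (e k) = (if i = k then 1 else 0)"
        using i k ip1[of k] ip2[of i] ip3 orthonormalD(2)[OF orth, of i k] by (cases "i = n"; cases "k = n") auto
    qed
    then show ?case using eS \<open>e n \<in> span (range w)\<close> by blast
  qed
  have orth: "orthonormal J e"
    unfolding orthonormal_def
  proof (intro conjI ballI)
    fix i assume "i \<in> J" show "e i \<in> S" using * by blast
    fix k assume "k \<in> J"
    then show "ip (e i) (e k) = (if i = k then 1 else 0)"
      using \<open>i \<in> J\<close> *[of "max i k"] unfolding orthonormal_def by auto
  qed
  have "\<exists>F c. finite F \<and> F \<subseteq> J \<and> nrm (w n - (\<Sum>i\<in>F. c i \<odot> e i)) = 0" for n
  proof -
    have uS: "u n \<in> S"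
      unfolding u_def using w * by (intro S_diff S_sum) auto
    have u_proj: "u n = w n - proj e (J \<inter> {..<n}) (w n)"
      unfolding u_def proj_def by (intro arg_cong[of _ _ "\<lambda>x. w n - x"] sum.mono_neutral_right) (auto simp: J_def)
    show ?thesis
    proof (cases "nrm (u n) = 0")
      case True
      then show ?thesis unfolding u_proj proj_def by (intro exI[of _ "J \<inter> {..<n}"]) auto
    next
      case False
      \<comment> \<open>Here \<open>n\<close> belongs to \<open>J\<close>, and the residual itself
        is the missing multiple of \<open>e n\<close>.\<close>
      have un: "u n = complex_of_real (nrm (u n)) \<odot> e n" unfolding e_u using False by simp
      then have nJ: "n \<in> J" unfolding J_def using False by auto
      define c where "c i = (if i = n then complex_of_real (nrm (u n)) else ip (w n) (e i))" for i
      have "(\<Sum>i\<in>insert n (J \<inter> {..<n}). c i \<odot> e i) = c n \<odot> e n + (\<Sum>i\<in>J \<inter> {..<n}. c i \<odot> e i)"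
        by (intro sum.insert) auto
      also have "(\<Sum>i\<in>J \<inter> {..<n}. c i \<odot> e i) = proj e (J \<inter> {..<n}) (w n)"
        unfolding proj_def by (intro sum.cong) (auto simp: c_def)
      also have "c n \<odot> e n + proj e (J \<inter> {..<n}) (w n) = w n"
        using un u_proj by (simp add: c_def)
      finally show ?thesis
        using nJ by (intro exI[of _ "insert n (J \<inter> {..<n})"] exI[of _ c]) auto
    qed
  qed
  then show ?thesis using that orth * by blast
qed

lemma orthonormal_nrm: "orthonormal I v \<Longrightarrow> i \<in> I \<Longrightarrow> nrm (v i) = 1"
  by (simp add: nrm_def orthonormalD(2))

lemma orthonormal_sequence_of_countable:
  assumes "countable A" "A \<subseteq> S"
  obtains J and e :: "nat \<Rightarrow> 'v" where "orthonormal J e" "\<And>k. e k \<in> span A"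
    "\<And>a. a \<in> A \<Longrightarrow> \<exists>F c. finite F \<and> F \<subseteq> J \<and> nrm (a - (\<Sum>i\<in>F. c i \<odot> e i)) = 0"
proof (cases "A = {}")
  case True
  then show ?thesis using that[of "{}" "\<lambda>_. 0"] by (simp add: orthonormal_def)
next
  case False
  have w: "from_nat_into A n \<in> S" for n using assms(2) from_nat_into[OF False] by blast
  obtain J where J: "orthonormal J (gram_schmidt (from_nat_into A))"
    "\<And>k. gram_schmidt (from_nat_into A) k \<in> span (range (from_nat_into A))"
    "\<And>n. \<exists>F c. finite F \<and> F \<subseteq> J \<and> nrm (from_nat_into A n - (\<Sum>i\<in>F. c i \<odot> gram_schmidt (from_nat_into A) i)) = 0"
    by (rule orthonormal_gram_schmidt[of "from_nat_into A", OF w]) blast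
  have range: "range (from_nat_into A) = A" by (rule range_from_nat_into[OF False assms(1)])
  show ?thesis
  proof (rule that[OF J(1)])
    show "gram_schmidt (from_nat_into A) k \<in> span A" for k using J(2)[of k] unfolding range .
    fix a assume "a \<in> A"
    then obtain n where "a = from_nat_into A n" using range by blast
    then show "\<exists>F c. finite F \<and> F \<subseteq> J \<and> nrm (a - (\<Sum>i\<in>F. c i \<odot> gram_schmidt (from_nat_into A) i)) = 0"
      using J(3)[of n] by simp
  qed
qed

text \<open>By Bessel's inequality each \<open>e k\<close> has only countably many nonzero
  coefficients along \<open>U\<close>, and every \<open>u\<close> in \<open>U\<close>, having norm
  1, has a nonzero inner product with some \<open>e k\<close>.\<close>

lemma countable_orthonormal_set:
  assumes U: "orthonormal U (\<lambda>u. u)" and e: "orthonormal J e" and "countable J"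
    and dense: "\<And>f. f \<in> S \<Longrightarrow> ((\<lambda>F. nrm (f - proj e F f)) \<longlongrightarrow> 0) (finite_subsets_at_top J)"
  shows "countable U"
proof -
  have "countable {u \<in> U. (cmod (ip (e k) u))\<^sup>2 \<noteq> 0}" if "k \<in> J" for k
  proof (rule summable_countable_real, rule nonneg_bdd_above_summable_on)
    have "e k \<in> S" using e that by (auto dest: orthonormalD)
    then show "bdd_above (sum (\<lambda>u. (cmod (ip (e k) u))\<^sup>2) ` {F. F \<subseteq> U \<and> finite F})"
      using bessel[OF U] by (intro bdd_aboveI[of _ "(nrm (e k))\<^sup>2"]) auto
  qed simp
  then have "countable (\<Union>k\<in>J. {u \<in> U. (cmod (ip (e k) u))\<^sup>2 \<noteq> 0})"
    using \<open>countable J\<close> by auto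
  moreover have "U \<subseteq> (\<Union>k\<in>J. {u \<in> U. (cmod (ip (e k) u))\<^sup>2 \<noteq> 0})"
  proof
    fix u assume u: "u \<in> U"
    then have uS: "u \<in> S" using U by (auto dest: orthonormalD)
    have "\<exists>k\<in>J. ip (e k) u \<noteq> 0"
    proof (rule ccontr)
      assume "\<not> ?thesis"
      then have "((\<lambda>i. ip u (e i) * ip (e i) u) has_sum 0) J"
        by (intro has_sum_0) auto
      then have "ip u u = 0"
        using ip_has_sum[OF e uS uS dense[OF uS]] has_sum_unique by blast
      moreover have "ip u u = 1" using orthonormalD(2)[OF U u u] by simp
      ultimately show False by simp
    qed
    then show "u \<in> (\<Union>k\<in>J. {u \<in> U. (cmod (ip (e k) u))\<^sup>2 \<noteq> 0})" using u by auto
  qed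
  ultimately show ?thesis by (rule countable_subset[rotated])
qed

end

section \<open>Weak sequential compactness and compact positive operators\<close>

context semi_hilbert
begin

text \<open>The coefficients along a countable basis are bounded, so on a diagonal subsequence each
  of them converges. By Bessel's inequality the squares of the limits sum to at most 1, so the
  limits are the coefficients of a vector \<open>p\<close> of the unit ball. Convergence extends to
  every \<open>g\<close> because finite projections approximate \<open>g\<close> while the
  \<open>h n\<close> stay bounded.\<close>

lemma weakly_convergent_subsequence:
  fixes J :: "'i set"
  assumes e: "orthonormal J e" and "countable J"
    and dense: "\<And>f. f \<in> S \<Longrightarrow> ((\<lambda>F. nrm (f - proj e F f)) \<longlongrightarrow> 0) (finite_subsets_at_top J)"
    and h: "\<And>n::nat. h n \<in> S" "\<And>n. nrm (h n) \<le> 1"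
  obtains r p where "strict_mono r" "p \<in> S" "nrm p \<le> 1" "\<And>g. g \<in> S \<Longrightarrow> (\<lambda>n. ip (h (r n)) g) \<longlonglongrightarrow> ip p g"
proof -
  have bound: "norm (ip (h n) (e k)) \<le> 1" if "k \<in> J" for n k
    using cauchy_schwarz[of "h n" "e k"] h orthonormalD(1)[OF e that] orthonormal_nrm[OF e that] 
    by (metis mult.right_neutral order_trans)
  obtain r where r: "strict_mono r" "\<And>k. k \<in> J \<Longrightarrow> \<exists>l. (\<lambda>n. ip (h (r n)) (e k)) \<longlonglongrightarrow> l"
    using function_convergent_subsequence[OF \<open>countable J\<close>, of "\<lambda>n k. ip (h n) (e k)" 1] bound by blast
  then obtain c where c: "\<And>k. k \<in> J \<Longrightarrow> (\<lambda>n. ip (h (r n)) (e k)) \<longlonglongrightarrow> c k"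
    by metis
  have c_sum: "(\<Sum>k\<in>F. (cmod (c k))\<^sup>2) \<le> 1" if "finite F" "F \<subseteq> J" for F
  proof (rule LIMSEQ_le_const2)
    show "(\<lambda>n. \<Sum>k\<in>F. (cmod (ip (h (r n)) (e k)))\<^sup>2) \<longlonglongrightarrow> (\<Sum>k\<in>F. (cmod (c k))\<^sup>2)"
      using that c by (intro tendsto_sum tendsto_power tendsto_norm) auto
    have "(\<Sum>k\<in>F. (cmod (ip (h (r n)) (e k)))\<^sup>2) \<le> 1" for n
    proof -
      have "(nrm (h (r n)))\<^sup>2 \<le> 1" using h by (simp add: power_le_one)
      then show ?thesis using bessel[OF e that, of "h (r n)"] h by (smt (verit))
    qed
    then show "\<exists>N. \<forall>n\<ge>N. (\<Sum>k\<in>F. (cmod (ip (h (r n)) (e k)))\<^sup>2) \<le> 1" by blast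
  qed
  have "(\<lambda>k. (cmod (c k))\<^sup>2) summable_on J"
    by (rule nonneg_bdd_above_summable_on) (use c_sum in \<open>auto intro!: bdd_aboveI[of _ 1]\<close>)
  then obtain p where p: "p \<in> S" "\<And>k. k \<in> J \<Longrightarrow> ip p (e k) = c k"
    "((\<lambda>F. nrm (p - proj e F p)) \<longlongrightarrow> 0) (finite_subsets_at_top J)"
    using riesz_fischer[OF e, of c] by metis
  have "(nrm p)\<^sup>2 \<le> 1"
  proof (rule has_sum_le_finite_sums[OF parseval[OF e p(1,3)]])
    fix F assume "finite F" "F \<subseteq> J"
    then have "(\<Sum>k\<in>F. (cmod (ip p (e k)))\<^sup>2) = (\<Sum>k\<in>F. (cmod (c k))\<^sup>2)"
      using p(2) by (intro sum.cong) auto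
    then show "(\<Sum>k\<in>F. (cmod (ip p (e k)))\<^sup>2) \<le> 1" using c_sum[of F] \<open>finite F\<close> \<open>F \<subseteq> J\<close> by simp
  qed
  then have p1: "nrm p \<le> 1" using power2_le_imp_le[of "nrm p" 1] by simp
  have "(\<lambda>n. ip (h (r n)) g) \<longlonglongrightarrow> ip p g" if g: "g \<in> S" for g
  proof (rule tendstoI)
    fix \<epsilon> :: real assume \<epsilon>: "\<epsilon> > 0"
    have "\<forall>\<^sub>F F in finite_subsets_at_top J. dist (nrm (g - proj e F g)) 0 < \<epsilon> / 3"
      using dense[OF g] \<epsilon> by (intro tendstoD) auto
    then obtain F where F: "finite F" "F \<subseteq> J" "dist (nrm (g - proj e F g)) 0 < \<epsilon> / 3"
      unfolding eventually_finite_subsets_at_top by blast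
    define q where "q = proj e F g"
    have q: "q \<in> S" "nrm (g - q) < \<epsilon> / 3"
      using F proj_in[OF e F(2), of g] g by (auto simp: q_def dist_real_def)
    have eS: "e k \<in> S" if "k \<in> F" for k using e F that by (auto dest: orthonormalD)
    have "(\<lambda>n. ip (h (r n)) q) \<longlonglongrightarrow> ip p q"
    proof -
      have "ip f q = (\<Sum>k\<in>F. cnj (ip g (e k)) * ip f (e k))" if "f \<in> S" for f
        unfolding q_def proj_def using that eS by (intro ip_sum_right) auto
      moreover have "(\<lambda>n. \<Sum>k\<in>F. cnj (ip g (e k)) * ip (h (r n)) (e k)) \<longlonglongrightarrow> (\<Sum>k\<in>F. cnj (ip g (e k)) * ip p (e k))"
        using c p(2) F by (intro tendsto_sum tendsto_mult tendsto_const) auto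
      ultimately show ?thesis using h p by simp
    qed
    then have "\<forall>\<^sub>F n in sequentially. dist (ip (h (r n)) q) (ip p q) < \<epsilon> / 3"
      using \<epsilon> by (intro tendstoD) auto
    then show "\<forall>\<^sub>F n in sequentially. dist (ip (h (r n)) g) (ip p g) < \<epsilon>"
    proof eventually_elim
      case (elim n)
      have small: "cmod (ip f (g - q)) < \<epsilon> / 3" if "f \<in> S" "nrm f \<le> 1" for f
      proof -
        have "cmod (ip f (g - q)) \<le> nrm f * nrm (g - q)"
          using that g q by (intro cauchy_schwarz) auto
        also have "\<dots> \<le> 1 * nrm (g - q)"
          using that g q by (intro mult_right_mono) auto
        finally show ?thesis using q by simp
      qed
      have split: "ip f g = ip f (g - q) + ip f q" if "f \<in> S" for f
        using that g q by (simp add: ip_diff_right)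
      have "ip (h (r n)) g - ip p g = ip (h (r n)) (g - q) - ip p (g - q) + (ip (h (r n)) q - ip p q)"
        using split[of "h (r n)"] split[of p] h p by simp
      then have "cmod (ip (h (r n)) g - ip p g) \<le> cmod (ip (h (r n)) (g - q)) + cmod (ip p (g - q)) + cmod (ip (h (r n)) q - ip p q)"
        by (smt (verit) norm_triangle_ineq norm_triangle_ineq4)
      then show ?case
        using small[of "h (r n)"] small[of p] h p p1 elim by (simp add: dist_norm)
    qed
  qed
  then show ?thesis using that r p p1 by blast
qed

text \<open>A maximizer \<open>u\<close> of the Rayleigh quotient exists by compactness. If \<open>m\<close> is the maximum, then
  \<open>m \<langle>f, g\<rangle> - \<langle>T f, g\<rangle>\<close> is a semidefinite form vanishing at \<open>u\<close>, so by Cauchy--Schwarz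
  \<open>m u - T u\<close> is orthogonal to everything.\<close>

lemma eigenvector_of_compact_positive:
  assumes T: "\<And>f. f \<in> S \<Longrightarrow> T f \<in> S"
    and symm: "\<And>f g. f \<in> S \<Longrightarrow> g \<in> S \<Longrightarrow> ip (T f) g = ip f (T g)"
    and pos: "\<And>f. f \<in> S \<Longrightarrow> ip (T f) f \<in> \<real>\<^sub>\<ge>\<^sub>0"
    and definite: "\<And>f. f \<in> S \<Longrightarrow> nrm f = 0 \<Longrightarrow> f = 0"
    and W: "subspace W" "W \<subseteq> S" "\<And>f. f \<in> W \<Longrightarrow> T f \<in> W"
    and compact: "\<And>h. (\<And>n::nat. h n \<in> W) \<Longrightarrow> (\<And>n. nrm (h n) \<le> 1) \<Longrightarrow>
      \<exists>r p. strict_mono r \<and> p \<in> W \<and> nrm p \<le> 1 \<and> (\<lambda>n. Re (ip (T (h (r n))) (h (r n)))) \<longlonglongrightarrow> Re (ip (T p) p)"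
    and f: "f \<in> W" "ip (T f) f \<noteq> 0"
  shows "\<exists>u\<in>W. \<exists>m>0. ip u u = 1 \<and> T u = complex_of_real m \<odot> u"
proof -
  define q where "q f = Re (ip (T f) f)" for f
  define B where "B = {f \<in> W. nrm f \<le> 1}"
  have q_nonneg: "q f \<ge> 0" and ip_q: "ip (T f) f = complex_of_real (q f)" if "f \<in> S" for f
    using pos[OF that] by (auto simp: q_def elim!: nonneg_Reals_cases)
  \<comment> \<open>Linearity of \<open>T\<close> is available only through the form: symmetry moves
    \<open>T\<close> to the other argument, where \<open>ip\<close> is linear.\<close>
  have Tzero: "ip (T f) g = 0" if "f = 0" "g \<in> S" for f g
    using symm[of f g] T[of g] that by simp
  have q_scale: "q (c \<odot> f) = (cmod c)\<^sup>2 * q f" if "f \<in> S" for c f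
  proof -
    have "ip (T (c \<odot> f)) (c \<odot> f) = (c * cnj c) * ip f (T f)"
      using that T by (simp add: ip_scale_right ip_scale_left symm)
    also have "\<dots> = complex_of_real ((cmod c)\<^sup>2 * q f)"
      using that by (simp add: mult_cnj_cmod symm[symmetric] ip_q)
    finally show ?thesis by (simp add: q_def)
  qed
  have fS: "f \<in> S" using f W by blast
  have f0: "nrm f \<noteq> 0"
    using definite[OF fS] f Tzero[of f f] fS by auto
  have "\<exists>u\<in>B. \<forall>h\<in>B. q h \<le> q u"
  proof -
    \<comment> \<open>Sequential compactness is shown for the set of values of \<open>q\<close>,
      since the hypothesis \<open>compact\<close> gives convergence of these values and not
      convergence in norm of the vectors.\<close>
    have "Topological_Spaces.compact (q ` B)"
      unfolding compact_def
    proof (intro allI impI)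
      fix s :: "nat \<Rightarrow> real" assume "\<forall>n. s n \<in> q ` B"
      then have "\<forall>n. \<exists>x. x \<in> B \<and> s n = q x" by blast
      then obtain h where h: "\<And>n. h n \<in> B" "\<And>n. s n = q (h n)" by metis
      then obtain r p where "strict_mono r" "p \<in> W" "nrm p \<le> 1" "(\<lambda>n. q (h (r n))) \<longlonglongrightarrow> q p"
        using compact[of h] h(1) unfolding B_def q_def by auto
      then show "\<exists>l\<in>q ` B. \<exists>r. strict_mono r \<and> (s \<circ> r) \<longlonglongrightarrow> l"
        unfolding B_def comp_def h(2) by blast
    qed
    moreover have "q ` B \<noteq> {}" using subspace_0[OF W(1)] by (force simp: B_def)
    ultimately show ?thesis using compact_attains_sup[of "q ` B"] by auto
  qed
  then obtain u where u: "u \<in> B" "\<And>h. h \<in> B \<Longrightarrow> q h \<le> q u" by blast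
  define m where "m = q u"
  have uW: "u \<in> W" and uS: "u \<in> S" and u1: "nrm u \<le> 1" using u W by (auto simp: B_def)
  have bound: "q h \<le> m * (nrm h)\<^sup>2" if "h \<in> W" for h
  proof (cases "nrm h = 0")
    case True
    then show ?thesis using definite[of h] that W Tzero[of h h] by (auto simp: q_def)
  next
    case False
    have hS: "h \<in> S" using that W by blast
    let ?c = "complex_of_real (1 / nrm h)"
    have "?c \<odot> h \<in> B" using that hS W False by (auto simp: B_def nrm_scale norm_divide subspace_scale)
    then have "q (?c \<odot> h) \<le> m" using u by (simp add: m_def)
    then show ?thesis using False hS by (simp add: q_scale field_simps norm_divide)
  qed
  have "0 < q f" using q_nonneg[OF fS] ip_q[OF fS] f by (cases "q f = 0") auto
  then have m: "m > 0" using bound[OF f(1)] f0 by (smt (verit) mult_nonpos_nonneg zero_le_power2)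
  \<comment> \<open>The homogeneous bound at the maximizer itself forces it onto the unit
    sphere.\<close>
  have "m \<le> m * (nrm u)\<^sup>2" using bound[OF uW] by (simp add: m_def)
  then have "1 \<le> (nrm u)\<^sup>2" using m by simp
  then have u_nrm: "nrm u = 1"
    using u1 nrm_nonneg[OF uS] power2_le_imp_le[of 1 "nrm u"] by simp
  interpret G: semi_inner scale W "\<lambda>f g. complex_of_real m * ip f g - ip (T f) g"
  proof
    show "subspace W" by (rule W)
    fix f g h assume "f \<in> W" "g \<in> W" 
    then have fg: "f \<in> S" "g \<in> S" using W by auto
    show "complex_of_real m * ip g f - ip (T g) f = cnj (complex_of_real m * ip f g - ip (T f) g)"
      using fg T ip_commute[of f g] ip_commute[of "T f" g] symm[of g f] by simp
    assume "h \<in> W" then have h: "h \<in> S" using W by auto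
    show "complex_of_real m * ip (f + g) h - ip (T (f + g)) h =
       complex_of_real m * ip f h - ip (T f) h + (complex_of_real m * ip g h - ip (T g) h)"
      using fg h T by (simp add: symm ip_add_left algebra_simps)
  next
    fix f h c assume "f \<in> W" "h \<in> W" 
    then have fg: "f \<in> S" "h \<in> S" using W by auto
    show "complex_of_real m * ip (c \<odot> f) h - ip (T (c \<odot> f)) h = c * (complex_of_real m * ip f h - ip (T f) h)"
      using fg T by (simp add: symm ip_scale_left algebra_simps)
  next
    fix f assume f: "f \<in> W"
    then have "f \<in> S" using W by auto
    then have "complex_of_real m * ip f f - ip (T f) f = complex_of_real (m * (nrm f)\<^sup>2 - q f)"
      by (simp add: ip_self ip_q)
    then show "complex_of_real m * ip f f - ip (T f) f \<in> \<real>\<^sub>\<ge>\<^sub>0"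
      using bound[OF f] by (simp only: nonneg_Reals_of_real_iff)
  qed
  define w where "w = complex_of_real m \<odot> u - T u"
  have wW: "w \<in> W" unfolding w_def using uW W by (intro subspace_diff subspace_scale) auto
  have "G.nrm u = 0" unfolding G.nrm_def using u_nrm uS by (simp add: ip_self ip_q m_def)
  then have "complex_of_real m * ip u w - ip (T u) w = 0"
    using G.cauchy_schwarz[OF uW wW] by simp
  then have "ip w w = 0"
    using uS T wW W by (subst (1) w_def) (auto simp: ip_diff_left ip_scale_left subset_iff)
  then have "w = 0" using definite[of w] wW W by (auto simp: nrm_def)
  then have "T u = complex_of_real m \<odot> u" by (simp add: w_def)
  moreover have "ip u u = 1" using u_nrm uS by (simp add: ip_self)
  ultimately show ?thesis using uW m by blast
qed

text \<open>The complement \<open>W\<close> of a set of eigenvectors is invariant under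
  \<open>T\<close>, so a nonzero value of the form on it would produce a further eigenvector. Weak
  convergence is part of the compactness hypothesis because it keeps the limit inside
  \<open>W\<close>. That \<open>T\<close> vanishes on the complement of \<open>U\<close> is
  expressed through the form.\<close>

lemma spectral_theorem:
  assumes T: "\<And>f. f \<in> S \<Longrightarrow> T f \<in> S"
    and symm: "\<And>f g. f \<in> S \<Longrightarrow> g \<in> S \<Longrightarrow> ip (T f) g = ip f (T g)"
    and pos: "\<And>f. f \<in> S \<Longrightarrow> ip (T f) f \<in> \<real>\<^sub>\<ge>\<^sub>0"
    and definite: "\<And>f. f \<in> S \<Longrightarrow> nrm f = 0 \<Longrightarrow> f = 0"
    and compact: "\<And>h. (\<And>n::nat. h n \<in> S) \<Longrightarrow> (\<And>n. nrm (h n) \<le> 1) \<Longrightarrow>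
      \<exists>r p. strict_mono r \<and> p \<in> S \<and> nrm p \<le> 1 \<and> (\<forall>g\<in>S. (\<lambda>n. ip (h (r n)) g) \<longlonglongrightarrow> ip p g)
        \<and> (\<lambda>n. Re (ip (T (h (r n))) (h (r n)))) \<longlonglongrightarrow> Re (ip (T p) p)"
  shows "\<exists>U \<sigma>. orthonormal U (\<lambda>u. u) \<and> (\<forall>u\<in>U. \<sigma> u > 0 \<and> T u = complex_of_real (\<sigma> u) \<odot> u) \<and>
    (\<forall>f\<in>S. (\<forall>u\<in>U. ip f u = 0) \<longrightarrow> ip (T f) f = 0)"
proof -
  define A where "A = {U. orthonormal U (\<lambda>u. u) \<and> (\<forall>u\<in>U. \<exists>s>0. T u = complex_of_real s \<odot> u)}"
  \<comment> \<open>Take a maximal orthonormal set of eigenvectors; its complement contains no further one.\<close>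
  have "\<exists>U\<in>A. \<forall>V\<in>A. U \<subseteq> V \<longrightarrow> V = U"
  proof (rule subset_Zorn')
    fix C assume C: "subset.chain A C"
    have "orthonormal (\<Union>C) (\<lambda>u. u)"
      unfolding orthonormal_def
    proof (intro conjI ballI)
      fix u assume "u \<in> \<Union>C"
      then obtain V where V: "V \<in> C" "u \<in> V" by blast
      then have VA: "V \<in> A" using C by (auto simp: subset_chain_def)
      then show "u \<in> S" using V by (auto simp: A_def orthonormal_def)
      fix v assume "v \<in> \<Union>C"
      then obtain V' where V': "V' \<in> C" "v \<in> V'" by blast
      then have VA': "V' \<in> A" using C by (auto simp: subset_chain_def)
      have "V \<subseteq> V' \<or> V' \<subseteq> V" using C V V' by (auto simp: subset_chain_def)
      then show "ip u v = (if u = v then 1 else 0)"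
        using V V' VA VA' by (auto simp: A_def orthonormal_def)
    qed
    then show "\<Union>C \<in> A" using C by (auto simp: A_def subset_chain_def)
  qed
  then obtain U where U: "U \<in> A" "\<And>V. V \<in> A \<Longrightarrow> U \<subseteq> V \<Longrightarrow> V = U" by metis
  have orthU: "orthonormal U (\<lambda>u. u)" and "\<forall>u\<in>U. \<exists>s>0. T u = complex_of_real s \<odot> u"
    using U by (auto simp: A_def)
  then obtain \<sigma> where \<sigma>: "\<And>u. u \<in> U \<Longrightarrow> \<sigma> u > 0" "\<And>u. u \<in> U \<Longrightarrow> T u = complex_of_real (\<sigma> u) \<odot> u"
    by metis
  have US: "u \<in> S" if "u \<in> U" for u using orthU that by (auto simp: orthonormal_def)
  define W where "W = {h \<in> S. \<forall>u\<in>U. ip h u = 0}"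
  have W: "subspace W" "W \<subseteq> S"
    unfolding W_def subspace_def using US by (auto simp: ip_add_left ip_scale_left)
  have TW: "T h \<in> W" if "h \<in> W" for h
    using that T \<sigma>(2) US by (auto simp: W_def symm ip_scale_right)
  have cW: "\<exists>r p. strict_mono r \<and> p \<in> W \<and> nrm p \<le> 1 \<and> (\<lambda>n. Re (ip (T (h (r n))) (h (r n)))) \<longlonglongrightarrow> Re (ip (T p) p)"
    if h: "\<And>n::nat. h n \<in> W" "\<And>n. nrm (h n) \<le> 1" for h
  proof -
    have "h n \<in> S" for n using h W by blast
    from compact[of h, OF this h(2)] obtain r p where r: "strict_mono r" "p \<in> S" "nrm p \<le> 1" "\<And>g. g \<in> S \<Longrightarrow> (\<lambda>n. ip (h (r n)) g) \<longlonglongrightarrow> ip p g"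
        "(\<lambda>n. Re (ip (T (h (r n))) (h (r n)))) \<longlonglongrightarrow> Re (ip (T p) p)"
      by auto
    have "ip p u = 0" if "u \<in> U" for u
    proof -
      have "(\<lambda>n. ip (h (r n)) u) = (\<lambda>n. 0)" using h(1) that by (auto simp: W_def)
      then have "(\<lambda>n. 0) \<longlonglongrightarrow> ip p u" using r(4)[OF US[OF that]] by simp
      then show ?thesis using LIMSEQ_unique tendsto_const by blast
    qed
    then have "p \<in> W" using r(2) by (simp add: W_def)
    then show ?thesis using r by blast
  qed
  have "ip (T f) f = 0" if f: "f \<in> S" "\<And>u. u \<in> U \<Longrightarrow> ip f u = 0" for f
  proof (rule ccontr)
    assume nz: "ip (T f) f \<noteq> 0"
    have fW: "f \<in> W" using f by (simp add: W_def)
    have "\<exists>u\<in>W. \<exists>m>0. ip u u = 1 \<and> T u = complex_of_real m \<odot> u"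
      by (rule eigenvector_of_compact_positive[of T W f])
        (fact T symm pos definite W(1) W(2) TW cW fW nz | assumption)+
    then obtain u m where u: "u \<in> W" "m > 0" "ip u u = 1" "T u = complex_of_real m \<odot> u"
      by blast
    have perp: "ip u v = 0" "ip v u = 0" if "v \<in> U" for v
      using u(1) that US[OF that] ip_commute[of u v] by (auto simp: W_def)
    have "insert u U \<in> A"
      using u W orthU perp U(1) by (auto simp: A_def orthonormal_def)
    then have "u \<in> U" using U(2)[of "insert u U"] by blast
    then show False using perp[of u] u by simp
  qed
  then show ?thesis using orthU \<sigma> by (intro exI[of _ U] exI[of _ \<sigma>]) auto
qed

end

section \<open>Completeness of the space of square-integrable functions\<close>

definition fun_scale :: "complex \<Rightarrow> ('a \<Rightarrow> complex^'n) \<Rightarrow> 'a \<Rightarrow> complex^'n" where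
  "fun_scale c f = (\<lambda>x. c *s f x)"

lemma vector_space_vec: "vector_space ((*s) :: complex \<Rightarrow> complex^'n \<Rightarrow> complex^'n)"
  by standard (simp_all add: vec_eq_iff algebra_simps)

lemma vector_space_fun_scale: "vector_space fun_scale"
  by standard (simp_all add: fun_scale_def fun_eq_iff vec_eq_iff algebra_simps)

lemma sum_fun_apply: "(\<Sum>i\<in>F. f i) x = (\<Sum>i\<in>F. f i x)"
  by (induction F rule: infinite_finite_induct) auto

lemma fun_scale_apply [simp]: "fun_scale c f x = c *s f x"
  by (simp add: fun_scale_def)

lemma norm_vec_sq: "(norm u)\<^sup>2 = (\<Sum>i\<in>UNIV. (cmod (u $ i))\<^sup>2)" for u :: "complex^'n"
  by (simp add: norm_vec_def L2_set_def sum_nonneg)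

lemma cinner_self: "cinner u u = complex_of_real ((norm u)\<^sup>2)"
  by (simp add: cinner_def norm_vec_sq mult_cnj_cmod)

lemma semi_inner_cinner: "semi_inner ((*s) :: complex \<Rightarrow> complex^'n \<Rightarrow> complex^'n) UNIV cinner"
proof -
  interpret vector_space "(*s) :: complex \<Rightarrow> complex^'n \<Rightarrow> complex^'n" by (rule vector_space_vec)
  show ?thesis
  proof
    show "cinner f f \<in> \<real>\<^sub>\<ge>\<^sub>0" for f :: "complex^'n"
      by (simp only: cinner_self nonneg_Reals_of_real_iff zero_le_power2)
  qed (simp_all add: cinner_def algebra_simps sum.distrib sum_distrib_left)
qed

lemma norm_cinner_le: "cmod (cinner u v) \<le> norm u * norm v" for u v :: "complex^'n"
proof -
  interpret semi_inner "(*s) :: complex \<Rightarrow> complex^'n \<Rightarrow> complex^'n" UNIV cinner by (rule semi_inner_cinner)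
  have "nrm w = norm w" for w by (simp add: nrm_def cinner_self)
  then show ?thesis using cauchy_schwarz[of u v] by simp
qed

lemma norm_vector_scalar_mult: "norm (c *s u) = cmod c * norm u" for u :: "complex^'n"
proof -
  have "(norm (c *s u))\<^sup>2 = (cmod c * norm u)\<^sup>2"
    by (simp add: norm_vec_sq power_mult_distrib sum_distrib_left norm_mult)
  then show ?thesis by (metis abs_norm_cancel abs_mult power2_eq_iff_nonneg norm_ge_zero mult_nonneg_nonneg)
qed

lemma measurable_vec_nth [measurable]:
  fixes f :: "'a \<Rightarrow> ('b::topological_space)^'n"
  assumes [measurable]: "f \<in> borel_measurable N" shows "(\<lambda>x. f x $ i) \<in> borel_measurable N"
  by (rule measurable_compose[OF assms borel_measurable_continuous_onI]) (intro continuous_intros)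

lemma measurable_vec_lambda:
  fixes f :: "'a \<Rightarrow> complex^'n"
  assumes "\<And>i. (\<lambda>x. f x $ i) \<in> borel_measurable N" shows "f \<in> borel_measurable N"
proof -
  have "f = (\<lambda>x. \<Sum>i\<in>UNIV. axis i (f x $ i))"
    by (auto simp: fun_eq_iff vec_eq_iff axis_def if_distrib cong: if_cong)
  moreover have "(\<lambda>x. \<Sum>i\<in>UNIV. axis i (f x $ i)) \<in> borel_measurable N"
  proof (intro borel_measurable_sum)
    fix i :: 'n
    have "continuous_on UNIV (\<lambda>z. axis i z :: complex^'n)"
      unfolding axis_def
    proof (intro continuous_on_vec_lambda)
      show "continuous_on UNIV (\<lambda>z. if j = i then z else (0::complex))" for j
        by (cases "j = i") auto
    qed
    then show "(\<lambda>x. axis i (f x $ i) :: complex^'n) \<in> borel_measurable N"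
      by (intro measurable_compose[OF assms borel_measurable_continuous_onI])
  qed
  ultimately show ?thesis by simp
qed

lemma measurable_vector_scalar_mult [measurable]:
  fixes f :: "'a \<Rightarrow> complex^'n"
  assumes [measurable]: "f \<in> borel_measurable N" "c \<in> borel_measurable N"
  shows "(\<lambda>x. c x *s f x) \<in> borel_measurable N"
  by (rule measurable_vec_lambda) (simp, measurable)

lemma measurable_cinner [measurable]:
  fixes f g :: "'a \<Rightarrow> complex^'n"
  assumes [measurable]: "f \<in> borel_measurable N" "g \<in> borel_measurable N"
  shows "(\<lambda>x. cinner (f x) (g x)) \<in> borel_measurable N"
proof -
  have [measurable]: "(\<lambda>x. cnj (g x $ i)) \<in> borel_measurable N" for i
    by (rule measurable_compose[OF measurable_vec_nth[OF assms(2)] borel_measurable_continuous_onI])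
      (intro continuous_intros)
  show ?thesis unfolding cinner_def by measurable
qed

lemma L2D:
  assumes "f \<in> L2 N"
  shows "f \<in> borel_measurable N" "integrable N (\<lambda>x. (norm (f x))\<^sup>2)"
  using assms by (auto simp: L2_def)

lemma L2_I_bound:
  fixes f :: "'a \<Rightarrow> complex^'n"
  assumes "f \<in> borel_measurable N" "integrable N g" "\<And>x. x \<in> space N \<Longrightarrow> (norm (f x))\<^sup>2 \<le> g x"
  shows "f \<in> L2 N"
  unfolding L2_def
proof (intro CollectI conjI assms)
  show "integrable N (\<lambda>x. (norm (f x))\<^sup>2)"
    using assms by (intro Bochner_Integration.integrable_bound[OF assms(2)]) (auto intro!: AE_I2 order_trans[OF assms(3)])
qed

lemma L2_add:
  assumes "f \<in> L2 N" "g \<in> L2 N" shows "(\<lambda>x. f x + g x) \<in> L2 N"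
proof (rule L2_I_bound)
  have [measurable]: "f \<in> borel_measurable N" "g \<in> borel_measurable N" using assms by (auto dest: L2D)
  show "(\<lambda>x. f x + g x) \<in> borel_measurable N" by measurable
  show "integrable N (\<lambda>x. 2 * (norm (f x))\<^sup>2 + 2 * (norm (g x))\<^sup>2)"
    by (simp add: L2D(2)[OF assms(1)] L2D(2)[OF assms(2)])
  show "(norm (f x + g x))\<^sup>2 \<le> 2 * (norm (f x))\<^sup>2 + 2 * (norm (g x))\<^sup>2" for x
  proof -
    have "(norm (f x + g x))\<^sup>2 \<le> (norm (f x) + norm (g x))\<^sup>2"
      by (intro power_mono norm_triangle_ineq) auto
    then show ?thesis
      using sum_squares_bound[of "norm (f x)" "norm (g x)"] by (simp add: power2_sum)
  qed
qed

lemma L2_scale: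
  assumes "f \<in> L2 N" shows "(\<lambda>x. c *s f x) \<in> L2 N"
proof (rule L2_I_bound)
  have [measurable]: "f \<in> borel_measurable N" using assms by (auto dest: L2D)
  show "(\<lambda>x. c *s f x) \<in> borel_measurable N" by measurable
  show "integrable N (\<lambda>x. (cmod c)\<^sup>2 * (norm (f x))\<^sup>2)" using assms by (auto dest: L2D)
qed (simp add: norm_vector_scalar_mult power_mult_distrib)

lemma integrable_cinner:
  assumes "f \<in> L2 N" "g \<in> L2 N" shows "integrable N (\<lambda>x. cinner (f x) (g x))"
proof (rule Bochner_Integration.integrable_bound)
  have [measurable]: "f \<in> borel_measurable N" "g \<in> borel_measurable N" using assms by (auto dest: L2D)
  show "(\<lambda>x. cinner (f x) (g x)) \<in> borel_measurable N" by measurable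
  show "integrable N (\<lambda>x. (norm (f x))\<^sup>2 + (norm (g x))\<^sup>2)" using assms by (auto dest: L2D)
  have "cmod (cinner (f x) (g x)) \<le> (norm (f x))\<^sup>2 + (norm (g x))\<^sup>2" for x
  proof -
    have "norm (f x) * norm (g x) \<le> (norm (f x))\<^sup>2 + (norm (g x))\<^sup>2"
      using sum_squares_bound[of "norm (f x)" "norm (g x)"] mult_nonneg_nonneg[OF norm_ge_zero norm_ge_zero, of "f x" "g x"]
      by linarith
    then show ?thesis using norm_cinner_le[of "f x" "g x"] by linarith
  qed
  then show "AE x in N. cmod (cinner (f x) (g x)) \<le> norm ((norm (f x))\<^sup>2 + (norm (g x))\<^sup>2)"
    by (simp add: abs_of_nonneg)
qed

lemma L2_inner_self: "L2_inner N f f = complex_of_real (\<integral>x. (norm (f x))\<^sup>2 \<partial>N)"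
  by (simp add: L2_inner_def cinner_self flip: integral_complex_of_real of_real_power)

lemma semi_inner_L2:
  fixes N :: "'a measure"
  shows "semi_inner fun_scale (L2 N :: ('a \<Rightarrow> complex^'n) set) (L2_inner N)"
proof -
  interpret vector_space "fun_scale :: complex \<Rightarrow> ('a \<Rightarrow> complex^'n) \<Rightarrow> 'a \<Rightarrow> complex^'n"
    by (rule vector_space_fun_scale)
  interpret C: semi_inner "(*s) :: complex \<Rightarrow> complex^'n \<Rightarrow> complex^'n" UNIV cinner by (rule semi_inner_cinner)
  show ?thesis
  proof
    have "(\<lambda>x. 0) \<in> (L2 N :: ('a \<Rightarrow> complex^'n) set)" by (simp add: L2_def)
    then show "subspace (L2 N)"
      unfolding subspace_def fun_scale_def plus_fun_def zero_fun_def using L2_add L2_scale by blast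
  next
    fix f g h :: "'a \<Rightarrow> complex^'n"
    assume "f \<in> L2 N" "g \<in> L2 N"
    have "(\<lambda>x. cinner (g x) (f x)) = (\<lambda>x. cnj (cinner (f x) (g x)))"
      by (rule ext, rule C.ip_commute) auto
    then show "L2_inner N g f = cnj (L2_inner N f g)"
      by (simp add: L2_inner_def)
    assume "h \<in> L2 N"
    then show "L2_inner N (f + g) h = L2_inner N f h + L2_inner N g h"
      using \<open>f \<in> L2 N\<close> \<open>g \<in> L2 N\<close> by (simp add: L2_inner_def C.ip_add_left integrable_cinner)
  next
    fix f h :: "'a \<Rightarrow> complex^'n" and c
    assume "f \<in> L2 N" "h \<in> L2 N"
    then show "L2_inner N (fun_scale c f) h = c * L2_inner N f h"
      by (simp add: L2_inner_def C.ip_scale_left)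
  next
    fix f :: "'a \<Rightarrow> complex^'n"
    show "L2_inner N f f \<in> \<real>\<^sub>\<ge>\<^sub>0"
      by (simp only: L2_inner_self nonneg_Reals_of_real_iff) simp
  qed
qed

lemma L2_nrm_sq:
  "f \<in> L2 N \<Longrightarrow> (semi_inner.nrm (L2_inner N) f)\<^sup>2 = (\<integral>x. (norm (f x))\<^sup>2 \<partial>N)"
  by (simp add: semi_inner.nrm_def[OF semi_inner_L2] L2_inner_self)

lemma L2_AE_zero_iff:
  assumes "f \<in> L2 N"
  shows "semi_inner.nrm (L2_inner N) f = 0 \<longleftrightarrow> (AE x in N. f x = 0)"
proof -
  have "semi_inner.nrm (L2_inner N) f = 0 \<longleftrightarrow> (\<integral>x. (norm (f x))\<^sup>2 \<partial>N) = 0"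
    using L2_nrm_sq[OF assms] by (metis power_zero_numeral zero_eq_power2)
  also have "\<dots> \<longleftrightarrow> (AE x in N. (norm (f x))\<^sup>2 = 0)"
    by (rule integral_nonneg_eq_0_iff_AE) (use assms in \<open>auto dest: L2D\<close>)
  finally show ?thesis by simp
qed

text \<open>Pointwise \<open>norm (f x) \<le> d + (norm (f x))^2 / d\<close>, whichever of
  \<open>norm (f x)\<close> and \<open>d\<close> is larger. The free parameter \<open>d\<close>
  balances the two terms; the estimate takes the place of Cauchy--Schwarz against a
  constant.\<close>

lemma (in finite_measure) integral_norm_le:
  fixes f :: "'a \<Rightarrow> 'b::{banach, second_countable_topology}"
  assumes "f \<in> borel_measurable M" "integrable M (\<lambda>x. (norm (f x))\<^sup>2)" "d > 0"
  shows "integrable M f" "(\<integral>x. norm (f x) \<partial>M) \<le> d * measure M (space M) + (\<integral>x. (norm (f x))\<^sup>2 \<partial>M) / d"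
proof -
  have le: "norm (f x) \<le> d + (norm (f x))\<^sup>2 / d" for x
  proof (cases "norm (f x) \<le> d")
    case False
    then have "d * norm (f x) \<le> (norm (f x))\<^sup>2" by (simp add: power2_eq_square mult_right_mono)
    then have "norm (f x) \<le> (norm (f x))\<^sup>2 / d" using \<open>d > 0\<close> by (simp add: field_simps)
    then show ?thesis using \<open>d > 0\<close> by linarith
  qed (use \<open>d > 0\<close> in \<open>auto intro: add_increasing2\<close>)
  have i: "integrable M (\<lambda>x. d + (norm (f x))\<^sup>2 / d)" using assms by simp
  show "integrable M f"
    using assms by (intro Bochner_Integration.integrable_bound[OF i]) (auto intro!: AE_I2 order_trans[OF le])
  then have "(\<integral>x. norm (f x) \<partial>M) \<le> (\<integral>x. d + (norm (f x))\<^sup>2 / d \<partial>M)"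
    using i le by (intro integral_mono) auto
  then show "(\<integral>x. norm (f x) \<partial>M) \<le> d * measure M (space M) + (\<integral>x. (norm (f x))\<^sup>2 \<partial>M) / d"
    using assms by (simp add: mult.commute)
qed

text \<open>On a finite measure space an L2 Cauchy sequence is Cauchy in L1, so a subsequence
  converges almost everywhere to some \<open>g\<close>. Fatou's lemma along it bounds the distance
  from each late \<open>s k\<close> to \<open>g\<close>, which shows both that \<open>g\<close> is
  square integrable and that the whole sequence converges.\<close>

lemma semi_hilbert_L2:
  fixes N :: "'a measure"
  assumes "finite_measure N"
  shows "semi_hilbert fun_scale (L2 N :: ('a \<Rightarrow> complex^'n) set) (L2_inner N)"
proof -
  interpret finite_measure N by fact
  interpret L: semi_inner fun_scale "L2 N :: ('a \<Rightarrow> complex^'n) set" "L2_inner N" by (rule semi_inner_L2)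
  show ?thesis
  proof
    fix s :: "nat \<Rightarrow> 'a \<Rightarrow> complex^'n"
    assume s: "\<And>k. s k \<in> L2 N" and C: "\<And>e. e > 0 \<Longrightarrow> \<exists>N. \<forall>k\<ge>N. \<forall>m\<ge>N. L.nrm (s k - s m) < e"
    have [measurable]: "s k \<in> borel_measurable N" for k using s by (auto dest: L2D)
    have dS: "s k - s m \<in> L2 N" for k m using s by blast
    have int_s: "integrable N (s k)" for k
      using integral_norm_le(1)[of "s k" 1] s by (auto dest: L2D)
    have "\<exists>K. \<forall>i\<ge>K. \<forall>j\<ge>K. (\<integral>x. norm (s i x - s j x) \<partial>N) < e" if e: "e > 0" for e
    proof -
      define m where "m = measure N (space N) + 1"
      \<comment> \<open>With this \<open>d\<close> the first term of \<open>integral_norm_le\<close>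
        is at most \<open>e / 2\<close>, and the threshold \<open>sqrt (d * e / 2)\<close> brings
        the second below \<open>e / 2\<close>. The 1 added in \<open>m\<close> avoids a zero
        denominator for the null measure.\<close>
      define d where "d = e / (2 * m)"
      have m: "m > 0" "measure N (space N) < m" by (auto simp: m_def add_nonneg_pos)
      have d: "d > 0" using m that by (simp add: d_def)
      have "sqrt (d * e / 2) > 0" using d that by simp
      from C[OF this] obtain K where K: "\<And>k l. k \<ge> K \<Longrightarrow> l \<ge> K \<Longrightarrow> L.nrm (s k - s l) < sqrt (d * e / 2)" by blast
      have "(\<integral>x. norm (s i x - s j x) \<partial>N) < e" if ij: "i \<ge> K" "j \<ge> K" for i j
      proof -
        have "(L.nrm (s i - s j))\<^sup>2 < (sqrt (d * e / 2))\<^sup>2"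
          using K[OF ij] L.nrm_nonneg[OF dS] by (intro power_strict_mono) auto
        then have "(L.nrm (s i - s j))\<^sup>2 < d * e / 2" using d e by simp
        then have "(\<integral>x. (norm ((s i - s j) x))\<^sup>2 \<partial>N) < d * e / 2"
          using L2_nrm_sq[OF dS, of i j] by simp
        then have "(\<integral>x. (norm ((s i - s j) x))\<^sup>2 \<partial>N) / d < e / 2" using d by (simp add: field_simps)
        moreover have "(\<integral>x. norm ((s i - s j) x) \<partial>N) \<le> d * measure N (space N) + (\<integral>x. (norm ((s i - s j) x))\<^sup>2 \<partial>N) / d"
          by (rule integral_norm_le(2)[OF L2D[OF dS[of i j]] d])
        moreover have "d * measure N (space N) \<le> d * m" using d m by (intro mult_left_mono) auto
        moreover have "d * m = e / 2" using m by (simp add: d_def)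
        ultimately have "(\<integral>x. norm ((s i - s j) x) \<partial>N) < e" by linarith
        then show ?thesis by simp
      qed
      then show ?thesis by blast
    qed
    then obtain r where r: "strict_mono r" "AE x in N. Cauchy (\<lambda>i. s (r i) x)"
      by (rule cauchy_L1_AE_cauchy_subseq[OF int_s])
    define g where "g x = lim (\<lambda>i. s (r i) x)" for x
    have [measurable]: "g \<in> borel_measurable N" unfolding g_def by measurable
    have lim: "AE x in N. (\<lambda>i. s (r i) x) \<longlonglongrightarrow> g x"
      using r(2) by eventually_elim (simp add: g_def Cauchy_convergent_iff convergent_LIMSEQ_iff)
    have fatou: "integrable N (\<lambda>x. (norm (s k x - g x))\<^sup>2) \<and> (\<integral>x. (norm (s k x - g x))\<^sup>2 \<partial>N) \<le> e\<^sup>2"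
      if e: "e > 0" and K: "\<And>l. l \<ge> K \<Longrightarrow> L.nrm (s k - s l) \<le> e" for k e K
    proof -
      have "(\<integral>\<^sup>+x. ennreal ((norm (s k x - g x))\<^sup>2) \<partial>N) = (\<integral>\<^sup>+x. liminf (\<lambda>i. ennreal ((norm (s k x - s (r i) x))\<^sup>2)) \<partial>N)"
      proof (rule nn_integral_cong_AE)
        show "AE x in N. ennreal ((norm (s k x - g x))\<^sup>2) = liminf (\<lambda>i. ennreal ((norm (s k x - s (r i) x))\<^sup>2))"
          using lim
        proof eventually_elim
          case (elim x)
          have "(\<lambda>i. ennreal ((norm (s k x - s (r i) x))\<^sup>2)) \<longlonglongrightarrow> ennreal ((norm (s k x - g x))\<^sup>2)"
            by (intro tendsto_intros tendsto_ennrealI elim)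
          from lim_imp_Liminf[OF _ this] show ?case by simp
        qed
      qed
      also have "\<dots> \<le> liminf (\<lambda>i. \<integral>\<^sup>+x. ennreal ((norm (s k x - s (r i) x))\<^sup>2) \<partial>N)"
        by (rule nn_integral_liminf) measurable
      also have "\<dots> \<le> ennreal (e\<^sup>2)"
      proof (rule Liminf_le)
        have "(\<integral>\<^sup>+x. ennreal ((norm (s k x - s (r i) x))\<^sup>2) \<partial>N) \<le> ennreal (e\<^sup>2)" if "i \<ge> K" for i
        proof -
          have "L.nrm (s k - s (r i)) \<le> e" using K seq_suble[OF r(1), of i] that by auto
          then have "(L.nrm (s k - s (r i)))\<^sup>2 \<le> e\<^sup>2"
            using L.nrm_nonneg[OF dS] by (intro power_mono) auto
          then have "(\<integral>x. (norm ((s k - s (r i)) x))\<^sup>2 \<partial>N) \<le> e\<^sup>2" using L2_nrm_sq[OF dS, of k "r i"] by simp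
          moreover have "(\<integral>\<^sup>+x. ennreal ((norm ((s k - s (r i)) x))\<^sup>2) \<partial>N) = ennreal (\<integral>x. (norm ((s k - s (r i)) x))\<^sup>2 \<partial>N)"
            using L2D[OF dS[of k "r i"]] by (intro nn_integral_eq_integral) auto
          ultimately show ?thesis by (simp add: ennreal_leI)
        qed
        then show "\<forall>\<^sub>F i in sequentially. (\<integral>\<^sup>+x. ennreal ((norm (s k x - s (r i) x))\<^sup>2) \<partial>N) \<le> ennreal (e\<^sup>2)"
          by (auto simp: eventually_sequentially)
      qed simp
      finally have nn: "(\<integral>\<^sup>+x. ennreal ((norm (s k x - g x))\<^sup>2) \<partial>N) \<le> ennreal (e\<^sup>2)" .
      then have i: "integrable N (\<lambda>x. (norm (s k x - g x))\<^sup>2)"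
        by (intro integrableI_bounded) (auto simp: le_less_trans[OF _ ennreal_less_top])
      have "ennreal (\<integral>x. (norm (s k x - g x))\<^sup>2 \<partial>N) \<le> ennreal (e\<^sup>2)"
        using nn_integral_eq_integral[OF i] nn by simp
      then show ?thesis using i by (simp add: ennreal_le_iff)
    qed
    \<comment> \<open>Any finite distance does here: one term with \<open>s K1 - g\<close> in L2
      puts \<open>g\<close> into L2.\<close>
    obtain K1 where K1: "\<And>k l. k \<ge> K1 \<Longrightarrow> l \<ge> K1 \<Longrightarrow> L.nrm (s k - s l) < 1"
      using C[of 1] by auto
    have "s K1 - g \<in> borel_measurable N" unfolding fun_diff_def by measurable
    then have "s K1 - g \<in> L2 N"
      using fatou[of 1 K1 K1] K1[of K1] by (auto simp: L2_def less_imp_le)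
    then have "s K1 - (s K1 - g) \<in> L2 N" using s by blast
    then have g: "g \<in> L2 N" by simp
    have "(\<lambda>k. L.nrm (s k - g)) \<longlonglongrightarrow> 0"
    proof (rule LIMSEQ_I)
      fix e :: real assume "e > 0"
      then obtain K where K: "\<And>k l. k \<ge> K \<Longrightarrow> l \<ge> K \<Longrightarrow> L.nrm (s k - s l) < e / 2"
        using C[of "e / 2"] by auto
      have "norm (L.nrm (s k - g) - 0) < e" if "k \<ge> K" for k
      proof -
        have "(L.nrm (s k - g))\<^sup>2 \<le> (e / 2)\<^sup>2"
          using fatou[of "e / 2" K k] K[of k] that \<open>e > 0\<close> L2_nrm_sq[of "s k - g" N] s g by (auto simp: less_imp_le)
        then have "L.nrm (s k - g) \<le> e / 2" by (rule power2_le_imp_le) (use \<open>e > 0\<close> in simp)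
        moreover have "L.nrm (s k - g) \<ge> 0" using s g by simp
        ultimately show ?thesis using \<open>e > 0\<close> by simp
      qed
      then show "\<exists>K. \<forall>k\<ge>K. norm (L.nrm (s k - g) - 0) < e" by blast
    qed
    then show "\<exists>f\<in>L2 N. (\<lambda>k. L.nrm (s k - f)) \<longlonglongrightarrow> 0" using g by blast
  qed
qed

section \<open>Geometry and topology of a reproducing kernel Hilbert space\<close>

lemma norm_axis_one: "norm (axis j 1 :: complex^'n) = 1"
  by (simp add: norm_vec_def L2_set_def axis_def if_distrib[of norm] if_distrib[of "\<lambda>x. x\<^sup>2"] cong: if_cong)

sublocale hilbert_function_space \<subseteq> Hs: semi_hilbert fun_scale H ip
proof -
  interpret vector_space "fun_scale :: complex \<Rightarrow> ('a \<Rightarrow> complex^'n) \<Rightarrow> 'a \<Rightarrow> complex^'n"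
    by (rule vector_space_fun_scale)
  interpret semi_inner fun_scale H ip
  proof
    show "subspace H"
      unfolding subspace_def fun_scale_def plus_fun_def zero_fun_def using zero_in add_in scale_in by blast
  qed (simp_all only: plus_fun_def fun_scale_def ip_add ip_scale ip_nonneg, rule ip_sym)
  have nrm_eq: "nrm = ip_norm ip" by (simp add: fun_eq_iff nrm_def ip_norm_def)
  show "semi_hilbert fun_scale H ip"
  proof
    fix s :: "nat \<Rightarrow> 'a \<Rightarrow> complex^'n"
    assume "\<And>k. s k \<in> H" "\<And>e. e > 0 \<Longrightarrow> \<exists>N. \<forall>k\<ge>N. \<forall>m\<ge>N. nrm (s k - s m) < e"
    then show "\<exists>f\<in>H. (\<lambda>k. nrm (s k - f)) \<longlonglongrightarrow> 0"
      unfolding nrm_eq fun_diff_def by (rule complete)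
  qed
qed

lemma (in hilbert_function_space) nrm_eq_ip_norm: "Hs.nrm = ip_norm ip"
  by (simp add: fun_eq_iff Hs.nrm_def ip_norm_def)

lemma (in hilbert_function_space) nrm_zero_imp: "f \<in> H \<Longrightarrow> Hs.nrm f = 0 \<Longrightarrow> f = 0"
  using ip_definite[of f] by (simp add: Hs.ip_self zero_fun_def)

section \<open>Sections, point evaluation and two equivalent pseudo-metrics\<close>

context rkhs
begin

abbreviation sec :: "'n \<Rightarrow> 'a \<Rightarrow> 'a \<Rightarrow> complex^'n" where
  "sec j x \<equiv> kernel_section X K x (axis j 1)"

text \<open>By \<open>kernel_diag\<close> this is the trace of \<open>K x x\<close>. Written through
  the sections, it dominates the squared value at \<open>x\<close> of every unit vector and, by
  Bessel's inequality, the sum of these over an orthonormal family.\<close>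

definition trace :: "'a \<Rightarrow> real" where
  "trace x = (\<Sum>j\<in>UNIV. (Hs.nrm (sec j x))\<^sup>2)"

lemma eval_component: "f \<in> H \<Longrightarrow> x \<in> X \<Longrightarrow> f x $ j = ip f (sec j x)"
  by (subst reproducing) auto

lemma eval_outside: "f \<in> H \<Longrightarrow> x \<notin> X \<Longrightarrow> f x = 0"
  using subset_functions by (auto simp: functions_on_def)

lemma sec_apply: "t \<in> X \<Longrightarrow> sec j x t $ l = K t x $ l $ j"
  by (simp add: kernel_section_def matrix_vector_mult_def axis_def if_distrib cong: if_cong)

text \<open>The Gram matrix of the sections. As \<open>ip\<close> is linear in its first argument,
  the point of evaluation \<open>x\<close> with its index \<open>l\<close> goes to the second slot;
  this fixes the place of the conjugate in every expansion of the kernel.\<close>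

lemma ip_sec: "x \<in> X \<Longrightarrow> t \<in> X \<Longrightarrow> ip (sec j t) (sec l x) = K x t $ l $ j"
  using eval_component[OF section_in, of t x j l] by (simp add: sec_apply)

lemma kernel_commute: "x \<in> X \<Longrightarrow> t \<in> X \<Longrightarrow> K t x $ j $ l = cnj (K x t $ l $ j)"
  using Hs.ip_commute[of "sec j t" "sec l x"] by (simp add: section_in ip_sec)

lemma kernel_diag: "x \<in> X \<Longrightarrow> K x x $ j $ j = complex_of_real ((Hs.nrm (sec j x))\<^sup>2)"
  using Hs.ip_self[of "sec j x"] by (simp add: section_in ip_sec)

lemma trace_nonneg: "trace x \<ge> 0"
  by (simp add: trace_def sum_nonneg)

lemma norm_eval_sq_le: "f \<in> H \<Longrightarrow> x \<in> X \<Longrightarrow> (norm (f x))\<^sup>2 \<le> (Hs.nrm f)\<^sup>2 * trace x"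
proof -
  assume f: "f \<in> H" and x: "x \<in> X"
  have "(cmod (f x $ j))\<^sup>2 \<le> (Hs.nrm f)\<^sup>2 * (Hs.nrm (sec j x))\<^sup>2" for j
    unfolding power_mult_distrib[symmetric] eval_component[OF f x]
    using f x section_in by (intro power_mono Hs.cauchy_schwarz) auto
  then show ?thesis
    unfolding norm_vec_sq trace_def sum_distrib_left by (intro sum_mono)
qed

lemma norm_eval_le: "f \<in> H \<Longrightarrow> x \<in> X \<Longrightarrow> norm (f x) \<le> Hs.nrm f * sqrt (trace x)"
proof (rule power2_le_imp_le)
  assume f: "f \<in> H" and x: "x \<in> X"
  show "(norm (f x))\<^sup>2 \<le> (Hs.nrm f * sqrt (trace x))\<^sup>2"
    using norm_eval_sq_le[OF f x] trace_nonneg by (simp add: power_mult_distrib)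
qed (simp add: trace_nonneg)

lemma kernel_section_eq: "kernel_section X K x y = (\<Sum>j\<in>UNIV. fun_scale (y $ j) (sec j x))"
proof
  fix t
  show "kernel_section X K x y t = (\<Sum>j\<in>UNIV. fun_scale (y $ j) (sec j x)) t"
  proof (cases "t \<in> X")
    case True
    have "(K t x *v y) $ l = (\<Sum>j\<in>UNIV. y $ j * sec j x t $ l)" for l
      using True by (simp add: matrix_vector_mult_def sec_apply mult.commute)
    then show ?thesis using True
      by (simp add: vec_eq_iff sum_fun_apply sum_component kernel_section_def[of X K x y])
  qed (simp add: kernel_section_def sum_fun_apply)
qed

text \<open>A pseudo-metric equivalent to the one defining the topology, but measurable by inspection.\<close>

definition sec_dist :: "'a \<Rightarrow> 'a \<Rightarrow> real" where
  "sec_dist x t = (\<Sum>j\<in>UNIV. Hs.nrm (sec j x - sec j t))"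

abbreviation kd :: "'a \<Rightarrow> 'a \<Rightarrow> real" where
  "kd \<equiv> kernel_dist X K ip"

lemma kernel_section_diff_le:
  assumes "x \<in> X" "t \<in> X" "norm y \<le> 1"
  shows "Hs.nrm (kernel_section X K x y - kernel_section X K t y) \<le> sec_dist x t"
proof -
  have "kernel_section X K x y - kernel_section X K t y = (\<Sum>j\<in>UNIV. fun_scale (y $ j) (sec j x - sec j t))"
    unfolding kernel_section_eq[of _ y] by (simp add: Hs.scale_right_diff_distrib sum_subtractf)
  then have "Hs.nrm (kernel_section X K x y - kernel_section X K t y) \<le> (\<Sum>j\<in>UNIV. cmod (y $ j) * Hs.nrm (sec j x - sec j t))"
    using assms section_in by (auto intro!: Hs.nrm_sum_le)
  also have "\<dots> \<le> (\<Sum>j\<in>UNIV. 1 * Hs.nrm (sec j x - sec j t))"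
    using assms(1,2) section_in order_trans[OF Finite_Cartesian_Product.norm_nth_le assms(3)]
    by (intro sum_mono mult_right_mono Hs.nrm_nonneg Hs.S_diff) auto
  finally show ?thesis by (simp add: sec_dist_def)
qed

lemma kernel_dist_eq:
  "kd x t = (SUP y\<in>{y. norm y \<le> 1}. Hs.nrm (kernel_section X K x y - kernel_section X K t y))"
  unfolding kernel_dist_def nrm_eq_ip_norm fun_diff_def by (rule refl)

lemma kernel_dist_le: "x \<in> X \<Longrightarrow> t \<in> X \<Longrightarrow> kd x t \<le> sec_dist x t"
  unfolding kernel_dist_eq using kernel_section_diff_le by (intro cSUP_least) (auto intro: exI[of _ 0])

lemma nrm_sec_diff_le:
  assumes "x \<in> X" "t \<in> X" shows "Hs.nrm (sec j x - sec j t) \<le> kd x t"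
  unfolding kernel_dist_eq
proof (rule cSUP_upper2)
  show "bdd_above ((\<lambda>y. Hs.nrm (kernel_section X K x y - kernel_section X K t y)) ` {y. norm y \<le> 1})"
    using kernel_section_diff_le[OF assms] by (intro bdd_aboveI[of _ "sec_dist x t"]) auto
  show "axis j 1 \<in> {y :: complex^'n. norm y \<le> 1}" by (simp add: norm_axis_one)
qed simp

lemma sec_dist_le: "x \<in> X \<Longrightarrow> t \<in> X \<Longrightarrow> sec_dist x t \<le> CARD('n) * kd x t"
  unfolding sec_dist_def using nrm_sec_diff_le sum_bounded_above[of UNIV "\<lambda>j. Hs.nrm (sec j x - sec j t)" "kd x t"] by simp

lemma sec_dist_commute: "x \<in> X \<Longrightarrow> t \<in> X \<Longrightarrow> sec_dist x t = sec_dist t x"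
  unfolding sec_dist_def using section_in by (intro sum.cong Hs.nrm_minus_commute) auto

lemma sec_dist_triangle: "x \<in> X \<Longrightarrow> t \<in> X \<Longrightarrow> s \<in> X \<Longrightarrow> sec_dist x s \<le> sec_dist x t + sec_dist t s"
  unfolding sec_dist_def sum.distrib[symmetric] using section_in by (intro sum_mono Hs.nrm_triangle_diff) auto

section \<open>Open sets and continuity in the kernel topology\<close>

abbreviation \<tau> :: "'a topology" where "\<tau> \<equiv> kernel_topology X K ip"

lemma topspace_kernel_topology [simp]: "topspace \<tau> = X"
proof
  show "topspace \<tau> \<subseteq> X" by (auto simp: topspace_def openin_pseudometric_topology)
  have "openin \<tau> X" by (auto simp: openin_pseudometric_topology intro: exI[of _ 1])
  then show "X \<subseteq> topspace \<tau>" by (rule openin_subset)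
qed

text \<open>A one-sided Lipschitz bound is enough for sublevel sets. It is applied to balls of
  \<open>sec_dist\<close> with \<open>C = CARD('n)\<close> and to residuals with
  \<open>C = 1\<close>.\<close>

lemma openin_less:
  assumes "C > 0" and "\<And>x t. x \<in> X \<Longrightarrow> t \<in> X \<Longrightarrow> \<phi> t \<le> \<phi> x + C * kd x t"
  shows "openin \<tau> {x \<in> X. \<phi> x < (a::real)}"
  unfolding openin_pseudometric_topology
proof (intro conjI ballI)
  fix x assume x: "x \<in> {x \<in> X. \<phi> x < a}"
  have "\<phi> t < a" if "t \<in> X" "kd x t < (a - \<phi> x) / C" for t
    using assms(2)[of x t] that x assms(1) by (auto simp: field_simps)
  then show "\<exists>r>0. {t \<in> X. kd x t < r} \<subseteq> {x \<in> X. \<phi> x < a}"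
    using x assms(1) by (intro exI[of _ "(a - \<phi> x) / C"]) auto
qed auto

lemma openin_sec_ball: "q \<in> X \<Longrightarrow> openin \<tau> {x \<in> X. sec_dist q x < a}"
proof (rule openin_less[of "real CARD('n)"])
  fix x t assume "q \<in> X" "x \<in> X" "t \<in> X"
  then show "sec_dist q t \<le> sec_dist q x + real CARD('n) * kd x t"
    using sec_dist_triangle[of q x t] sec_dist_le[of x t] by linarith
qed simp

text \<open>Each component of \<open>f t - f x\<close> is the inner product of \<open>f\<close> with
  a difference of sections, so \<open>f\<close> is Lipschitz for \<open>kd\<close>. The 1 added in
  \<open>C\<close> keeps the constant positive when \<open>f\<close> is zero.\<close>

lemma continuous_kernel_topology:
  assumes f: "f \<in> H" shows "continuous_map \<tau> euclidean f"
  unfolding continuous_map_def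
proof (intro conjI allI impI)
  fix U :: "(complex^'n) set" assume "openin euclidean U"
  then have U: "open U" by simp
  define C where "C = real CARD('n) * Hs.nrm f + 1"
  have C: "C > 0" using f by (simp add: C_def add_nonneg_pos)
  have lip: "norm (f t - f x) \<le> C * kd x t" if "x \<in> X" "t \<in> X" for x t
  proof -
    have kd0: "0 \<le> kd x t" 
      using nrm_sec_diff_le[OF that] Hs.nrm_nonneg[of "sec undefined x - sec undefined t"] section_in that
      by (meson Hs.S_diff order_trans)
    have "norm (f t - f x) \<le> (\<Sum>j\<in>UNIV. cmod ((f t - f x) $ j))"
      unfolding norm_vec_def by (rule L2_set_le_sum) simp
    also have "\<dots> \<le> (\<Sum>j\<in>(UNIV::'n set). Hs.nrm f * kd x t)"
    proof (rule sum_mono)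
      fix j
      have "(f t - f x) $ j = ip f (sec j t - sec j x)"
        using f that section_in by (simp add: eval_component Hs.ip_diff_right)
      also have "cmod \<dots> \<le> Hs.nrm f * Hs.nrm (sec j t - sec j x)"
        using f that section_in by (intro Hs.cauchy_schwarz) auto
      also have "\<dots> \<le> Hs.nrm f * kd x t"
        using nrm_sec_diff_le[OF that, of j] Hs.nrm_minus_commute[of "sec j t" "sec j x"] f that section_in
        by (intro mult_left_mono) auto
      finally show "cmod ((f t - f x) $ j) \<le> Hs.nrm f * kd x t" .
    qed
    also have "\<dots> \<le> C * kd x t" using kd0 by (simp add: C_def algebra_simps)
    finally show ?thesis .
  qed
  show "openin \<tau> {x \<in> topspace \<tau>. f x \<in> U}"
    unfolding openin_pseudometric_topology topspace_kernel_topology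
  proof (intro conjI ballI)
    fix x assume x: "x \<in> {x \<in> X. f x \<in> U}"
    then obtain e where e: "e > 0" "\<And>y. dist y (f x) < e \<Longrightarrow> y \<in> U"
      using U unfolding open_dist by blast
    have "f t \<in> U" if "t \<in> X" "kd x t < e / C" for t
      using lip[of x t] x that C by (intro e) (auto simp: dist_norm field_simps)
    then show "\<exists>r>0. {t \<in> X. kd x t < r} \<subseteq> {x \<in> X. f x \<in> U}"
      using e C by (intro exI[of _ "e / C"]) auto
  qed auto
qed auto

section \<open>Second countability from separability\<close>

definition dense_points :: "'a set \<Rightarrow> bool" where
  "dense_points Q \<longleftrightarrow> countable Q \<and> Q \<subseteq> X \<and> (\<forall>x\<in>X. \<forall>e>0. \<exists>q\<in>Q. sec_dist q x < e)"

text \<open>A subset of a separable metric space is separable: for each tuple \<open>g\<close> of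
  elements of the dense set and each radius \<open>1 / (m + 1)\<close>, choose a point whose
  sections lie that close to \<open>g\<close>, if there is one. The pairs in \<open>P\<close> are
  those that admit such a point, so that \<open>SOME\<close> is meaningful on them.\<close>

lemma dense_points_exist:
  assumes "separable_function_space H ip"
  obtains Q where "dense_points Q"
proof -
  obtain D where D: "countable D" "D \<subseteq> H" "\<And>f e. f \<in> H \<Longrightarrow> e > 0 \<Longrightarrow> \<exists>g\<in>D. Hs.nrm (f - g) < e"
    using assms unfolding separable_function_space_def nrm_eq_ip_norm fun_diff_def by blast
  define near where "near g m x \<longleftrightarrow> x \<in> X \<and> (\<forall>j. Hs.nrm (sec j x - g j) < 1 / real (Suc m))" for g m x
  define pt where "pt = (\<lambda>(g, m). SOME x. near g m x)"
  define P where "P = {gm \<in> (UNIV \<rightarrow>\<^sub>E D) \<times> (UNIV::nat set). \<exists>x. near (fst gm) (snd gm) x}"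
  have near_pt: "near g m (pt (g, m))" if "(g, m) \<in> P" for g m
    using that unfolding P_def pt_def by (auto intro: someI_ex)
  have "countable ((UNIV::'n set) \<rightarrow>\<^sub>E D)" using D(1) by (intro countable_PiE) simp_all
  then have "countable (((UNIV::'n set) \<rightarrow>\<^sub>E D) \<times> (UNIV::nat set))" by (rule countable_SIGMA) simp
  then have "countable P" unfolding P_def by (rule countable_subset[OF Collect_subset])
  moreover have "pt ` P \<subseteq> X" using near_pt by (auto simp: near_def)
  moreover have "\<exists>q\<in>pt ` P. sec_dist q x < e" if x: "x \<in> X" and e: "e > 0" for x e
  proof -
    \<comment> \<open>The factor 2 pays for the detour over \<open>g\<close>, the factor
      \<open>CARD('n)\<close> for the sum over the components.\<close>
    obtain m where m: "1 / real (Suc m) < e / (2 * real CARD('n))"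
      using reals_Archimedean[of "e / (2 * real CARD('n))"] e by (auto simp: inverse_eq_divide)
    have "\<exists>g\<in>D. Hs.nrm (sec j x - g) < 1 / real (Suc m)" for j
      using D(3) section_in[OF x] by simp
    then obtain g where g: "\<And>j. g j \<in> D" "\<And>j. Hs.nrm (sec j x - g j) < 1 / real (Suc m)" by metis
    then have P: "(g, m) \<in> P" using x by (auto simp: P_def near_def)
    define q where "q = pt (g, m)"
    have q: "q \<in> X" "\<And>j. Hs.nrm (sec j q - g j) < 1 / real (Suc m)"
      using near_pt[OF P] by (auto simp: near_def q_def)
    have "Hs.nrm (sec j q - sec j x) < e / real CARD('n)" for j
    proof -
      have gH: "g j \<in> H" using g D by blast
      have "Hs.nrm (sec j q - sec j x) \<le> Hs.nrm (sec j q - g j) + Hs.nrm (sec j x - g j)"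
        using Hs.nrm_triangle_diff[of "sec j q" "g j" "sec j x"] Hs.nrm_minus_commute[of "g j" "sec j x"] gH q x section_in by auto
      also have "\<dots> < e / (2 * real CARD('n)) + e / (2 * real CARD('n))"
        using q(2)[of j] g(2)[of j] m by linarith
      finally show ?thesis by simp
    qed
    then have "sec_dist q x < (\<Sum>j\<in>(UNIV::'n set). e / real CARD('n))"
      unfolding sec_dist_def by (intro sum_strict_mono) auto
    then show ?thesis using P by (auto simp: q_def)
  qed
  ultimately show ?thesis using that[of "pt ` P"] by (auto simp: dense_points_def)
qed

definition base :: "'a set \<Rightarrow> 'a set set" where
  "base Q = (\<lambda>(q, m). {x \<in> X. sec_dist q x < 1 / real (Suc m)}) ` (Q \<times> UNIV)"

lemma countable_base: "dense_points Q \<Longrightarrow> countable (base Q)"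
  unfolding base_def dense_points_def by auto

lemma openin_base: "dense_points Q \<Longrightarrow> b \<in> base Q \<Longrightarrow> openin \<tau> b"
  unfolding base_def dense_points_def using openin_sec_ball by auto

text \<open>Two steps of \<open>sec_dist\<close> below \<open>r / 2\<close> stay within
  \<open>r\<close>, and \<open>kd\<close> is bounded by \<open>sec_dist\<close>; so balls of the
  auxiliary pseudo-metric around countably many centres form a base.\<close>

lemma open_eq_Union_base:
  assumes Q: "dense_points Q" and U: "openin \<tau> U"
  shows "U = \<Union>{b \<in> base Q. b \<subseteq> U}"
proof (intro equalityI subsetI)
  fix x assume x: "x \<in> U"
  then obtain r where r: "r > 0" "{t \<in> X. kd x t < r} \<subseteq> U" and xX: "x \<in> X"
    using U unfolding openin_pseudometric_topology by blast
  obtain m where m: "1 / real (Suc m) < r / 2"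
    using reals_Archimedean[of "r / 2"] r by (auto simp: inverse_eq_divide)
  obtain q where q: "q \<in> Q" "sec_dist q x < 1 / real (Suc m)"
    using Q xX unfolding dense_points_def by (metis of_nat_0_less_iff zero_less_Suc zero_less_divide_1_iff)
  have qX: "q \<in> X" using q Q by (auto simp: dense_points_def)
  define b where "b = {t \<in> X. sec_dist q t < 1 / real (Suc m)}"
  have "b \<subseteq> U"
  proof
    fix t assume "t \<in> b"
    then have t: "t \<in> X" "sec_dist q t < 1 / real (Suc m)" by (auto simp: b_def)
    have "kd x t \<le> sec_dist x q + sec_dist q t"
      using kernel_dist_le[OF xX t(1)] sec_dist_triangle[OF xX qX t(1)] by linarith
    also have "\<dots> < r" using q t m sec_dist_commute[OF xX qX] by simp
    finally show "t \<in> U" using r t by auto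
  qed
  moreover have "b \<in> base Q" using q unfolding base_def b_def by auto
  moreover have "x \<in> b" using q xX by (auto simp: b_def)
  ultimately show "x \<in> \<Union>{b \<in> base Q. b \<subseteq> U}" by blast
qed auto

text \<open>Sections depend continuously on the point, so approximation at the dense points carries
  over to all points.\<close>

lemma sec_approximable:
  assumes Q: "dense_points Q" and e: "Hs.orthonormal I e"
    and appr: "\<And>q. q \<in> Q \<Longrightarrow> \<exists>F c. finite F \<and> F \<subseteq> I \<and> Hs.nrm (sec j q - (\<Sum>i\<in>F. fun_scale (c i) (e i))) = 0"
    and x: "x \<in> X" and "\<epsilon> > 0"
  shows "\<exists>F c. finite F \<and> F \<subseteq> I \<and> Hs.nrm (sec j x - (\<Sum>i\<in>F. fun_scale (c i) (e i))) < \<epsilon>"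
proof -
  obtain q where q: "q \<in> Q" "sec_dist q x < \<epsilon>" using Q x \<open>\<epsilon> > 0\<close> unfolding dense_points_def by blast
  have qX: "q \<in> X" using q Q by (auto simp: dense_points_def)
  obtain F c where F: "finite F" "F \<subseteq> I" "Hs.nrm (sec j q - (\<Sum>i\<in>F. fun_scale (c i) (e i))) = 0" using appr[OF q(1)] by blast
  have s: "(\<Sum>i\<in>F. fun_scale (c i) (e i)) \<in> H" using F e by (auto dest: Hs.orthonormalD)
  have "Hs.nrm (sec j q - sec j x) \<le> sec_dist q x"
    unfolding sec_dist_def using section_in qX x by (intro member_le_sum) auto
  moreover have "Hs.nrm (sec j x - (\<Sum>i\<in>F. fun_scale (c i) (e i))) \<le> Hs.nrm (sec j x - sec j q) + Hs.nrm (sec j q - (\<Sum>i\<in>F. fun_scale (c i) (e i)))"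
    using s section_in qX x by (intro Hs.nrm_triangle_diff) auto
  moreover have "Hs.nrm (sec j x - sec j q) = Hs.nrm (sec j q - sec j x)"
    using section_in qX x by (intro Hs.nrm_minus_commute) auto
  ultimately show ?thesis using F q by (intro exI[of _ F] exI[of _ c]) auto
qed

text \<open>By the reproducing property the components of \<open>w x\<close> are inner products with
  sections, and these are limits of combinations of the \<open>e i\<close>.\<close>

lemma orthogonal_null_if_sec_approximable:
  assumes e: "Hs.orthonormal I e"
    and appr: "\<And>x j \<epsilon>. x \<in> X \<Longrightarrow> \<epsilon> > 0 \<Longrightarrow> \<exists>F c. finite F \<and> F \<subseteq> I \<and> Hs.nrm (sec j x - (\<Sum>i\<in>F. fun_scale (c i) (e i))) < \<epsilon>"
    and w: "w \<in> H" "\<And>i. i \<in> I \<Longrightarrow> ip w (e i) = 0"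
  shows "w = 0"
proof
  fix x
  show "w x = 0 x"
  proof (cases "x \<in> X")
    case True
    have "ip w (sec j x) = 0" for j
    proof -
      have "((\<lambda>i. ip (sec j x) (e i) * ip (e i) w) has_sum ip (sec j x) w) I"
        using appr[OF True] section_in[OF True] w e
        by (intro Hs.ip_has_sum Hs.residual_tendsto_zeroI) auto
      moreover have "((\<lambda>i. ip (sec j x) (e i) * ip (e i) w) has_sum 0) I"
      proof (rule has_sum_0)
        fix i assume i: "i \<in> I"
        then have "ip (e i) w = cnj (ip w (e i))" using w e Hs.orthonormalD(1)[OF e i] by (intro Hs.ip_commute) auto
        then show "ip (sec j x) (e i) * ip (e i) w = 0" using w(2)[OF i] by simp
      qed
      ultimately have "ip (sec j x) w = 0" using has_sum_unique by blast
      then show ?thesis using Hs.ip_commute[of "sec j x" w] section_in[OF True] w by simp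
    qed
    then show ?thesis using eval_component[OF w(1) True] by (simp add: vec_eq_iff)
  qed (simp add: eval_outside w)
qed

text \<open>The basis is built from sections at countably many points, not from an arbitrary dense
  subset of \<open>H\<close>, because measurability of the kernel gives that of its sections; this
  is how \<open>measurable_H\<close> reaches all of \<open>H\<close>.\<close>

lemma orthonormal_basis_of_sections:
  assumes "dense_points Q"
  obtains J and e :: "nat \<Rightarrow> _" where "Hs.orthonormal J e" "\<And>k. e k \<in> Hs.span {sec j q |j q. q \<in> Q}"
    "\<And>f. f \<in> H \<Longrightarrow> ((\<lambda>F. Hs.nrm (f - Hs.proj e F f)) \<longlongrightarrow> 0) (finite_subsets_at_top J)"
proof -
  let ?A = "{sec j q |j q. q \<in> Q}"
  have A: "?A = (\<lambda>(j, q). sec j q) ` (UNIV \<times> Q)" by auto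
  have "countable ?A" unfolding A using assms by (auto simp: dense_points_def)
  moreover have "?A \<subseteq> H" using assms section_in by (auto simp: dense_points_def)
  ultimately obtain J and e :: "nat \<Rightarrow> _" where e: "Hs.orthonormal J e" "\<And>k. e k \<in> Hs.span ?A"
    "\<And>a. a \<in> ?A \<Longrightarrow> \<exists>F c. finite F \<and> F \<subseteq> J \<and> Hs.nrm (a - (\<Sum>i\<in>F. fun_scale (c i) (e i))) = 0"
    by (rule Hs.orthonormal_sequence_of_countable) blast
  have "((\<lambda>F. Hs.nrm (f - Hs.proj e F f)) \<longlongrightarrow> 0) (finite_subsets_at_top J)" if "f \<in> H" for f
  proof (rule Hs.residual_tendsto_zero_if_orthogonal[OF e(1) that])
    fix w assume "w \<in> H" "\<And>i. i \<in> J \<Longrightarrow> ip w (e i) = 0"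
    then have "w = 0"
      by (rule orthogonal_null_if_sec_approximable[OF e(1) sec_approximable[OF assms e(1) e(3)], rotated -2]) auto
    then show "ip w f = 0" using that by simp
  qed
  then show ?thesis using that e by blast
qed

end

section \<open>The measure \<open>\<nu>\<close> and the adjoint of the inclusion of \<open>H\<close> into \<open>L\<^sup>2\<close>\<close>

lemma norm_matrix_vector_mult_le:
  fixes A :: "complex^'n^'m"
  shows "norm (A *v v) \<le> (\<Sum>i\<in>UNIV. \<Sum>j\<in>UNIV. cmod (A $ i $ j)) * norm v"
proof -
  have "norm (A *v v) \<le> (\<Sum>i\<in>UNIV. cmod ((A *v v) $ i))"
    unfolding norm_vec_def by (rule L2_set_le_sum) simp
  also have "\<dots> \<le> (\<Sum>i\<in>UNIV. \<Sum>j\<in>UNIV. cmod (A $ i $ j) * norm v)"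
  proof (rule sum_mono)
    fix i
    have "cmod ((A *v v) $ i) \<le> (\<Sum>j\<in>UNIV. cmod (A $ i $ j * v $ j))"
      unfolding matrix_vector_mult_def by (simp add: norm_sum)
    also have "\<dots> \<le> (\<Sum>j\<in>UNIV. cmod (A $ i $ j) * norm v)"
      by (intro sum_mono) (simp add: norm_mult mult_left_mono Finite_Cartesian_Product.norm_nth_le)
    finally show "cmod ((A *v v) $ i) \<le> (\<Sum>j\<in>UNIV. cmod (A $ i $ j) * norm v)" .
  qed
  finally show ?thesis by (simp add: sum_distrib_right)
qed

lemma bounded_linear_matrix_vector_mult: "bounded_linear (\<lambda>v. A *v v)" for A :: "complex^'n^'m"
proof (rule bounded_linear_intro)
  show "A *v (x + y) = A *v x + A *v y" for x y by (simp add: matrix_vector_right_distrib)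
  show "A *v (r *\<^sub>R x) = r *\<^sub>R (A *v x)" for r x
    by (simp add: vec_eq_iff matrix_vector_mult_def scaleR_sum_right)
  show "norm (A *v v) \<le> norm v * (\<Sum>i\<in>UNIV. \<Sum>j\<in>UNIV. cmod (A $ i $ j))" for v
    using norm_matrix_vector_mult_le[of A v] by (simp add: mult.commute)
qed

lemma matrix_opnorm_nonneg: "matrix_opnorm A \<ge> 0"
  unfolding matrix_opnorm_def by (rule onorm_pos_le[OF bounded_linear_matrix_vector_mult])

lemma cmod_entry_le_matrix_opnorm: "cmod (A $ i $ j) \<le> matrix_opnorm A"
proof -
  have "(A *v axis j 1) $ i = A $ i $ j"
    by (simp add: matrix_vector_mult_def axis_def if_distrib cong: if_cong)
  then have "cmod (A $ i $ j) \<le> norm (A *v axis j 1)"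
    by (metis Finite_Cartesian_Product.norm_nth_le)
  also have "\<dots> \<le> matrix_opnorm A * norm (axis j 1 :: complex^_)"
    unfolding matrix_opnorm_def by (rule onorm[OF bounded_linear_matrix_vector_mult])
  finally show ?thesis by (simp add: norm_axis_one)
qed

text \<open>Comparison with the entries yields continuity of the operator norm, on which
  measurability of the weight rests.\<close>

lemma matrix_opnorm_lipschitz:
  fixes A B :: "complex^'n^'m"
  shows "\<bar>matrix_opnorm A - matrix_opnorm B\<bar> \<le> (\<Sum>i\<in>UNIV. \<Sum>j\<in>UNIV. cmod (A $ i $ j - B $ i $ j))"
proof -
  have *: "matrix_opnorm A - matrix_opnorm B \<le> (\<Sum>i\<in>UNIV. \<Sum>j\<in>UNIV. cmod (A $ i $ j - B $ i $ j))" for A B :: "complex^'n^'m"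
  proof -
    have "onorm (\<lambda>v. (A - B) *v v) \<le> (\<Sum>i\<in>UNIV. \<Sum>j\<in>UNIV. cmod ((A - B) $ i $ j))"
      by (intro onorm_bound norm_matrix_vector_mult_le sum_nonneg) auto
    moreover have "onorm (\<lambda>v. (A - B) *v v + B *v v) \<le> onorm (\<lambda>v. (A - B) *v v) + onorm (\<lambda>v. B *v v)"
      by (intro onorm_triangle bounded_linear_matrix_vector_mult)
    moreover have "(A - B) *v v + B *v v = A *v v" for v
      by (simp add: matrix_vector_mult_diff_rdistrib)
    ultimately show ?thesis unfolding matrix_opnorm_def by simp
  qed
  show ?thesis using *[of A B] *[of B A] by (simp add: norm_minus_commute abs_le_iff)
qed

lemma continuous_matrix_opnorm: "continuous_on UNIV (matrix_opnorm :: complex^'n^'m \<Rightarrow> real)"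
proof (rule continuous_at_imp_continuous_on, rule ballI)
  fix B :: "complex^'n^'m"
  have lim: "((\<lambda>A. \<Sum>i\<in>UNIV. \<Sum>j\<in>UNIV. cmod (A $ i $ j - B $ i $ j)) \<longlongrightarrow> (\<Sum>i\<in>(UNIV::'m set). \<Sum>j\<in>(UNIV::'n set). cmod (B $ i $ j - B $ i $ j))) (at B)"
    by (intro tendsto_intros)
  have "((\<lambda>A. matrix_opnorm A - matrix_opnorm B) \<longlongrightarrow> 0) (at B)"
    by (rule Lim_null_comparison[OF always_eventually]) (use lim matrix_opnorm_lipschitz in auto)
  then show "isCont matrix_opnorm B" unfolding isCont_def by (rule LIM_zero_cancel)
qed

locale mercer_setting = rkhs "space M" K H ip + finite_measure M
  for M :: "'a measure"
    and K :: "'a \<Rightarrow> 'a \<Rightarrow> complex^'n^'n"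
    and H :: "('a \<Rightarrow> complex^'n) set"
    and ip :: "('a \<Rightarrow> complex^'n) \<Rightarrow> ('a \<Rightarrow> complex^'n) \<Rightarrow> complex" +
  assumes measurable_K: "(\<lambda>(x, t). K x t) \<in> borel_measurable (M \<Otimes>\<^sub>M M)"
    and separable: "separable_function_space H ip"
begin

abbreviation N :: "'a measure" where "N \<equiv> kernel_measure M K"

abbreviation weight :: "'a \<Rightarrow> real" where "weight x \<equiv> 1 / (1 + matrix_opnorm (K x x))"

lemma measurable_kernel_left: "t \<in> space M \<Longrightarrow> (\<lambda>x. K x t) \<in> borel_measurable M"
  using measurable_Pair1[OF measurable_K] by simp

lemma measurable_kernel_diag: "(\<lambda>x. K x x) \<in> borel_measurable M"
proof -
  have "(\<lambda>x. (x, x)) \<in> M \<rightarrow>\<^sub>M M \<Otimes>\<^sub>M M" by measurable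
  from measurable_compose[OF this measurable_K] show ?thesis by simp
qed

lemma measurable_kernel_diag_entry [measurable]: "(\<lambda>x. K x x $ l $ j) \<in> borel_measurable M"
  by (intro measurable_vec_nth measurable_kernel_diag)

lemma measurable_weight [measurable]: "weight \<in> borel_measurable M"
proof -
  have "(\<lambda>x. matrix_opnorm (K x x)) \<in> borel_measurable M"
    by (rule measurable_compose[OF measurable_kernel_diag borel_measurable_continuous_onI[OF continuous_matrix_opnorm]])
  then show ?thesis by measurable
qed

lemma weight_pos: "weight x > 0"
  using matrix_opnorm_nonneg[of "K x x"] by (simp add: add_pos_nonneg)

lemma space_N [simp]: "space N = space M" and sets_N [simp, measurable_cong]: "sets N = sets M"
  by (simp_all add: kernel_measure_def)

text \<open>The weight is positive everywhere, so both measures have the same null sets; equalities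
  almost everywhere for \<open>N\<close> can thus be used on the support of
  \<open>M\<close>.\<close>

lemma AE_N_iff: "(AE x in N. P x) \<longleftrightarrow> (AE x in M. P x)"
proof -
  have "(\<lambda>x. ennreal (weight x)) \<in> borel_measurable M" by measurable
  from AE_density[OF this, of P] show ?thesis
    unfolding kernel_measure_def using weight_pos by simp
qed

lemma finite_measure_N: "finite_measure N"
proof (rule finite_measureI)
  have "emeasure N (space N) = (\<integral>\<^sup>+x. ennreal (weight x) * indicator (space M) x \<partial>M)"
    unfolding kernel_measure_def space_density by (rule emeasure_density) measurable
  also have "\<dots> \<le> (\<integral>\<^sup>+x. 1 \<partial>M)"
    using matrix_opnorm_nonneg
    by (intro nn_integral_mono) (auto simp: indicator_def ennreal_le_1 divide_le_eq_1 add_pos_nonneg)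
  also have "\<dots> = emeasure M (space M)" by simp
  finally show "emeasure N (space N) \<noteq> \<infinity>"
    using emeasure_finite by (metis infinity_ennreal_def neq_top_trans)
qed

sublocale L: semi_hilbert fun_scale "L2 N :: ('a \<Rightarrow> complex^'n) set" "L2_inner N"
  by (rule semi_hilbert_L2[OF finite_measure_N])

lemma trace_eq: "x \<in> space M \<Longrightarrow> trace x = (\<Sum>j\<in>UNIV. Re (K x x $ j $ j))"
  by (simp add: trace_def kernel_diag)

lemma measurable_trace [measurable]: "trace \<in> borel_measurable M"
proof -
  have "(\<lambda>x. \<Sum>j\<in>UNIV. Re (K x x $ j $ j)) \<in> borel_measurable M" by measurable
  then show ?thesis using trace_eq by (simp cong: measurable_cong)
qed

text \<open>This is what the weight is for: each diagonal entry is at most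
  \<open>matrix_opnorm (K x x)\<close>, so trace times weight is bounded by
  \<open>CARD('n)\<close>.\<close>

lemma integrable_trace: "integrable N trace"
proof -
  have "integrable M (\<lambda>x. weight x *\<^sub>R trace x)"
  proof (rule integrable_const_bound[of _ "real CARD('n)"])
    have "norm (weight x *\<^sub>R trace x) \<le> real CARD('n)" if "x \<in> space M" for x
    proof -
      have "Re (K x x $ j $ j) \<le> matrix_opnorm (K x x)" for j
        using cmod_entry_le_matrix_opnorm[of "K x x" j j] complex_Re_le_cmod order_trans by blast
      then have "trace x \<le> real CARD('n) * matrix_opnorm (K x x)"
        unfolding trace_eq[OF that] using sum_bounded_above[of UNIV "\<lambda>j. Re (K x x $ j $ j)" "matrix_opnorm (K x x)"] by simp
      also have "\<dots> \<le> real CARD('n) * (1 + matrix_opnorm (K x x))" by simp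
      finally have "trace x / (1 + matrix_opnorm (K x x)) \<le> real CARD('n)"
        using matrix_opnorm_nonneg[of "K x x"] by (simp add: divide_le_eq add_pos_nonneg)
      then show ?thesis using trace_nonneg[of x] matrix_opnorm_nonneg[of "K x x"] by simp
    qed
    then show "AE x in M. norm (weight x *\<^sub>R trace x) \<le> real CARD('n)" by (rule AE_I2)
  qed measurable
  then show ?thesis
    unfolding kernel_measure_def using weight_pos
    by (subst integrable_density) (auto intro: less_imp_le)
qed

lemma filterlim_initial_segments:
  fixes J :: "nat set"
  shows "filterlim (\<lambda>k. J \<inter> {..<k}) (finite_subsets_at_top J) sequentially"
  unfolding filterlim_finite_subsets_at_top
proof (intro allI impI)
  fix Y assume "finite Y \<and> Y \<subseteq> J"
  then obtain k where "Y \<subseteq> {..<k}" using finite_nat_bounded by blast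
  then have "Y \<subseteq> J \<inter> {..<l}" if "l \<ge> k" for l using that \<open>finite Y \<and> Y \<subseteq> J\<close> by force
  then show "\<forall>\<^sub>F k in sequentially. finite (J \<inter> {..<k}) \<and> Y \<subseteq> J \<inter> {..<k} \<and> J \<inter> {..<k} \<subseteq> J"
    unfolding eventually_sequentially by blast
qed

lemma measurable_section: 
  assumes "q \<in> space M" shows "sec j q \<in> borel_measurable M"
proof (rule measurable_vec_lambda)
  fix l
  have "(\<lambda>t. K t q $ l $ j) \<in> borel_measurable M"
    by (intro measurable_vec_nth measurable_kernel_left assms)
  then show "(\<lambda>t. sec j q t $ l) \<in> borel_measurable M"
    using sec_apply by (simp cong: measurable_cong)
qed

text \<open>Finite combinations of sections are measurable, and norm convergence implies convergence
  at each point, since evaluation at \<open>x\<close> is bounded by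
  \<open>sqrt (trace x)\<close>.\<close>

lemma measurable_H:
  assumes f: "f \<in> H" shows "f \<in> borel_measurable M"
proof -
  obtain Q where Q: "dense_points Q" using dense_points_exist[OF separable] .
  obtain J and e :: "nat \<Rightarrow> 'a \<Rightarrow> complex^'n" where e: "Hs.orthonormal J e" "\<And>k. e k \<in> Hs.span {sec j q |j q. q \<in> Q}"
    "\<And>f. f \<in> H \<Longrightarrow> ((\<lambda>F. Hs.nrm (f - Hs.proj e F f)) \<longlongrightarrow> 0) (finite_subsets_at_top J)"
    by (rule orthonormal_basis_of_sections[OF Q]) blast
  have "Hs.span {sec j q |j q. q \<in> Q} \<subseteq> borel_measurable M"
  proof (rule Hs.span_minimal)
    show "{sec j q |j q. q \<in> Q} \<subseteq> borel_measurable M"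
      using Q measurable_section by (auto simp: dense_points_def)
    show "Hs.subspace (borel_measurable M)"
      unfolding Hs.subspace_def fun_scale_def plus_fun_def zero_fun_def by (auto intro: measurable_vector_scalar_mult)
  qed
  then have me [measurable]: "e k \<in> borel_measurable M" for k using e(2) by blast
  define s where "s k = Hs.proj e (J \<inter> {..<k}) f" for k
  have sH: "s k \<in> H" for k unfolding s_def by (rule Hs.proj_in[OF e(1)]) auto
  have s_eq: "s k = (\<lambda>x. \<Sum>i\<in>J \<inter> {..<k}. ip f (e i) *s e i x)" for k
    by (simp add: fun_eq_iff s_def Hs.proj_def sum_fun_apply)
  show ?thesis
  proof (rule borel_measurable_LIMSEQ_metric)
    show "s k \<in> borel_measurable M" for k unfolding s_eq by measurable
    fix x assume x: "x \<in> space M"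
    have "(\<lambda>k. Hs.nrm (f - s k)) \<longlonglongrightarrow> 0"
      unfolding s_def by (rule filterlim_compose[OF e(3)[OF f] filterlim_initial_segments])
    then have lim: "(\<lambda>k. Hs.nrm (f - s k) * sqrt (trace x)) \<longlonglongrightarrow> 0" by (rule tendsto_mult_left_zero)
    have "(\<lambda>k. f x - s k x) \<longlonglongrightarrow> 0"
    proof (rule Lim_null_comparison[OF _ lim])
      show "\<forall>\<^sub>F k in sequentially. norm (f x - s k x) \<le> Hs.nrm (f - s k) * sqrt (trace x)"
        using norm_eval_le[of "f - s _", OF Hs.S_diff[OF f sH] x] by simp
    qed
    from tendsto_diff[OF tendsto_const[of "f x"] this] show "(\<lambda>k. s k x) \<longlonglongrightarrow> f x" by simp
  qed
qed

section \<open>The Hilbert--Schmidt property of the inclusion into L2\<close>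

lemma H_subset_L2: "f \<in> H \<Longrightarrow> f \<in> L2 N"
proof (rule L2_I_bound)
  assume f: "f \<in> H"
  show "f \<in> borel_measurable N" using measurable_H[OF f] by simp
  show "integrable N (\<lambda>x. (Hs.nrm f)\<^sup>2 * trace x)" using integrable_trace by simp
  show "x \<in> space N \<Longrightarrow> (norm (f x))\<^sup>2 \<le> (Hs.nrm f)\<^sup>2 * trace x" for x
    using norm_eval_sq_le[OF f] by simp
qed

lemma L2_nrm_le:
  assumes f: "f \<in> H" shows "L.nrm f \<le> sqrt (\<integral>x. trace x \<partial>N) * Hs.nrm f"
proof (rule power2_le_imp_le)
  have T: "(\<integral>x. trace x \<partial>N) \<ge> 0" using trace_nonneg by simp
  have "(L.nrm f)\<^sup>2 = (\<integral>x. (norm (f x))\<^sup>2 \<partial>N)" by (rule L2_nrm_sq[OF H_subset_L2[OF f]])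
  also have "\<dots> \<le> (\<integral>x. (Hs.nrm f)\<^sup>2 * trace x \<partial>N)"
    using L2D(2)[OF H_subset_L2[OF f]] integrable_trace norm_eval_sq_le[OF f] by (intro integral_mono) auto
  finally show "(L.nrm f)\<^sup>2 \<le> (sqrt (\<integral>x. trace x \<partial>N) * Hs.nrm f)\<^sup>2"
    using T by (simp add: power_mult_distrib mult.commute)
  show "0 \<le> sqrt (\<integral>x. trace x \<partial>N) * Hs.nrm f" using T f by simp
qed

text \<open>At each point the components of the \<open>e k\<close> are, up to conjugation, the
  coefficients of the sections along the family, so Bessel's inequality bounds the sum of their
  squares by the trace; it remains to integrate.\<close>

lemma sum_L2_nrm_orthonormal_le:
  assumes e: "Hs.orthonormal I e" and F: "finite F" "F \<subseteq> I"
  shows "(\<Sum>k\<in>F. (L.nrm (e k))\<^sup>2) \<le> (\<integral>x. trace x \<partial>N)"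
proof -
  have eH: "e k \<in> H" if "k \<in> F" for k using e F that by (auto dest: Hs.orthonormalD)
  have "(\<Sum>k\<in>F. (L.nrm (e k))\<^sup>2) = (\<Sum>k\<in>F. \<integral>x. (norm (e k x))\<^sup>2 \<partial>N)"
    using eH H_subset_L2 by (intro sum.cong L2_nrm_sq) auto
  also have "\<dots> = (\<integral>x. (\<Sum>k\<in>F. (norm (e k x))\<^sup>2) \<partial>N)"
    using eH H_subset_L2 L2D(2) by (intro Bochner_Integration.integral_sum[symmetric]) blast
  also have "\<dots> \<le> (\<integral>x. trace x \<partial>N)"
  proof (rule integral_mono)
    show "integrable N (\<lambda>x. \<Sum>k\<in>F. (norm (e k x))\<^sup>2)"
      using eH H_subset_L2 L2D(2) by (intro Bochner_Integration.integrable_sum) blast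
    fix x assume "x \<in> space N"
    then have x: "x \<in> space M" by simp
    have "(\<Sum>k\<in>F. (norm (e k x))\<^sup>2) = (\<Sum>k\<in>F. \<Sum>j\<in>UNIV. (cmod (ip (sec j x) (e k)))\<^sup>2)"
      unfolding norm_vec_sq
    proof (intro sum.cong refl)
      fix k j assume "k \<in> F"
      then show "(cmod (e k x $ j))\<^sup>2 = (cmod (ip (sec j x) (e k)))\<^sup>2"
        using eval_component[OF eH x] Hs.ip_commute[OF section_in[OF x] eH] by simp
    qed
    also have "\<dots> = (\<Sum>j\<in>UNIV. \<Sum>k\<in>F. (cmod (ip (sec j x) (e k)))\<^sup>2)" by (rule sum.swap)
    also have "\<dots> \<le> trace x"
      unfolding trace_def using section_in[OF x] by (intro sum_mono Hs.bessel[OF e F])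
    finally show "(\<Sum>k\<in>F. (norm (e k x))\<^sup>2) \<le> trace x" .
  qed (rule integrable_trace)
  finally show ?thesis .
qed

text \<open>The integral operator, with values in \<open>H\<close>, is the adjoint of the inclusion of \<open>H\<close> into
  \<open>L\<^sup>2\<close>; on \<open>H\<close> it is the operator that is diagonalized below.\<close>

definition adj :: "('a \<Rightarrow> complex^'n) \<Rightarrow> 'a \<Rightarrow> complex^'n" where
  "adj g x = (if x \<in> space M then integral_operator N K g x else 0)"

lemma cinner_section: "x \<in> space M \<Longrightarrow> t \<in> space M \<Longrightarrow> cinner v (sec l x t) = (K x t *v v) $ l"
  by (simp add: cinner_def matrix_vector_mult_def sec_apply kernel_commute[of x t] mult.commute)

lemma adj_component:
  assumes g: "g \<in> L2 N" and x: "x \<in> space M"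
  shows "adj g x $ l = L2_inner N g (sec l x)"
proof -
  \<comment> \<open>Integrability is at hand only for the components, which are inner products of
    square integrable functions; measurability and integrability of the vector are derived from
    them.\<close>
  have comp: "integrable N (\<lambda>t. (K x t *v g t) $ l)" for l
  proof -
    have int: "integrable N (\<lambda>t. cinner (g t) (sec l x t))"
      by (rule integrable_cinner[OF g H_subset_L2[OF section_in[OF x]]])
    have "cinner (g t) (sec l x t) = (K x t *v g t) $ l" if "t \<in> space N" for t
      using that by (simp add: cinner_section[OF x])
    from iffD1[OF Bochner_Integration.integrable_cong[OF refl this] int] show ?thesis .
  qed
  have int: "integrable N (\<lambda>t. K x t *v g t)"
  proof (rule Bochner_Integration.integrable_bound)
    show "integrable N (\<lambda>t. \<Sum>l\<in>UNIV. cmod ((K x t *v g t) $ l))" using comp by (intro Bochner_Integration.integrable_sum integrable_norm)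
    show "(\<lambda>t. K x t *v g t) \<in> borel_measurable N" using comp by (intro measurable_vec_lambda borel_measurable_integrable)
    have "norm (v :: complex^'n) \<le> (\<Sum>l\<in>UNIV. cmod (v $ l))" for v
      unfolding norm_vec_def by (rule L2_set_le_sum) simp
    then show "AE t in N. norm (K x t *v g t) \<le> norm (\<Sum>l\<in>UNIV. cmod ((K x t *v g t) $ l))"
      by (simp add: sum_nonneg)
  qed
  have "adj g x $ l = (\<integral>t. (K x t *v g t) $ l \<partial>N)"
    using integral_bounded_linear[OF bounded_linear_vec_nth[of l] int] x by (simp add: adj_def integral_operator_def)
  also have "\<dots> = L2_inner N g (sec l x)"
    unfolding L2_inner_def using cinner_section[OF x] by (intro Bochner_Integration.integral_cong) auto
  finally show ?thesis .
qed

text \<open>The pointwise integral does not show membership in \<open>H\<close>. Instead the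
  functional \<open>h \<mapsto> L2_inner N g h\<close> determines coefficients along a basis, square
  summable because the inclusion is Hilbert--Schmidt, and \<open>riesz_fischer\<close> yields a
  vector \<open>p\<close> of \<open>H\<close> representing the conjugate functional in the other
  slot.\<close>

lemma adj:
  assumes g: "g \<in> L2 N"
  shows adj_in: "adj g \<in> H" and ip_adj: "h \<in> H \<Longrightarrow> ip (adj g) h = L2_inner N g h"
proof -
  obtain Q where Q: "dense_points Q" using dense_points_exist[OF separable] .
  obtain J and e :: "nat \<Rightarrow> 'a \<Rightarrow> complex^'n" where e: "Hs.orthonormal J e" "\<And>k. e k \<in> Hs.span {sec j q |j q. q \<in> Q}"
    and dense: "\<And>f. f \<in> H \<Longrightarrow> ((\<lambda>F. Hs.nrm (f - Hs.proj e F f)) \<longlongrightarrow> 0) (finite_subsets_at_top J)"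
    by (rule orthonormal_basis_of_sections[OF Q]) blast
  have eH: "e k \<in> H" if "k \<in> J" for k using e that by (auto dest: Hs.orthonormalD)
  define c where "c k = L2_inner N g (e k)" for k
  have "(\<lambda>k. (cmod (c k))\<^sup>2) summable_on J"
  proof (rule nonneg_bdd_above_summable_on)
    have "(\<Sum>k\<in>F. (cmod (c k))\<^sup>2) \<le> (L.nrm g)\<^sup>2 * (\<integral>x. trace x \<partial>N)" if F: "finite F" "F \<subseteq> J" for F
    proof -
      have "(\<Sum>k\<in>F. (cmod (c k))\<^sup>2) \<le> (\<Sum>k\<in>F. (L.nrm g)\<^sup>2 * (L.nrm (e k))\<^sup>2)"
        unfolding c_def power_mult_distrib[symmetric]
        using F eH H_subset_L2 g by (intro sum_mono power_mono L.cauchy_schwarz) auto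
      also have "\<dots> \<le> (L.nrm g)\<^sup>2 * (\<integral>x. trace x \<partial>N)"
        unfolding sum_distrib_left[symmetric] using sum_L2_nrm_orthonormal_le[OF e(1) F] by (intro mult_left_mono) auto
      finally show ?thesis .
    qed
    then show "bdd_above (sum (\<lambda>k. (cmod (c k))\<^sup>2) ` {F. F \<subseteq> J \<and> finite F})"
      by (intro bdd_aboveI[of _ "(L.nrm g)\<^sup>2 * (\<integral>x. trace x \<partial>N)"]) auto
  qed simp
  then obtain p where p: "p \<in> H" "\<And>k. k \<in> J \<Longrightarrow> ip p (e k) = c k"
    by (rule Hs.riesz_fischer[OF e(1)]) blast
  have ip_p: "ip p h = L2_inner N g h" if h: "h \<in> H" for h
  proof -
    have "((\<lambda>k. ip p (e k) * ip (e k) h) has_sum ip p h) J"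
      by (rule Hs.ip_has_sum[OF e(1) p(1) h dense[OF p(1)]])
    then have 1: "((\<lambda>k. c k * ip (e k) h) has_sum ip p h) J" using p(2) by (simp cong: has_sum_cong)
    have "((\<lambda>k. c k * ip (e k) h) has_sum L2_inner N g h) J"
      unfolding has_sum_def
    proof (rule Lim_transform2[OF tendsto_const[of "L2_inner N g h"]])
      have "((\<lambda>F. L.nrm g * (sqrt (\<integral>x. trace x \<partial>N) * Hs.nrm (h - Hs.proj e F h))) \<longlongrightarrow> 0) (finite_subsets_at_top J)"
        by (intro tendsto_mult_right_zero dense[OF h])
      moreover have "\<forall>\<^sub>F F in finite_subsets_at_top J. norm (L2_inner N g h - (\<Sum>k\<in>F. c k * ip (e k) h))
          \<le> L.nrm g * (sqrt (\<integral>x. trace x \<partial>N) * Hs.nrm (h - Hs.proj e F h))"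
      proof (rule eventually_finite_subsets_at_top_weakI)
        fix F assume F: "finite F" "F \<subseteq> J"
        have pF: "Hs.proj e F h \<in> H" by (rule Hs.proj_in[OF e(1) F(2)])
        have "L2_inner N g (Hs.proj e F h) = (\<Sum>k\<in>F. cnj (ip h (e k)) * c k)"
          unfolding Hs.proj_def c_def using F eH H_subset_L2 g by (intro L.ip_sum_right) auto
        also have "\<dots> = (\<Sum>k\<in>F. c k * ip (e k) h)"
          using F eH h by (intro sum.cong) (auto simp: Hs.ip_commute[OF h eH] subset_iff)
        finally have "L2_inner N g h - (\<Sum>k\<in>F. c k * ip (e k) h) = L2_inner N g (h - Hs.proj e F h)"
          using g H_subset_L2[OF h] H_subset_L2[OF pF] by (simp add: L.ip_diff_right)
        moreover have "cmod (L2_inner N g (h - Hs.proj e F h)) \<le> L.nrm g * L.nrm (h - Hs.proj e F h)"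
          using g H_subset_L2[OF h] H_subset_L2[OF pF] by (intro L.cauchy_schwarz) auto
        moreover have "\<dots> \<le> L.nrm g * (sqrt (\<integral>x. trace x \<partial>N) * Hs.nrm (h - Hs.proj e F h))"
          using g h pF by (intro mult_left_mono L2_nrm_le) auto
        ultimately show "norm (L2_inner N g h - (\<Sum>k\<in>F. c k * ip (e k) h))
          \<le> L.nrm g * (sqrt (\<integral>x. trace x \<partial>N) * Hs.nrm (h - Hs.proj e F h))" by simp
      qed
      ultimately show "((\<lambda>F. L2_inner N g h - (\<Sum>k\<in>F. c k * ip (e k) h)) \<longlongrightarrow> 0) (finite_subsets_at_top J)"
        by (rule Lim_null_comparison[rotated])
    qed
    then show ?thesis using 1 has_sum_unique by blast
  qed
  \<comment> \<open>Inserting sections for \<open>h\<close> gives the values of \<open>p\<close>,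
    and they are those of the integral.\<close>
  have "p = adj g"
  proof
    fix x show "p x = adj g x"
    proof (cases "x \<in> space M")
      case True
      then show ?thesis
        using eval_component[OF p(1) True] ip_p[OF section_in[OF True]] adj_component[OF g True]
        by (simp add: vec_eq_iff)
    qed (simp add: eval_outside p adj_def)
  qed
  then show "adj g \<in> H" "h \<in> H \<Longrightarrow> ip (adj g) h = L2_inner N g h" using p ip_p by auto
qed

text \<open>An open set is a countable union of base balls, and these are measurable since
  \<open>sec_dist q x\<close> is a formula in entries of the kernel.\<close>

lemma openin_sets:
  assumes "openin \<tau> U" shows "U \<in> sets M"
proof -
  obtain Q where Q: "dense_points Q" using dense_points_exist[OF separable] .
  have "b \<in> sets M" if b: "b \<in> base Q" for b
  proof -
    obtain q m where q: "q \<in> Q" "b = {x \<in> space M. sec_dist q x < 1 / real (Suc m)}"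
      using b by (auto simp: base_def simp del: of_nat_Suc)
    have qX: "q \<in> space M" using q Q by (auto simp: dense_points_def)
    have [measurable]: "(\<lambda>x. K x q $ j $ j) \<in> borel_measurable M" for j
      by (intro measurable_vec_nth measurable_kernel_left qX)
    have "(\<lambda>x. \<Sum>j\<in>UNIV. sqrt (Re (K q q $ j $ j) - 2 * Re (K x q $ j $ j) + Re (K x x $ j $ j))) \<in> borel_measurable M"
      by measurable
    moreover have "sec_dist q x = (\<Sum>j\<in>UNIV. sqrt (Re (K q q $ j $ j) - 2 * Re (K x q $ j $ j) + Re (K x x $ j $ j)))"
      if x: "x \<in> space M" for x
      unfolding sec_dist_def
    proof (rule sum.cong)
      fix j
      have "(Hs.nrm (sec j q - sec j x))\<^sup>2 = Re (K q q $ j $ j) - 2 * Re (K x q $ j $ j) + Re (K x x $ j $ j)"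
        using section_in[OF x] section_in[OF qX] by (simp add: Hs.nrm_diff_sq kernel_diag x qX ip_sec)
      then show "Hs.nrm (sec j q - sec j x) = sqrt (Re (K q q $ j $ j) - 2 * Re (K x q $ j $ j) + Re (K x x $ j $ j))"
        using section_in[OF x] section_in[OF qX] by (metis Hs.S_diff Hs.nrm_nonneg real_sqrt_unique)
    qed simp
    ultimately have "(\<lambda>x. sec_dist q x) \<in> borel_measurable M" by (simp cong: measurable_cong)
    then show ?thesis unfolding q by measurable
  qed
  then have "\<Union>{b \<in> base Q. b \<subseteq> U} \<in> sets M"
    using countable_base[OF Q] by (intro sets.countable_Union) (auto intro: countable_subset)
  then show ?thesis using open_eq_Union_base[OF Q assms] by simp
qed

text \<open>\<open>Z\<close> is the largest null open set: every null open set is a union of null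
  members of the base, and countability of the base keeps \<open>Z\<close> null. Hence the
  complement of \<open>Z\<close> is the least closed set of full measure.\<close>

lemma support_properties:
  shows support_subset: "measure_support \<tau> M \<subseteq> space M"
    and support_disjoint: "openin \<tau> U \<Longrightarrow> emeasure M U = 0 \<Longrightarrow> U \<inter> measure_support \<tau> M = {}"
proof -
  obtain Q where Q: "dense_points Q" using dense_points_exist[OF separable] .
  define Z where "Z = \<Union>{b \<in> base Q. emeasure M b = 0}"
  have baseQ: "b \<in> base Q \<Longrightarrow> openin \<tau> b" for b by (rule openin_base[OF Q])
  have Zopen: "openin \<tau> Z" unfolding Z_def using baseQ by (intro openin_Union) auto
  have "(\<Union>b\<in>{b \<in> base Q. emeasure M b = 0}. b) \<in> null_sets M"
  proof (rule null_sets_UN')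
    show "countable {b \<in> base Q. emeasure M b = 0}"
      by (rule countable_subset[OF Collect_subset countable_base[OF Q]])
  qed (use baseQ openin_sets in \<open>auto simp: null_sets_def\<close>)
  then have "Z \<in> null_sets M" by (simp add: Z_def)
  then have Z0: "emeasure M Z = 0" "Z \<in> sets M" by (auto simp: null_sets_def)
  have null_sub: "U \<subseteq> Z" if "openin \<tau> U" "emeasure M U = 0" for U
  proof -
    have "emeasure M b = 0" if "b \<in> base Q" "b \<subseteq> U" for b
      using emeasure_mono[OF that(2), of M] openin_sets[OF \<open>openin \<tau> U\<close>] \<open>emeasure M U = 0\<close> by simp
    then show ?thesis using open_eq_Union_base[OF Q that(1)] unfolding Z_def by blast
  qed
  have "measure_support \<tau> M = space M - Z"
    unfolding measure_support_def
  proof (rule Least_equality)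
    have "emeasure M (space M - Z) = emeasure M (space M)"
      using \<open>Z \<in> null_sets M\<close> by (simp add: emeasure_Diff_null_set)
    moreover have "closedin \<tau> (space M - Z)"
      unfolding closedin_def using Zopen openin_subset[OF Zopen] by (simp add: double_diff)
    ultimately show "closedin \<tau> (space M - Z) \<and> emeasure M (space M - Z) = emeasure M (space M)" by blast
  next
    fix C assume C: "closedin \<tau> C \<and> emeasure M C = emeasure M (space M)"
    then have CX: "C \<subseteq> space M" and op: "openin \<tau> (space M - C)" by (auto simp: closedin_def)
    have "space M - (space M - C) \<in> sets M" using openin_sets[OF op] by blast
    then have "C \<in> sets M" using CX by (simp add: double_diff)
    then have "emeasure M (space M - C) = 0"
      using C CX by (subst emeasure_Diff) auto
    then show "space M - Z \<le> C" using null_sub[OF op] by blast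
  qed
  then show "measure_support \<tau> M \<subseteq> space M"
    and "openin \<tau> U \<Longrightarrow> emeasure M U = 0 \<Longrightarrow> U \<inter> measure_support \<tau> M = {}"
    using null_sub by auto
qed

lemma continuous_AE_eq_on_support:
  assumes f: "continuous_map \<tau> euclidean f" and g: "continuous_map \<tau> euclidean g"
    and ae: "AE x in N. f x = g x" and x: "x \<in> measure_support \<tau> M"
  shows "f x = (g x :: complex^'n)"
proof (rule ccontr)
  assume ne: "f x \<noteq> g x"
  define U where "U = {x \<in> topspace \<tau>. f x - g x \<in> - {0}}"
  have "continuous_map \<tau> euclidean (\<lambda>x. f x - g x)" by (rule continuous_map_diff[OF f g])
  then have "openin \<tau> U"
    unfolding U_def by (rule openin_continuous_map_preimage) (simp add: open_Compl)
  moreover have "emeasure M U = 0"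
  proof -
    have "AE x in M. f x = g x" using ae by (simp add: AE_N_iff)
    then have "AE x in M. x \<notin> U" by eventually_elim (simp add: U_def)
    then show ?thesis using openin_sets[OF \<open>openin \<tau> U\<close>] AE_iff_null_sets[of U M] by (auto simp: null_sets_def)
  qed
  ultimately have "x \<notin> U" using support_disjoint x by blast
  then show False using ne support_subset x by (auto simp: U_def)
qed

end

section \<open>Expansions of the kernel\<close>

context rkhs
begin

text \<open>Evaluations are inner products with sections, so weak convergence implies convergence at
  each point; this prepares the dominated convergence in
  \<open>eigenfunctions_of_adj\<close>.\<close>

lemma tendsto_eval_of_weak:
  assumes "\<And>g. g \<in> H \<Longrightarrow> (\<lambda>n. ip (h n) g) \<longlonglongrightarrow> ip p g" "\<And>n. h n \<in> H" "p \<in> H" "x \<in> X"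
  shows "(\<lambda>n. (norm (h n x))\<^sup>2) \<longlonglongrightarrow> (norm (p x))\<^sup>2"
  unfolding norm_vec_sq using assms section_in
  by (intro tendsto_sum tendsto_power tendsto_norm) (simp add: eval_component)

definition sec_residual :: "('i \<Rightarrow> 'a \<Rightarrow> complex^'n) \<Rightarrow> 'n \<Rightarrow> 'i set \<Rightarrow> 'a \<Rightarrow> real" where
  "sec_residual v j F x = Hs.nrm (sec j x - Hs.proj v F (sec j x))"

text \<open>Passing to the residual is additive and does not increase the norm, whence a constant
  independent of \<open>F\<close>. It is written \<open>1 * kd x t\<close> to match
  \<open>openin_less\<close>.\<close>

lemma residual_lipschitz:
  assumes v: "Hs.orthonormal I v" and F: "finite F" "F \<subseteq> I" and x: "x \<in> X" and t: "t \<in> X"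
  shows "sec_residual v j F t \<le> sec_residual v j F x + 1 * kd x t"
proof -
  let ?d = "sec j t - sec j x"
  have s: "sec j x \<in> H" "sec j t \<in> H" using x t section_in by auto
  have p: "Hs.proj v F f \<in> H" for f using v F by blast
  have eq: "sec j t - Hs.proj v F (sec j t) = (sec j x - Hs.proj v F (sec j x)) + (?d - Hs.proj v F ?d)"
    using Hs.proj_diff[OF v F(2) s(2) s(1)] by (simp add: algebra_simps)
  have "sec_residual v j F t \<le> sec_residual v j F x + Hs.nrm (?d - Hs.proj v F ?d)"
    unfolding sec_residual_def eq using s p by (intro Hs.nrm_triangle Hs.S_diff)
  also have "Hs.nrm (?d - Hs.proj v F ?d) \<le> Hs.nrm ?d"
    using s by (intro Hs.residual_le[OF v F]) auto
  also have "Hs.nrm ?d \<le> kd x t"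
    using nrm_sec_diff_le[OF x t, of j] Hs.nrm_minus_commute[OF s(2) s(1)] by simp
  finally show ?thesis by simp
qed

text \<open>Dini's argument: the residuals decrease in \<open>F\<close> and are Lipschitz uniformly in \<open>F\<close>.\<close>

lemma residual_uniform_on_compact:
  assumes v: "Hs.orthonormal I v" and C: "compactin \<tau> C" and "e > 0"
    and lim: "\<And>x. x \<in> C \<Longrightarrow> ((\<lambda>F. sec_residual v j F x) \<longlongrightarrow> 0) (finite_subsets_at_top I)"
  shows "\<forall>\<^sub>F F in finite_subsets_at_top I. \<forall>x\<in>C. sec_residual v j F x < e"
proof -
  define U where "U F = {x \<in> X. sec_residual v j F x < e}" for F
  define \<F> where "\<F> = {F. finite F \<and> F \<subseteq> I}"
  have CX: "C \<subseteq> X" using compactin_subset_topspace[OF C] by simp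
  have op: "openin \<tau> (U F)" if "F \<in> \<F>" for F
    unfolding U_def by (rule openin_less[of 1]) (use residual_lipschitz[OF v, of F] that in \<open>auto simp: \<F>_def\<close>)
  have "C \<subseteq> \<Union>(U ` \<F>)"
  proof
    fix x assume x: "x \<in> C"
    then have "\<forall>\<^sub>F F in finite_subsets_at_top I. dist (sec_residual v j F x) 0 < e"
      using lim[OF x] \<open>e > 0\<close> by (intro tendstoD)
    then obtain F where "F \<in> \<F>" "dist (sec_residual v j F x) 0 < e"
      unfolding eventually_finite_subsets_at_top \<F>_def by blast
    then show "x \<in> \<Union>(U ` \<F>)" using x CX by (auto simp: U_def dist_real_def abs_less_iff intro!: bexI[of _ F])
  qed
  then obtain \<U> where "finite \<U>" "\<U> \<subseteq> U ` \<F>" "C \<subseteq> \<Union>\<U>"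
    using C op unfolding compactin_def by (metis (no_types, lifting) image_iff)
  then obtain \<G> where \<G>: "finite \<G>" "\<G> \<subseteq> \<F>" "C \<subseteq> \<Union>(U ` \<G>)"
    using finite_subset_image[of \<U> U \<F>] by blast
  have "sec_residual v j F x < e" if F: "finite F" "\<Union>\<G> \<subseteq> F" "F \<subseteq> I" and x: "x \<in> C" for F x
  proof -
    obtain G where G: "G \<in> \<G>" "x \<in> U G" using \<G> x by blast
    have "sec_residual v j F x \<le> sec_residual v j G x"
      unfolding sec_residual_def
      by (rule Hs.residual_antimono[OF v F(1) _ F(3)]) (use G F x CX section_in in auto)
    then show ?thesis using G by (simp add: U_def)
  qed
  moreover have "finite (\<Union>\<G>)" "\<Union>\<G> \<subseteq> I" using \<G> by (auto simp: \<F>_def)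
  ultimately show ?thesis
    unfolding eventually_finite_subsets_at_top by (intro exI[of _ "\<Union>\<G>"]) simp
qed

text \<open>The error is the inner product of the residuals of two sections. Bounding it by a
  product separates the variables, so uniformity on a compact set of pairs reduces to uniformity on
  its two projections.\<close>

lemma kernel_expansion_error:
  assumes v: "Hs.orthonormal I v" and F: "finite F" "F \<subseteq> I" and x: "x \<in> X" and t: "t \<in> X"
  shows "cmod (K x t $ l $ j - (\<Sum>i\<in>F. v i x $ l * cnj (v i t $ j))) \<le> sec_residual v j F t * sec_residual v l F x"
proof -
  have vH: "v i \<in> H" if "i \<in> F" for i using v F that by (auto dest: Hs.orthonormalD)
  have s: "sec j t \<in> H" "sec l x \<in> H" using x t section_in by auto
  have p: "Hs.proj v F f \<in> H" for f using v F by blast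
  have "ip (sec j t) (v i) * ip (v i) (sec l x) = v i x $ l * cnj (v i t $ j)" if "i \<in> F" for i
    using eval_component[OF vH[OF that] x, of l] eval_component[OF vH[OF that] t, of j] Hs.ip_commute[OF vH[OF that] s(1)] by simp
  then have "(\<Sum>i\<in>F. v i x $ l * cnj (v i t $ j)) = (\<Sum>i\<in>F. ip (sec j t) (v i) * ip (v i) (sec l x))"
    by (intro sum.cong) auto
  then have "K x t $ l $ j - (\<Sum>i\<in>F. v i x $ l * cnj (v i t $ j)) = ip (sec j t - Hs.proj v F (sec j t)) (sec l x - Hs.proj v F (sec l x))"
    using Hs.ip_residuals[OF v F s] by (simp add: ip_sec x t)
  then show ?thesis
    unfolding sec_residual_def using s p by (simp add: Hs.cauchy_schwarz)
qed

lemma kernel_expansion: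
  assumes v: "Hs.orthonormal I v" and x: "x \<in> X" and t: "t \<in> X"
    and lim: "((\<lambda>F. sec_residual v j F t) \<longlongrightarrow> 0) (finite_subsets_at_top I)"
  shows "((\<lambda>i. v i x $ l * cnj (v i t $ j)) has_sum K x t $ l $ j) I"
proof -
  have s: "sec j t \<in> H" "sec l x \<in> H" using x t section_in by auto
  have *: "ip (sec j t) (v i) * ip (v i) (sec l x) = v i x $ l * cnj (v i t $ j)" if "i \<in> I" for i
    using eval_component[OF Hs.orthonormalD(1)[OF v that] x, of l] eval_component[OF Hs.orthonormalD(1)[OF v that] t, of j]
      Hs.ip_commute[OF Hs.orthonormalD(1)[OF v that] s(1)] by simp
  have "((\<lambda>i. ip (sec j t) (v i) * ip (v i) (sec l x)) has_sum ip (sec j t) (sec l x)) I"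
    using Hs.ip_has_sum[OF v s] lim unfolding sec_residual_def .
  from iffD1[OF has_sum_cong[OF *] this] show ?thesis by (simp add: ip_sec x t)
qed

lemma kernel_expansion_uniform:
  assumes v: "Hs.orthonormal I v" and C: "compactin (prod_topology \<tau> \<tau>) C"
    and lim: "\<And>j x. x \<in> fst ` C \<union> snd ` C \<Longrightarrow> ((\<lambda>F. sec_residual v j F x) \<longlongrightarrow> 0) (finite_subsets_at_top I)"
  shows "uniform_limit C (\<lambda>F (x, t). \<Sum>i\<in>F. v i x $ l * cnj (v i t $ j)) (\<lambda>(x, t). K x t $ l $ j) (finite_subsets_at_top I)"
proof (rule uniform_limitI)
  fix e :: real assume e: "e > 0"
  have C1: "compactin \<tau> (fst ` C)" and C2: "compactin \<tau> (snd ` C)"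
    using image_compactin[OF C continuous_map_fst] image_compactin[OF C continuous_map_snd] by auto
  have X12: "fst ` C \<subseteq> X" "snd ` C \<subseteq> X"
    using compactin_subset_topspace[OF C1] compactin_subset_topspace[OF C2] by auto
  have "\<forall>\<^sub>F F in finite_subsets_at_top I. finite F \<and> F \<subseteq> I"
    by (rule eventually_finite_subsets_at_top_weakI) simp
  moreover have "\<forall>\<^sub>F F in finite_subsets_at_top I. \<forall>x\<in>fst ` C. sec_residual v l F x < e"
    by (rule residual_uniform_on_compact[OF v C1 e]) (use lim in auto)
  \<comment> \<open>The second factor only has to be bounded; the bound 1 leaves the product below
    \<open>e\<close>.\<close>
  moreover have "\<forall>\<^sub>F F in finite_subsets_at_top I. \<forall>x\<in>snd ` C. sec_residual v j F x < 1"
    by (rule residual_uniform_on_compact[OF v C2]) (use lim in auto)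
  ultimately show "\<forall>\<^sub>F F in finite_subsets_at_top I. \<forall>z\<in>C.
      dist (case z of (x, t) \<Rightarrow> \<Sum>i\<in>F. v i x $ l * cnj (v i t $ j)) (case z of (x, t) \<Rightarrow> K x t $ l $ j) < e"
  proof eventually_elim
    case (elim F)
    show ?case
    proof
      fix z assume z: "z \<in> C"
      obtain x t where xt: "z = (x, t)" by (cases z)
      have x: "x \<in> X" "sec_residual v l F x < e" and t: "t \<in> X" "sec_residual v j F t < 1"
        using z xt X12 elim by force+
      have "sec_residual v j F t \<ge> 0" "sec_residual v l F x \<ge> 0"
        unfolding sec_residual_def using v elim x t section_in by (auto intro!: Hs.nrm_nonneg Hs.S_diff Hs.proj_in[of I])
      then have "sec_residual v j F t * sec_residual v l F x \<le> 1 * sec_residual v l F x"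
        using t by (intro mult_right_mono) auto
      then have "cmod (K x t $ l $ j - (\<Sum>i\<in>F. v i x $ l * cnj (v i t $ j))) < e"
        using kernel_expansion_error[OF v _ _ x(1) t(1), of F l j] elim x by simp
      then show "dist (case z of (x, t) \<Rightarrow> \<Sum>i\<in>F. v i x $ l * cnj (v i t $ j)) (case z of (x, t) \<Rightarrow> K x t $ l $ j) < e"
        by (simp add: xt dist_norm norm_minus_commute)
    qed
  qed
qed

end

section \<open>Eigenfunctions of the integral operator\<close>

context mercer_setting
begin

abbreviation kerL :: "('a \<Rightarrow> complex^'n) set" where "kerL \<equiv> operator_kernel N K"

text \<open>A product of a map with its adjoint has the kernel of the adjoint: if
  \<open>adj g\<close> vanishes almost everywhere, its squared norm in \<open>H\<close>, which is
  the L2 inner product of \<open>g\<close> with \<open>adj g\<close>, is zero, and so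
  \<open>adj g\<close> vanishes at every point.\<close>

lemma adj_eq_zero_iff:
  assumes g: "g \<in> L2 N" shows "g \<in> kerL \<longleftrightarrow> adj g = 0"
proof
  assume "g \<in> kerL"
  then have "AE x in N. integral_operator N K g x = 0" by (simp add: operator_kernel_def)
  then have "AE x in N. adj g x = 0" by eventually_elim (simp add: adj_def)
  then have "L.nrm (adj g) = 0" using L2_AE_zero_iff H_subset_L2 adj_in[OF g] by blast
  then have "L2_inner N g (adj g) = 0" using L.cauchy_schwarz[OF g H_subset_L2[OF adj_in[OF g]]] by simp
  then have "ip (adj g) (adj g) = 0" using ip_adj[OF g adj_in[OF g]] by simp
  then show "adj g = 0" using nrm_zero_imp[OF adj_in[OF g]] by (simp add: Hs.nrm_def)
next
  assume 0: "adj g = 0"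
  have "integral_operator N K g x = 0" if "x \<in> space M" for x
    using fun_cong[OF 0, of x] that by (simp add: adj_def)
  then show "g \<in> kerL" using g by (auto simp: operator_kernel_def intro: AE_I2)
qed

text \<open>The range of the inclusion is orthogonal to the kernel of its adjoint.\<close>

lemma H_orthogonal_kerL: "h \<in> H \<Longrightarrow> h \<in> L2_orthogonal N kerL"
proof -
  assume h: "h \<in> H"
  have "L2_inner N h f = 0" if "f \<in> kerL" for f
  proof -
    have f: "f \<in> L2 N" using that by (simp add: operator_kernel_def)
    have "L2_inner N f h = 0" using ip_adj[OF f h] adj_eq_zero_iff[OF f] that h by simp
    then show ?thesis using L.ip_commute[OF f H_subset_L2[OF h]] by simp
  qed
  then show ?thesis using H_subset_L2[OF h] by (simp add: L2_orthogonal_def)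
qed

lemma adj_scale: "g \<in> L2 N \<Longrightarrow> adj (fun_scale c g) = fun_scale c (adj g)"
proof
  fix x assume g: "g \<in> L2 N"
  show "adj (fun_scale c g) x = fun_scale c (adj g) x"
  proof (cases "x \<in> space M")
    case True
    then show ?thesis
      using g adj_component[OF g True] adj_component[OF L.S_scale[OF g] True] H_subset_L2[OF section_in[OF True]]
      by (simp add: vec_eq_iff L.ip_scale_left)
  qed (simp add: adj_def)
qed

lemma L2_inner_cong_AE:
  fixes f g g' :: "'a \<Rightarrow> complex^'n"
  assumes "f \<in> L2 N" "g \<in> L2 N" "g' \<in> L2 N" "AE x in N. g x = g' x"
  shows "L2_inner N f g = L2_inner N f g'"
proof -
  have "AE x in N. (g - g') x = 0" using assms(4) by eventually_elim simp
  then have "L.nrm (g - g') = 0" using L2_AE_zero_iff assms by blast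
  then have "L2_inner N f (g - g') = 0" using L.cauchy_schwarz[of f "g - g'"] assms by simp
  then show ?thesis using assms by (simp add: L.ip_diff_right)
qed

text \<open>The form \<open>ip (adj f) f\<close> is the squared L2 norm of \<open>f\<close>. Along a
  weakly convergent sequence in the unit ball the squared values converge pointwise and are
  dominated by the integrable trace, so the form converges as \<open>spectral_theorem\<close>
  requires.\<close>

lemma eigenfunctions_of_adj:
  obtains I :: "nat set" and u \<sigma> where "Hs.orthonormal I u" "\<And>i. i \<in> I \<Longrightarrow> \<sigma> i > 0"
    "\<And>i. i \<in> I \<Longrightarrow> adj (u i) = fun_scale (complex_of_real (\<sigma> i)) (u i)"
    "\<And>f. f \<in> H \<Longrightarrow> (\<And>i. i \<in> I \<Longrightarrow> ip f (u i) = 0) \<Longrightarrow> L2_inner N f f = 0"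
proof -
  obtain Q where Q: "dense_points Q" using dense_points_exist[OF separable] .
  obtain J and e :: "nat \<Rightarrow> 'a \<Rightarrow> complex^'n" where e: "Hs.orthonormal J e"
    and dense: "\<And>f. f \<in> H \<Longrightarrow> ((\<lambda>F. Hs.nrm (f - Hs.proj e F f)) \<longlongrightarrow> 0) (finite_subsets_at_top J)"
    by (rule orthonormal_basis_of_sections[OF Q]) blast
  have adjH: "adj f \<in> H" if "f \<in> H" for f by (rule adj_in[OF H_subset_L2[OF that]])
  have ipT: "ip (adj f) g = L2_inner N f g" if "f \<in> H" "g \<in> H" for f g by (rule ip_adj[OF H_subset_L2[OF that(1)] that(2)])
  have "\<exists>U \<sigma>. Hs.orthonormal U (\<lambda>u. u) \<and> (\<forall>u\<in>U. \<sigma> u > 0 \<and> adj u = fun_scale (complex_of_real (\<sigma> u)) u) \<and>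
    (\<forall>f\<in>H. (\<forall>u\<in>U. ip f u = 0) \<longrightarrow> ip (adj f) f = 0)"
  proof (rule Hs.spectral_theorem)
    show "adj f \<in> H" if "f \<in> H" for f by (rule adjH[OF that])
    show "ip (adj f) g = ip f (adj g)" if "f \<in> H" "g \<in> H" for f g
      using that Hs.ip_commute[OF adjH[OF that(2)] that(1)] L.ip_commute[OF H_subset_L2 H_subset_L2, OF that(2) that(1)]
      by (simp add: ipT)
    show "ip (adj f) f \<in> \<real>\<^sub>\<ge>\<^sub>0" if "f \<in> H" for f
      unfolding ipT[OF that that] by (rule L.ip_self_nonneg[OF H_subset_L2[OF that]])
    show "f = 0" if "f \<in> H" "Hs.nrm f = 0" for f by (rule nrm_zero_imp[OF that])
    fix h :: "nat \<Rightarrow> 'a \<Rightarrow> complex^'n"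
    assume h: "\<And>n. h n \<in> H" "\<And>n. Hs.nrm (h n) \<le> 1"
    obtain r p where r: "strict_mono r" "p \<in> H" "Hs.nrm p \<le> 1" "\<And>g. g \<in> H \<Longrightarrow> (\<lambda>n. ip (h (r n)) g) \<longlonglongrightarrow> ip p g"
      by (rule Hs.weakly_convergent_subsequence[of J e h, OF e _ dense h]) (use countableI_type in blast)+
    have Re_ip: "Re (ip (adj f) f) = (\<integral>x. (norm (f x))\<^sup>2 \<partial>N)" if "f \<in> H" for f
      by (simp add: ipT that L2_inner_self)
    have "(\<lambda>n. \<integral>x. (norm (h (r n) x))\<^sup>2 \<partial>N) \<longlonglongrightarrow> (\<integral>x. (norm (p x))\<^sup>2 \<partial>N)"
    proof (rule integral_dominated_convergence[where w = trace])
      show "(\<lambda>x. (norm (p x))\<^sup>2) \<in> borel_measurable N" "\<And>n. (\<lambda>x. (norm (h (r n) x))\<^sup>2) \<in> borel_measurable N"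
        using L2D(2)[OF H_subset_L2[OF r(2)]] L2D(2)[OF H_subset_L2[OF h(1)]] by (blast intro: borel_measurable_integrable)+
      show "integrable N trace" by (rule integrable_trace)
      show "AE x in N. (\<lambda>n. (norm (h (r n) x))\<^sup>2) \<longlonglongrightarrow> (norm (p x))\<^sup>2"
        using tendsto_eval_of_weak[of "\<lambda>n. h (r n)" p] r h by (intro AE_I2) auto
      show "AE x in N. norm ((norm (h (r n) x))\<^sup>2) \<le> trace x" for n
      proof (rule AE_I2)
        fix x assume "x \<in> space N"
        then have "(norm (h (r n) x))\<^sup>2 \<le> (Hs.nrm (h (r n)))\<^sup>2 * trace x"
          using norm_eval_sq_le[OF h(1)] by simp
        also have "\<dots> \<le> 1 * trace x"
          using h trace_nonneg by (intro mult_right_mono) (auto simp: power_le_one)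
        finally show "norm ((norm (h (r n) x))\<^sup>2) \<le> trace x" by simp
      qed
    qed
    then have "(\<lambda>n. Re (ip (adj (h (r n))) (h (r n)))) \<longlonglongrightarrow> Re (ip (adj p) p)"
      using Re_ip r(2) h(1) by simp
    then show "\<exists>r p. strict_mono r \<and> p \<in> H \<and> Hs.nrm p \<le> 1 \<and> (\<forall>g\<in>H. (\<lambda>n. ip (h (r n)) g) \<longlonglongrightarrow> ip p g) \<and>
        (\<lambda>n. Re (ip (adj (h (r n))) (h (r n)))) \<longlonglongrightarrow> Re (ip (adj p) p)"
      using r by (intro exI[of _ r] exI[of _ p]) auto
  qed
  then obtain U \<sigma> where U: "Hs.orthonormal U (\<lambda>u. u)" "\<And>u. u \<in> U \<Longrightarrow> \<sigma> u > 0"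
    "\<And>u. u \<in> U \<Longrightarrow> adj u = fun_scale (complex_of_real (\<sigma> u)) u"
    "\<And>f. f \<in> H \<Longrightarrow> (\<And>u. u \<in> U \<Longrightarrow> ip f u = 0) \<Longrightarrow> ip (adj f) f = 0"
    by blast
  have cU: "countable U" by (rule Hs.countable_orthonormal_set[OF U(1) e _ dense]) auto
  \<comment> \<open>The eigenvectors are renumbered by naturals, so that the family is visibly
    countable.\<close>
  define I where "I = to_nat_on U ` U"
  have inI: "from_nat_into U i \<in> U" if "i \<in> I" for i using that cU by (auto simp: I_def)
  have surj: "\<exists>i\<in>I. from_nat_into U i = u" if "u \<in> U" for u using that cU by (auto simp: I_def)
  have inj: "from_nat_into U i = from_nat_into U k \<longleftrightarrow> i = k" if "i \<in> I" "k \<in> I" for i k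
    using that cU by (auto simp: I_def)
  show ?thesis
  proof (rule that[of I "from_nat_into U" "\<lambda>i. \<sigma> (from_nat_into U i)"])
    show "Hs.orthonormal I (from_nat_into U)"
      using inI inj Hs.orthonormalD[OF U(1)] unfolding Hs.orthonormal_def by simp
    show "L2_inner N f f = 0" if "f \<in> H" "\<And>i. i \<in> I \<Longrightarrow> ip f (from_nat_into U i) = 0" for f
      using U(4)[of f] that surj ipT by metis
  qed (use inI U in auto)
qed

text \<open>A unit eigenvector in \<open>H\<close> with eigenvalue \<sigma> has squared L2 norm
  \<sigma>, whence the factor \<open>1 / sqrt \<sigma>\<close>. As these functions are built in
  \<open>H\<close>, the eigenvalue equation holds at every point and not only almost
  everywhere.\<close>

lemma mercer_family_exists:
  "\<exists>(I :: nat set) f \<sigma>. mercer_family M K ip I f \<sigma> \<and> pointwise_eigenfamily M K I f \<sigma>"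
proof -
  obtain I :: "nat set" and u \<sigma> where u: "Hs.orthonormal I u" "\<And>i. i \<in> I \<Longrightarrow> \<sigma> i > 0"
    "\<And>i. i \<in> I \<Longrightarrow> adj (u i) = fun_scale (complex_of_real (\<sigma> i)) (u i)"
    "\<And>f. f \<in> H \<Longrightarrow> (\<And>i. i \<in> I \<Longrightarrow> ip f (u i) = 0) \<Longrightarrow> L2_inner N f f = 0"
    using eigenfunctions_of_adj by blast
  define c where "c i = complex_of_real (1 / sqrt (\<sigma> i))" for i
  define f where "f i = fun_scale (c i) (u i)" for i
  have uH: "u i \<in> H" if "i \<in> I" for i using u(1) that by (auto dest: Hs.orthonormalD)
  have uL: "u i \<in> L2 N" if "i \<in> I" for i using H_subset_L2[OF uH[OF that]] .
  have fH: "f i \<in> H" if "i \<in> I" for i unfolding f_def using uH[OF that] by blast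
  have fL: "f i \<in> L2 N" if "i \<in> I" for i using H_subset_L2[OF fH[OF that]] .
  have adj_f: "adj (f i) = fun_scale (complex_of_real (\<sigma> i)) (f i)" if "i \<in> I" for i
    unfolding f_def using adj_scale[OF uL[OF that]] u(3)[OF that] by (simp add: mult.commute)
  have eigen: "integral_operator N K (f i) x = \<sigma> i *\<^sub>R f i x" if "i \<in> I" "x \<in> space M" for i x
    using fun_cong[OF adj_f[OF that(1)], of x] that(2) by (simp add: adj_def vec_eq_iff scaleR_conv_of_real[where 'a=complex])
  have orth: "L.orthonormal I f"
    unfolding L.orthonormal_def
  proof (intro conjI ballI)
    fix i assume i: "i \<in> I" then show "f i \<in> L2 N" by (rule fL)
    fix k assume k: "k \<in> I"
    have "L2_inner N (u i) (u k) = complex_of_real (\<sigma> i) * ip (u i) (u k)"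
      using ip_adj[OF uL[OF i] uH[OF k]] u(3)[OF i] uH i k by (simp add: Hs.ip_scale_left)
    also have "ip (u i) (u k) = (if i = k then 1 else 0)" by (rule Hs.orthonormalD(2)[OF u(1) i k])
    finally have "L2_inner N (f i) (f k) = c i * (cnj (c k) * (complex_of_real (\<sigma> i) * (if i = k then 1 else 0)))"
      unfolding f_def using uL[OF i] uL[OF k] by (simp add: L.ip_scale_left L.ip_scale_right)
    moreover have "c i * (cnj (c i) * complex_of_real (\<sigma> i)) = 1"
    proof -
      have "c i * (cnj (c i) * complex_of_real (\<sigma> i)) = complex_of_real (1 / sqrt (\<sigma> i) * (1 / sqrt (\<sigma> i) * \<sigma> i))"
        by (simp only: c_def complex_cnj_complex_of_real of_real_mult)
      also have "1 / sqrt (\<sigma> i) * (1 / sqrt (\<sigma> i) * \<sigma> i) = 1" using u(2)[OF i] by (simp add: field_simps)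
      finally show ?thesis by simp
    qed
    ultimately show "L2_inner N (f i) (f k) = (if i = k then 1 else 0)" by (cases "i = k") simp_all
  qed
  have basis: "orthonormal_basis (L2_orthogonal N kerL) (L2_inner N) I f"
    unfolding orthonormal_basis_def
  proof (intro conjI ballI allI impI)
    show "orthonormal_family (L2_orthogonal N kerL) (L2_inner N) I f"
      unfolding orthonormal_family_def using H_orthogonal_kerL[OF fH] L.orthonormalD(2)[OF orth] by blast
    fix g and \<epsilon> :: real assume g: "g \<in> L2_orthogonal N kerL" and \<epsilon>: "\<epsilon> > 0"
    then have gL: "g \<in> L2 N" by (simp add: L2_orthogonal_def)
    have "((\<lambda>F. L.nrm (g - L.proj f F g)) \<longlongrightarrow> 0) (finite_subsets_at_top I)"
    proof (rule L.residual_tendsto_zero_if_orthogonal[OF orth gL])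
      fix w assume w: "w \<in> L2 N" "\<And>i. i \<in> I \<Longrightarrow> L2_inner N w (f i) = 0"
      have wH: "adj w \<in> H" by (rule adj_in[OF w(1)])
      have "ip (adj w) (u i) = 0" if "i \<in> I" for i
      proof -
        have "L2_inner N w (f i) = cnj (c i) * L2_inner N w (u i)"
          unfolding f_def using uL[OF that] w by (simp add: L.ip_scale_right)
        moreover have "c i \<noteq> 0" using u(2)[OF that] by (simp add: c_def)
        ultimately show ?thesis using w(2)[OF that] ip_adj[OF w(1) uH[OF that]] by simp
      qed
      \<comment> \<open>\<open>adj w\<close> is orthogonal in \<open>H\<close> to all eigenvectors,
        so it is null in L2; then its norm in \<open>H\<close> is zero too, because its square is
        the L2 product of \<open>w\<close> with \<open>adj w\<close>.\<close>
      then have "L2_inner N (adj w) (adj w) = 0" by (rule u(4)[OF wH])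
      then have "L.nrm (adj w) = 0" by (simp add: L.nrm_def)
      then have "ip (adj w) (adj w) = 0"
        using L.cauchy_schwarz[OF w(1) H_subset_L2[OF wH]] by (simp add: ip_adj[OF w(1) wH])
      then have "adj w = 0" using nrm_zero_imp[OF wH] by (simp add: Hs.nrm_def)
      then have "w \<in> kerL" using adj_eq_zero_iff[OF w(1)] by simp
      then have "L2_inner N g w = 0" using g by (simp add: L2_orthogonal_def)
      then show "L2_inner N w g = 0" using L.ip_commute[OF gL w(1)] by simp
    qed
    then have "\<forall>\<^sub>F F in finite_subsets_at_top I. dist (L.nrm (g - L.proj f F g)) 0 < \<epsilon>"
      using \<epsilon> by (rule tendstoD)
    then obtain F where F: "finite F" "F \<subseteq> I" "dist (L.nrm (g - L.proj f F g)) 0 < \<epsilon>"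
      unfolding eventually_finite_subsets_at_top by blast
    have "ip_norm (L2_inner N) (\<lambda>x. g x - (\<Sum>i\<in>F. L2_inner N g (f i) *s f i x)) = L.nrm (g - L.proj f F g)"
      unfolding ip_norm_def L.nrm_def L.proj_def fun_diff_def by (simp add: sum_fun_apply)
    then show "\<exists>F c. finite F \<and> F \<subseteq> I \<and> ip_norm (L2_inner N) (\<lambda>x. g x - (\<Sum>i\<in>F. c i *s f i x)) < \<epsilon>"
      using F by (intro exI[of _ F] exI[of _ "\<lambda>i. L2_inner N g (f i)"]) (auto simp: dist_real_def)
  qed
  have "mercer_family M K ip I f \<sigma>"
    unfolding mercer_family_def Let_def
    using basis continuous_kernel_topology[OF fH] subset_functions fH u(2) eigen by (auto intro!: AE_I2)
  moreover have "pointwise_eigenfamily M K I f \<sigma>"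
    unfolding pointwise_eigenfamily_def using eigen by blast
  ultimately show ?thesis by blast
qed

end

section \<open>Consequences for an arbitrary family of eigenfunctions\<close>

context mercer_setting
begin

text \<open>In \<open>H\<close> the product of \<open>adj (f i)\<close> and \<open>adj (f k)\<close>
  is the L2 product of \<open>f i\<close> with \<open>\<sigma> k\<close> times \<open>f k\<close>,
  so the factors \<open>1 / sqrt (\<sigma> i)\<close> make the \<open>v i\<close> orthonormal. They
  are built from \<open>adj\<close> because \<open>f i\<close> need not belong to \<open>H\<close>;
  \<open>v i\<close> is \<open>sqrt (\<sigma> i)\<close> times \<open>f i\<close> wherever the
  eigenvalue equation holds.\<close>

lemma mercer_family_properties:
  fixes I :: "'i set"
  assumes fam: "mercer_family M K ip I f \<sigma>"
  defines "v \<equiv> \<lambda>i. fun_scale (complex_of_real (1 / sqrt (\<sigma> i))) (adj (f i))"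
  shows mercer_family_pos: "i \<in> I \<Longrightarrow> \<sigma> i > 0"
    and mercer_family_orthonormal: "Hs.orthonormal I v"
    and mercer_family_on_support: "i \<in> I \<Longrightarrow> x \<in> measure_support \<tau> M \<Longrightarrow> v i x = complex_of_real (sqrt (\<sigma> i)) *s f i x"
    and mercer_family_pointwise: "pointwise_eigenfamily M K I f \<sigma> \<Longrightarrow> i \<in> I \<Longrightarrow> v i x = complex_of_real (sqrt (\<sigma> i)) *s f i x"
    and mercer_family_orthogonal: "w \<in> H \<Longrightarrow> (\<And>i. i \<in> I \<Longrightarrow> ip w (v i) = 0) \<Longrightarrow> x \<in> measure_support \<tau> M \<Longrightarrow> w x = 0"
proof -
  have fX: "f i \<in> functions_on (space M)" and cont: "continuous_map \<tau> euclidean (f i)"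
    and pos: "\<sigma> i > 0" and ae: "AE x in N. integral_operator N K (f i) x = \<sigma> i *\<^sub>R f i x" if "i \<in> I" for i
    using fam that by (auto simp: mercer_family_def Let_def)
  have basis: "orthonormal_basis (L2_orthogonal N kerL) (L2_inner N) I f"
    using fam by (simp add: mercer_family_def Let_def)
  have fL: "f i \<in> L2 N" if "i \<in> I" for i
    using basis that by (auto simp: orthonormal_basis_def orthonormal_family_def L2_orthogonal_def)
  have orth: "L.orthonormal I f"
    using basis fL by (auto simp: orthonormal_basis_def orthonormal_family_def L.orthonormal_def)
  have aH: "adj (f i) \<in> H" if "i \<in> I" for i by (rule adj_in[OF fL[OF that]])
  have vH: "v i \<in> H" if "i \<in> I" for i unfolding v_def using aH[OF that] by blast
  show "i \<in> I \<Longrightarrow> \<sigma> i > 0" for i by (rule pos)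
  have scal: "complex_of_real (1 / sqrt (\<sigma> i)) * (complex_of_real (\<sigma> i) * z) = complex_of_real (sqrt (\<sigma> i)) * z" if "i \<in> I" for i z
  proof -
    have "complex_of_real (1 / sqrt (\<sigma> i)) * complex_of_real (\<sigma> i) = complex_of_real (1 / sqrt (\<sigma> i) * \<sigma> i)"
      by (simp only: of_real_mult)
    also have "1 / sqrt (\<sigma> i) * \<sigma> i = sqrt (\<sigma> i)"
      using pos[OF that] real_sqrt_mult_self[of "\<sigma> i"] by (simp add: field_simps)
    finally show ?thesis by (simp only: mult.assoc[symmetric])
  qed
  have v_eq: "v i x = complex_of_real (sqrt (\<sigma> i)) *s f i x"
    if "i \<in> I" "adj (f i) x = \<sigma> i *\<^sub>R f i x" for i x
    unfolding v_def fun_scale_apply that(2) using scal[OF that(1)]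
    by (simp add: vec_eq_iff scaleR_conv_of_real[where 'a=complex] del: of_real_divide)
  have adj_ae: "AE x in N. adj (f i) x = \<sigma> i *\<^sub>R f i x" if "i \<in> I" for i
    using ae[OF that] AE_space by eventually_elim (simp add: adj_def)
  show "v i x = complex_of_real (sqrt (\<sigma> i)) *s f i x" if "i \<in> I" "x \<in> measure_support \<tau> M" for i x
  proof (rule v_eq[OF that(1)])
    have ident: "fun_scale (complex_of_real (\<sigma> i)) (f i) = (\<lambda>x. \<sigma> i *\<^sub>R f i x)"
      by (simp add: fun_eq_iff vec_eq_iff scaleR_conv_of_real[where 'a=complex])
    have "continuous_map \<tau> euclidean (\<lambda>x. \<sigma> i *\<^sub>R f i x)"
      by (intro continuous_map_compose[OF cont[OF that(1)], unfolded o_def, of euclidean "\<lambda>y. \<sigma> i *\<^sub>R y"])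
        (auto intro!: continuous_intros)
    then show "adj (f i) x = \<sigma> i *\<^sub>R f i x"
      using continuous_AE_eq_on_support[OF continuous_kernel_topology[OF aH[OF that(1)]] _ adj_ae[OF that(1)] that(2)] by blast
  qed
  show "v i x = complex_of_real (sqrt (\<sigma> i)) *s f i x" if "pointwise_eigenfamily M K I f \<sigma>" "i \<in> I" for i x
  proof (rule v_eq[OF that(2)])
    show "adj (f i) x = \<sigma> i *\<^sub>R f i x"
      using that fX[OF that(2)] by (cases "x \<in> space M") (auto simp: adj_def pointwise_eigenfamily_def functions_on_def)
  qed
  show "Hs.orthonormal I v"
    unfolding Hs.orthonormal_def
  proof (intro conjI ballI)
    fix i assume i: "i \<in> I" then show "v i \<in> H" by (rule vH)
    fix k assume k: "k \<in> I"
    have "AE x in N. adj (f k) x = fun_scale (complex_of_real (\<sigma> k)) (f k) x"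
      using adj_ae[OF k] by eventually_elim (simp add: vec_eq_iff scaleR_conv_of_real[where 'a=complex])
    then have "L2_inner N (f i) (adj (f k)) = L2_inner N (f i) (fun_scale (complex_of_real (\<sigma> k)) (f k))"
      using fL[OF i] fL[OF k] H_subset_L2[OF aH[OF k]] by (intro L2_inner_cong_AE) auto
    then have "ip (adj (f i)) (adj (f k)) = complex_of_real (\<sigma> k) * (if i = k then 1 else 0)"
      using ip_adj[OF fL[OF i] aH[OF k]] fL[OF i] fL[OF k] by (simp add: L.ip_scale_right L.orthonormalD(2)[OF orth i k])
    then have eq: "ip (v i) (v k) = complex_of_real (1 / sqrt (\<sigma> i)) * (cnj (complex_of_real (1 / sqrt (\<sigma> k))) * (complex_of_real (\<sigma> k) * (if i = k then 1 else 0)))"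
      unfolding v_def using aH[OF i] aH[OF k] by (simp only: Hs.ip_scale_left Hs.ip_scale_right Hs.S_scale mult.left_commute)
    have "complex_of_real (1 / sqrt (\<sigma> k)) * (complex_of_real (1 / sqrt (\<sigma> k)) * (complex_of_real (\<sigma> k) * 1)) = complex_of_real (1 / sqrt (\<sigma> k)) * (complex_of_real (sqrt (\<sigma> k)) * 1)"
      by (simp only: scal[OF k])
    also have "\<dots> = complex_of_real (1 / sqrt (\<sigma> k) * sqrt (\<sigma> k))" by (simp only: of_real_mult mult_1_right)
    also have "1 / sqrt (\<sigma> k) * sqrt (\<sigma> k) = 1" using pos[OF k] by simp
    finally show "ip (v i) (v k) = (if i = k then 1 else 0)"
      unfolding eq by (cases "i = k") simp_all
  qed
  show "w x = 0" if w: "w \<in> H" "\<And>i. i \<in> I \<Longrightarrow> ip w (v i) = 0" and x: "x \<in> measure_support \<tau> M" for w x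
  proof -
    have wL: "w \<in> L2 N" by (rule H_subset_L2[OF w(1)])
    have zero: "L2_inner N w (f i) = 0" if "i \<in> I" for i
    proof -
      have "ip w (v i) = cnj (complex_of_real (1 / sqrt (\<sigma> i))) * ip w (adj (f i))"
        unfolding v_def using w(1) aH[OF that] by (simp only: Hs.ip_scale_right)
      then have "ip w (adj (f i)) = 0" using w(2)[OF that] pos[OF that] by simp
      then have "L2_inner N (f i) w = 0"
        using Hs.ip_commute[OF w(1) aH[OF that]] ip_adj[OF fL[OF that] w(1)] by simp
      then show ?thesis using L.ip_commute[OF fL[OF that] wL] by simp
    qed
    \<comment> \<open>The basis property concerns only the complement of the kernel of the operator;
      it applies to \<open>w\<close> because \<open>H\<close> lies in that complement.\<close>
    have "((\<lambda>F. L.nrm (w - L.proj f F w)) \<longlongrightarrow> 0) (finite_subsets_at_top I)"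
    proof (rule L.residual_tendsto_zeroI[OF orth wL])
      fix e :: real assume "e > 0"
      then obtain F c where F: "finite F" "F \<subseteq> I" "ip_norm (L2_inner N) (\<lambda>x. w x - (\<Sum>i\<in>F. c i *s f i x)) < e"
        using basis H_orthogonal_kerL[OF w(1)] unfolding orthonormal_basis_def by meson
      have "ip_norm (L2_inner N) (\<lambda>x. w x - (\<Sum>i\<in>F. c i *s f i x)) = L.nrm (w - (\<Sum>i\<in>F. fun_scale (c i) (f i)))"
        unfolding ip_norm_def L.nrm_def fun_diff_def by (simp add: sum_fun_apply)
      then show "\<exists>F c. finite F \<and> F \<subseteq> I \<and> L.nrm (w - (\<Sum>i\<in>F. fun_scale (c i) (f i))) < e"
        using F by (intro exI[of _ F] exI[of _ c]) simp
    qed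
    from L.parseval[OF orth wL this] have "((\<lambda>i. (cmod (L2_inner N w (f i)))\<^sup>2) has_sum (L.nrm w)\<^sup>2) I" .
    moreover have "((\<lambda>i. (cmod (L2_inner N w (f i)))\<^sup>2) has_sum 0) I" by (rule has_sum_0) (simp add: zero)
    ultimately have "(L.nrm w)\<^sup>2 = 0" using has_sum_unique by blast
    then have "AE x in N. w x = 0" using L2_AE_zero_iff[OF wL] by simp
    then show ?thesis
      by (intro continuous_AE_eq_on_support[OF continuous_kernel_topology[OF w(1)] _ _ x]) simp_all
  qed
qed

end

section \<open>Components and the scalar kernels\<close>

lemma component_fun_add: "component_fun (f + g) j = component_fun f j + component_fun g j"
  and component_fun_scale: "component_fun (fun_scale c f) j = fun_scale c (component_fun f j)"
  and component_fun_zero: "component_fun 0 j = 0"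
  by (simp_all add: fun_eq_iff component_fun_def vec_eq_iff)

lemma component_fun_diff: "component_fun (f - g) j = component_fun f j - component_fun g j"
  by (simp add: fun_eq_iff component_fun_def vec_eq_iff)

lemma component_fun_sum:
  "component_fun (\<Sum>i\<in>F. fun_scale (c i) (f i)) j = (\<Sum>i\<in>F. fun_scale (c i) (component_fun (f i) j))"
  by (simp add: fun_eq_iff component_fun_def vec_eq_iff sum_fun_apply sum_component)

context rkhs
begin

text \<open>An orthonormal basis of the closed span of the sections \<open>K\<^sub>x\<^sup>j\<close> (with \<open>j\<close> fixed) is sent by
  \<open>f \<mapsto> f\<^sup>j\<close> to an orthonormal basis of \<open>H'\<close>, since both families of sections have the
  same Gram matrix.\<close>

lemma component_coisometry:
  assumes R: "rkhs X (component_kernel K j) H' ip'" and Q: "dense_points Q"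
  shows component_fun_in: "f \<in> H \<Longrightarrow> component_fun f j \<in> H'"
    and component_lift: "g \<in> H' \<Longrightarrow> \<exists>G\<in>H. Hs.nrm G = ip_norm ip' g \<and> (\<forall>f\<in>H. ip' g (component_fun f j) = ip G f)"
proof -
  interpret R: rkhs X "component_kernel K j" H' ip' by (rule R)
  define \<phi> where "\<phi> f = component_fun f j" for f :: "'a \<Rightarrow> complex^'n"
  have sec': "R.sec k x = \<phi> (sec j x)" if "x \<in> X" for x k
  proof
    fix t
    have "k = 1" by (metis (full_types) num1_eq1)
    then show "R.sec k x t = \<phi> (sec j x) t"
    proof (cases "t \<in> X")
      case True
      then show ?thesis unfolding \<phi>_def vec_eq_iff
        by (simp add: R.sec_apply component_kernel_def component_fun_def sec_apply)
    qed (simp add: kernel_section_def \<phi>_def component_fun_def vec_eq_iff)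
  qed
  have sec'H: "\<phi> (sec j x) \<in> H'" if "x \<in> X" for x
    using R.section_in[OF that, of 1] sec'[OF that, of 1] by simp
  have ip'_sec: "ip' g (\<phi> (sec j x)) = g x $ 1" if "g \<in> H'" "x \<in> X" for g x
    using R.eval_component[OF that, of 1] sec'[OF that(2), of 1] by simp
  have \<phi>_sec: "ip' (\<phi> f) (\<phi> (sec j x)) = ip f (sec j x)" if "f \<in> H" "\<phi> f \<in> H'" "x \<in> X" for f x
    using ip'_sec[OF that(2,3)] eval_component[OF that(1,3), of j] by (simp add: \<phi>_def component_fun_def)
  let ?V = "Hs.span {sec j x |x. x \<in> X}"
  have VH: "f \<in> H \<and> \<phi> f \<in> H'" if "f \<in> ?V" for f
  proof -
    have "?V \<subseteq> {f \<in> H. \<phi> f \<in> H'}"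
    proof (rule Hs.span_minimal)
      show "Hs.subspace {f \<in> H. \<phi> f \<in> H'}"
        by (auto simp: Hs.subspace_def \<phi>_def component_fun_add component_fun_scale component_fun_zero)
    qed (use section_in sec'H in auto)
    then show ?thesis using that by blast
  qed
  \<comment> \<open>Against sections both sides are values at a point, hence equal by the
    reproducing properties of the two spaces; the set of admissible \<open>g\<close> is a subspace,
    so it contains the span.\<close>
  have iso: "ip' (\<phi> f) (\<phi> g) = ip f g" if f: "f \<in> ?V" and g: "g \<in> ?V" for f g
  proof -
    have fH: "f \<in> H" "\<phi> f \<in> H'" using VH[OF f] by auto
    have "?V \<subseteq> {g \<in> H. \<phi> g \<in> H' \<and> ip' (\<phi> f) (\<phi> g) = ip f g}"
    proof (rule Hs.span_minimal)
      show "Hs.subspace {g \<in> H. \<phi> g \<in> H' \<and> ip' (\<phi> f) (\<phi> g) = ip f g}"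
        using fH by (auto simp: Hs.subspace_def \<phi>_def component_fun_add component_fun_scale component_fun_zero
            Hs.ip_add_right Hs.ip_scale_right R.Hs.ip_add_right R.Hs.ip_scale_right)
    qed (use section_in sec'H \<phi>_sec[OF fH] in auto)
    then show ?thesis using g by blast
  qed
  have iso_nrm: "R.Hs.nrm (\<phi> f) = Hs.nrm f" if "f \<in> ?V" for f
    unfolding R.Hs.nrm_def Hs.nrm_def iso[OF that that] ..
  let ?A = "{sec j q |q. q \<in> Q}"
  have AV: "?A \<subseteq> {sec j x |x. x \<in> X}" using Q by (auto simp: dense_points_def)
  have "countable ((\<lambda>q. sec j q) ` Q)" using Q by (auto simp: dense_points_def)
  also have "(\<lambda>q. sec j q) ` Q = ?A" by auto
  finally have "countable ?A" .
  moreover have "?A \<subseteq> H" using AV section_in by auto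
  ultimately obtain J and E :: "nat \<Rightarrow> 'a \<Rightarrow> complex^'n" where E: "Hs.orthonormal J E" "\<And>k. E k \<in> Hs.span ?A"
    "\<And>a. a \<in> ?A \<Longrightarrow> \<exists>F c. finite F \<and> F \<subseteq> J \<and> Hs.nrm (a - (\<Sum>i\<in>F. fun_scale (c i) (E i))) = 0"
    by (rule Hs.orthonormal_sequence_of_countable) blast
  have EV: "E k \<in> ?V" for k using E(2) Hs.span_mono[OF AV] by blast
  have EH: "E k \<in> H" "\<phi> (E k) \<in> H'" for k using VH[OF EV] by auto
  have appr: "\<exists>F c. finite F \<and> F \<subseteq> J \<and> Hs.nrm (sec j x - (\<Sum>i\<in>F. fun_scale (c i) (E i))) < \<epsilon>"
    if "x \<in> X" "\<epsilon> > 0" for x \<epsilon>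
    by (rule sec_approximable[OF Q E(1) _ that]) (use E(3) in blast)
  have E': "R.Hs.orthonormal J (\<lambda>k. \<phi> (E k))"
    using Hs.orthonormalD(2)[OF E(1)] EH iso[OF EV EV] by (simp add: R.Hs.orthonormal_def)
  have appr': "\<exists>F c. finite F \<and> F \<subseteq> J \<and> R.Hs.nrm (R.sec k x - (\<Sum>i\<in>F. fun_scale (c i) (\<phi> (E i)))) < \<epsilon>"
    if x: "x \<in> X" and \<epsilon>: "\<epsilon> > 0" for x \<epsilon> k
  proof -
    obtain F c where F: "finite F" "F \<subseteq> J" "Hs.nrm (sec j x - (\<Sum>i\<in>F. fun_scale (c i) (E i))) < \<epsilon>"
      using appr[OF x \<epsilon>] by blast
    have "sec j x - (\<Sum>i\<in>F. fun_scale (c i) (E i)) \<in> ?V"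
      by (rule Hs.span_diff[OF Hs.span_base Hs.span_sum[OF Hs.span_scale]]) (use x EV in auto)
    from iso_nrm[OF this] have "R.Hs.nrm (R.sec k x - (\<Sum>i\<in>F. fun_scale (c i) (\<phi> (E i)))) < \<epsilon>"
      using F sec'[OF x] by (simp add: \<phi>_def component_fun_diff component_fun_sum)
    then show ?thesis using F by blast
  qed
  have dense': "((\<lambda>F. R.Hs.nrm (g - R.Hs.proj (\<lambda>k. \<phi> (E k)) F g)) \<longlongrightarrow> 0) (finite_subsets_at_top J)" if g: "g \<in> H'" for g
  proof (rule R.Hs.residual_tendsto_zero_if_orthogonal[OF E' g])
    fix w assume w: "w \<in> H'" "\<And>i. i \<in> J \<Longrightarrow> ip' w (\<phi> (E i)) = 0"
    have "w = 0" by (rule R.orthogonal_null_if_sec_approximable[OF E' appr' w])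
    then show "ip' w g = 0" using g by simp
  qed
  \<comment> \<open>That \<open>\<phi> f\<close> lies in \<open>H'\<close> is not known in advance:
    the vector \<open>p\<close> of \<open>H'\<close> with the coefficients of \<open>f\<close> along
    \<open>E\<close> is identified with \<open>\<phi> f\<close> by comparing values at each
    point.\<close>
  have \<phi>f: "\<phi> f \<in> H' \<and> (\<forall>k\<in>J. ip' (\<phi> f) (\<phi> (E k)) = ip f (E k))" if f: "f \<in> H" for f
  proof -
    have "(\<lambda>k. (cmod (ip f (E k)))\<^sup>2) summable_on J"
    proof (rule nonneg_bdd_above_summable_on)
      show "bdd_above (sum (\<lambda>k. (cmod (ip f (E k)))\<^sup>2) ` {F. F \<subseteq> J \<and> finite F})"
        using Hs.bessel[OF E(1) _ _ f] by (intro bdd_aboveI[of _ "(Hs.nrm f)\<^sup>2"]) auto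
    qed simp
    then obtain p where p: "p \<in> H'" "\<And>k. k \<in> J \<Longrightarrow> ip' p (\<phi> (E k)) = ip f (E k)"
      by (rule R.Hs.riesz_fischer[OF E']) blast
    have "p = \<phi> f"
    proof
      fix x
      show "p x = \<phi> f x"
      proof (cases "x \<in> X")
        case True
        have "((\<lambda>k. ip' p (\<phi> (E k)) * ip' (\<phi> (E k)) (\<phi> (sec j x))) has_sum ip' p (\<phi> (sec j x))) J"
          by (rule R.Hs.ip_has_sum[OF E' p(1) sec'H[OF True] dense'[OF p(1)]])
        moreover have "ip' p (\<phi> (E k)) * ip' (\<phi> (E k)) (\<phi> (sec j x)) = ip f (E k) * ip (E k) (sec j x)" if "k \<in> J" for k
          using p(2)[OF that] \<phi>_sec[OF EH True] by simp
        ultimately have "((\<lambda>k. ip f (E k) * ip (E k) (sec j x)) has_sum ip' p (\<phi> (sec j x))) J"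
          by (simp cong: has_sum_cong)
        \<comment> \<open>The version for the second factor is used because the section lies in the
          closed span of the \<open>E k\<close>, whereas \<open>f\<close> may not.\<close>
        moreover have "((\<lambda>k. ip f (E k) * ip (E k) (sec j x)) has_sum ip f (sec j x)) J"
          by (rule Hs.ip_has_sum_right[OF E(1) f section_in[OF True]
              Hs.residual_tendsto_zeroI[OF E(1) section_in[OF True] appr[OF True]]])
        ultimately have "ip' p (\<phi> (sec j x)) = ip f (sec j x)" using has_sum_unique by blast
        then show ?thesis
          using ip'_sec[OF p(1) True] eval_component[OF f True, of j] by (simp add: \<phi>_def component_fun_def vec_eq_iff)
      qed (use R.eval_outside[OF p(1)] eval_outside[OF f] in \<open>simp add: \<phi>_def component_fun_def vec_eq_iff\<close>)
    qed
    then show ?thesis using p by simp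
  qed
  then show "f \<in> H \<Longrightarrow> component_fun f j \<in> H'" by (simp add: \<phi>_def)
  show "\<exists>G\<in>H. Hs.nrm G = ip_norm ip' g \<and> (\<forall>f\<in>H. ip' g (component_fun f j) = ip G f)" if g: "g \<in> H'"
  proof -
    note sum_g = R.Hs.parseval[OF E' g dense'[OF g]]
    then have "(\<lambda>k. (cmod (ip' g (\<phi> (E k))))\<^sup>2) summable_on J" by (auto simp: summable_on_def)
    \<comment> \<open>\<open>G\<close> is the image of \<open>g\<close> under the adjoint of
      \<open>\<phi>\<close>: it has along \<open>E\<close> the coefficients that \<open>g\<close>
      has along \<open>\<phi> (E k)\<close>, hence the same norm.\<close>
    then obtain G where G: "G \<in> H" "\<And>k. k \<in> J \<Longrightarrow> ip G (E k) = ip' g (\<phi> (E k))"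
      "((\<lambda>F. Hs.nrm (G - Hs.proj E F G)) \<longlongrightarrow> 0) (finite_subsets_at_top J)"
      by (rule Hs.riesz_fischer[OF E(1)]) blast
    have "((\<lambda>k. (cmod (ip G (E k)))\<^sup>2) has_sum (R.Hs.nrm g)\<^sup>2) J"
      using sum_g G(2) by (simp cong: has_sum_cong)
    then have "(Hs.nrm G)\<^sup>2 = (R.Hs.nrm g)\<^sup>2"
      using Hs.parseval[OF E(1) G(1,3)] has_sum_unique by blast
    then have nrm: "Hs.nrm G = R.Hs.nrm g"
      using G(1) g by (simp add: power2_eq_iff_nonneg)
    have "ip' g (\<phi> f) = ip G f" if f: "f \<in> H" for f
    proof -
      have f': "\<phi> f \<in> H'" "\<And>k. k \<in> J \<Longrightarrow> ip' (\<phi> f) (\<phi> (E k)) = ip f (E k)" using \<phi>f[OF f] by auto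
      have "ip' g (\<phi> (E k)) * ip' (\<phi> (E k)) (\<phi> f) = ip G (E k) * ip (E k) f" if "k \<in> J" for k
        using G(2)[OF that] f'(2)[OF that] R.Hs.ip_commute[OF f'(1) EH(2), of k] Hs.ip_commute[OF f EH(1), of k] by simp
      then have "((\<lambda>k. ip G (E k) * ip (E k) f) has_sum ip' g (\<phi> f)) J"
        using R.Hs.ip_has_sum[OF E' g f'(1) dense'[OF g]] by (simp cong: has_sum_cong)
      moreover have "((\<lambda>k. ip G (E k) * ip (E k) f) has_sum ip G f) J"
        by (rule Hs.ip_has_sum[OF E(1) G(1) f G(3)])
      ultimately show ?thesis using has_sum_unique by blast
    qed
    then show ?thesis using G(1) nrm by (auto simp: R.nrm_eq_ip_norm \<phi>_def)
  qed
qed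

end

text \<open>The conjugate falls on the factor at \<open>t\<close> because
  \<open>K x t $ l $ j\<close> is the inner product of the section at \<open>t\<close> with the
  section at \<open>x\<close>, linear in the former. To place the given functions themselves in
  \<open>H\<close>, they must agree with the \<open>v i\<close> at every point, which the pointwise
  eigenvalue equation or full support ensures; full support also makes the \<open>v i\<close>
  complete in \<open>H\<close>, as the basis and the frame identities require.\<close>

theorem theorem3p2:
  fixes M :: "'a measure"
    and K :: "'a \<Rightarrow> 'a \<Rightarrow> complex^'n^'n"
    and H :: "('a \<Rightarrow> complex^'n) set"
    and ip :: "('a \<Rightarrow> complex^'n) \<Rightarrow> ('a \<Rightarrow> complex^'n) \<Rightarrow> complex"
  defines "\<tau> \<equiv> kernel_topology (space M) K ip"
  defines "S \<equiv> measure_support \<tau> M"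
  assumes "finite_measure M"
    and "reproducing_kernel (space M) K"
    and "(\<lambda>(x, t). K x t) \<in> borel_measurable (M \<Otimes>\<^sub>M M)"
    and "rkhs (space M) K H ip"
    and "separable_function_space H ip"
  shows "(\<exists>(I :: nat set) f \<sigma>. mercer_family M K ip I f \<sigma> \<and> pointwise_eigenfamily M K I f \<sigma>)
    \<and> (\<forall>(I :: 'i set) f \<sigma>. mercer_family M K ip I f \<sigma> \<longrightarrow>
        (\<forall>l j. (\<forall>x\<in>S. \<forall>t\<in>S.
             ((\<lambda>i. complex_of_real (\<sigma> i) * f i x $ l * cnj (f i t $ j)) has_sum K x t $ l $ j) I) \<and>
           (\<forall>C. compactin (prod_topology \<tau> \<tau>) C \<and> C \<subseteq> S \<times> S \<longrightarrow>
             uniform_limit C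
               (\<lambda>F (x, t). \<Sum>i\<in>F. complex_of_real (\<sigma> i) * f i x $ l * cnj (f i t $ j))
               (\<lambda>(x, t). K x t $ l $ j) (finite_subsets_at_top I)))
      \<and> (pointwise_eigenfamily M K I f \<sigma> \<longrightarrow>
           orthonormal_family H ip I (\<lambda>i x. sqrt (\<sigma> i) *\<^sub>R f i x))
      \<and> (S = space M \<longrightarrow> orthonormal_basis H ip I (\<lambda>i x. sqrt (\<sigma> i) *\<^sub>R f i x))
      \<and> (S = space M \<longrightarrow> (\<forall>j H' ip'. rkhs (space M) (component_kernel K j) H' ip' \<longrightarrow>
           parseval_frame H' ip' I (\<lambda>i x. sqrt (\<sigma> i) *\<^sub>R component_fun (f i) j x))))"
proof -
  interpret mercer_setting M K H ip
    using assms(3,5-7) by (simp add: mercer_setting_def mercer_setting_axioms_def)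
  have S_def': "S = measure_support (kernel_topology (space M) K ip) M" by (simp add: S_def \<tau>_def)
  have SX: "S \<subseteq> space M" unfolding S_def' by (rule support_subset)
  have main: "(\<forall>l j. (\<forall>x\<in>S. \<forall>t\<in>S.
             ((\<lambda>i. complex_of_real (\<sigma> i) * f i x $ l * cnj (f i t $ j)) has_sum K x t $ l $ j) I) \<and>
           (\<forall>C. compactin (prod_topology \<tau> \<tau>) C \<and> C \<subseteq> S \<times> S \<longrightarrow>
             uniform_limit C
               (\<lambda>F (x, t). \<Sum>i\<in>F. complex_of_real (\<sigma> i) * f i x $ l * cnj (f i t $ j))
               (\<lambda>(x, t). K x t $ l $ j) (finite_subsets_at_top I)))
      \<and> (pointwise_eigenfamily M K I f \<sigma> \<longrightarrow>
           orthonormal_family H ip I (\<lambda>i x. sqrt (\<sigma> i) *\<^sub>R f i x))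
      \<and> (S = space M \<longrightarrow> orthonormal_basis H ip I (\<lambda>i x. sqrt (\<sigma> i) *\<^sub>R f i x))
      \<and> (S = space M \<longrightarrow> (\<forall>j H' ip'. rkhs (space M) (component_kernel K j) H' ip' \<longrightarrow>
           parseval_frame H' ip' I (\<lambda>i x. sqrt (\<sigma> i) *\<^sub>R component_fun (f i) j x)))"
    if fam: "mercer_family M K ip I f \<sigma>" for I :: "'i set" and f \<sigma>
  proof -
    define v where "v i = fun_scale (complex_of_real (1 / sqrt (\<sigma> i))) (adj (f i))" for i
    note facts = mercer_family_properties[OF fam, folded v_def S_def']
    have v: "Hs.orthonormal I v" by (rule facts(2))
    have vH: "v i \<in> H" if "i \<in> I" for i by (rule Hs.orthonormalD(1)[OF v that])
    have term_eq: "v i x $ l * cnj (v i t $ j) = complex_of_real (\<sigma> i) * f i x $ l * cnj (f i t $ j)"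
      if "i \<in> I" "x \<in> S" "t \<in> S" for i x t l j
    proof -
      have "complex_of_real (sqrt (\<sigma> i)) * complex_of_real (sqrt (\<sigma> i)) = complex_of_real (\<sigma> i)"
        using facts(1)[OF that(1)] by (simp flip: of_real_mult)
      then show ?thesis
        by (simp add: facts(3)[OF that(1,2)] facts(3)[OF that(1,3)] algebra_simps)
    qed
    have lim: "((\<lambda>F. sec_residual v j F x) \<longlongrightarrow> 0) (finite_subsets_at_top I)" if "x \<in> S" for x j
      unfolding sec_residual_def
    proof (rule Hs.residual_tendsto_zero_if_orthogonal[OF v])
      have x: "x \<in> space M" using that SX by blast
      show "sec j x \<in> H" by (rule section_in[OF x])
      fix w assume w: "w \<in> H" "\<And>i. i \<in> I \<Longrightarrow> ip w (v i) = 0"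
      have "w x = 0" by (rule facts(5)[OF w that])
      then show "ip w (sec j x) = 0" using eval_component[OF w(1) x, of j] by simp
    qed
    have sums: "((\<lambda>i. complex_of_real (\<sigma> i) * f i x $ l * cnj (f i t $ j)) has_sum K x t $ l $ j) I"
      if "x \<in> S" "t \<in> S" for x t l j
    proof -
      have "((\<lambda>i. v i x $ l * cnj (v i t $ j)) has_sum K x t $ l $ j) I"
        using that SX by (intro kernel_expansion[OF v _ _ lim]) auto
      from iffD1[OF has_sum_cong[OF term_eq[OF _ that]] this] show ?thesis .
    qed
    have unif: "uniform_limit C (\<lambda>F (x, t). \<Sum>i\<in>F. complex_of_real (\<sigma> i) * f i x $ l * cnj (f i t $ j))
               (\<lambda>(x, t). K x t $ l $ j) (finite_subsets_at_top I)"
      if C: "compactin (prod_topology \<tau> \<tau>) C" "C \<subseteq> S \<times> S" for C l j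
    proof -
      have lim_v: "uniform_limit C (\<lambda>F (x, t). \<Sum>i\<in>F. v i x $ l * cnj (v i t $ j))
               (\<lambda>(x, t). K x t $ l $ j) (finite_subsets_at_top I)"
      proof (rule kernel_expansion_uniform[OF v C(1)[unfolded \<tau>_def]])
        fix j x assume "x \<in> fst ` C \<union> snd ` C"
        then have "x \<in> S" using C(2) by auto
        then show "((\<lambda>F. sec_residual v j F x) \<longlongrightarrow> 0) (finite_subsets_at_top I)" by (rule lim)
      qed
      have "\<forall>\<^sub>F F in finite_subsets_at_top I. \<forall>z\<in>C. (case z of (x, t) \<Rightarrow> \<Sum>i\<in>F. v i x $ l * cnj (v i t $ j))
          = (case z of (x, t) \<Rightarrow> \<Sum>i\<in>F. complex_of_real (\<sigma> i) * f i x $ l * cnj (f i t $ j))"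
      proof (rule eventually_finite_subsets_at_top_weakI)
        fix F assume "finite F" "F \<subseteq> I"
        then show "\<forall>z\<in>C. (case z of (x, t) \<Rightarrow> \<Sum>i\<in>F. v i x $ l * cnj (v i t $ j))
          = (case z of (x, t) \<Rightarrow> \<Sum>i\<in>F. complex_of_real (\<sigma> i) * f i x $ l * cnj (f i t $ j))"
          using C(2) by (auto intro!: sum.cong term_eq)
      qed
      from iffD1[OF uniform_limit_cong[OF this refl] lim_v] show ?thesis .
    qed
    have scaled: "complex_of_real (sqrt (\<sigma> i)) *s f i x = sqrt (\<sigma> i) *\<^sub>R f i x" for i x
      by (simp add: vec_eq_iff scaleR_conv_of_real[where 'a=complex])
    have ortho: "orthonormal_family H ip I (\<lambda>i x. sqrt (\<sigma> i) *\<^sub>R f i x)"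
      if "\<And>i. i \<in> I \<Longrightarrow> v i = (\<lambda>x. sqrt (\<sigma> i) *\<^sub>R f i x)"
      using v that unfolding orthonormal_family_def Hs.orthonormal_def by simp
    have v_full: "v i = (\<lambda>x. sqrt (\<sigma> i) *\<^sub>R f i x)" if "S = space M" "i \<in> I" for i
    proof
      fix x
      show "v i x = sqrt (\<sigma> i) *\<^sub>R f i x"
      proof (cases "x \<in> space M")
        case True
        then show ?thesis using facts(3)[OF that(2), of x] that(1) by (simp add: scaled)
      next
        case False
        then have "f i x = 0" using fam that(2) by (auto simp: mercer_family_def Let_def functions_on_def)
        then show ?thesis using eval_outside[OF vH[OF that(2)] False] by simp
      qed
    qed
    \<comment> \<open>With full support a vector orthogonal to all \<open>v i\<close> vanishes at
      every point of the space, and elements of \<open>H\<close> are zero outside it by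
      convention.\<close>
    have dense: "((\<lambda>F. Hs.nrm (g - Hs.proj v F g)) \<longlongrightarrow> 0) (finite_subsets_at_top I)"
      if full: "S = space M" and g: "g \<in> H" for g
    proof (rule Hs.residual_tendsto_zero_if_orthogonal[OF v g])
      fix w assume w: "w \<in> H" "\<And>i. i \<in> I \<Longrightarrow> ip w (v i) = 0"
      have "w = 0"
      proof
        fix x show "w x = 0 x"
          using facts(5)[OF w, of x] full eval_outside[OF w(1), of x] by (cases "x \<in> space M") auto
      qed
      then show "ip w g = 0" using g by simp
    qed
    have basis: "orthonormal_basis H ip I (\<lambda>i x. sqrt (\<sigma> i) *\<^sub>R f i x)" if full: "S = space M"
      unfolding orthonormal_basis_def
    proof (intro conjI ballI allI impI)
      show "orthonormal_family H ip I (\<lambda>i x. sqrt (\<sigma> i) *\<^sub>R f i x)" using ortho v_full[OF full] by blast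
      fix g and e :: real assume g: "g \<in> H" and e: "e > 0"
      obtain F where F: "finite F" "F \<subseteq> I" "dist (Hs.nrm (g - Hs.proj v F g)) 0 < e"
        using tendstoD[OF dense[OF full g] e] unfolding eventually_finite_subsets_at_top by blast
      have "ip_norm ip (\<lambda>x. g x - (\<Sum>i\<in>F. ip g (v i) *s (sqrt (\<sigma> i) *\<^sub>R f i x))) = Hs.nrm (g - Hs.proj v F g)"
      proof -
        have "(\<lambda>x. g x - (\<Sum>i\<in>F. ip g (v i) *s (sqrt (\<sigma> i) *\<^sub>R f i x))) = g - Hs.proj v F g"
        proof
          fix x
          have "(\<Sum>i\<in>F. ip g (v i) *s (sqrt (\<sigma> i) *\<^sub>R f i x)) = (\<Sum>i\<in>F. ip g (v i) *s v i x)"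
            using v_full[OF full] F by (intro sum.cong) (auto simp: subset_iff)
          then show "g x - (\<Sum>i\<in>F. ip g (v i) *s (sqrt (\<sigma> i) *\<^sub>R f i x)) = (g - Hs.proj v F g) x"
            by (simp add: Hs.proj_def sum_fun_apply)
        qed
        then show ?thesis by (simp add: nrm_eq_ip_norm)
      qed
      then show "\<exists>F c. finite F \<and> F \<subseteq> I \<and> ip_norm ip (\<lambda>x. g x - (\<Sum>i\<in>F. c i *s (sqrt (\<sigma> i) *\<^sub>R f i x))) < e"
        using F by (intro exI[of _ F] exI[of _ "\<lambda>i. ip g (v i)"]) (auto simp: dist_real_def)
    qed
    have frame: "parseval_frame H' ip' I (\<lambda>i x. sqrt (\<sigma> i) *\<^sub>R component_fun (f i) j x)"
      if full: "S = space M" and R: "rkhs (space M) (component_kernel K j) H' ip'" for j H' ip'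
    proof -
      obtain Q where Q: "dense_points Q" using dense_points_exist[OF separable] .
      have eq: "(\<lambda>x. sqrt (\<sigma> i) *\<^sub>R component_fun (f i) j x) = component_fun (v i) j" if "i \<in> I" for i
        unfolding v_full[OF full that] by (simp add: fun_eq_iff component_fun_def vec_eq_iff)
      show ?thesis
        unfolding parseval_frame_def
      proof (intro conjI ballI)
        show "(\<lambda>x. sqrt (\<sigma> i) *\<^sub>R component_fun (f i) j x) \<in> H'" if "i \<in> I" for i
          unfolding eq[OF that] by (rule component_fun_in[OF R Q vH[OF that]])
        fix g assume g: "g \<in> H'"
        obtain G where G: "G \<in> H" "Hs.nrm G = ip_norm ip' g" "\<And>f. f \<in> H \<Longrightarrow> ip' g (component_fun f j) = ip G f"
          using component_lift[OF R Q g] by blast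
        have *: "(cmod (ip G (v i)))\<^sup>2 = (cmod (ip' g (\<lambda>x. sqrt (\<sigma> i) *\<^sub>R component_fun (f i) j x)))\<^sup>2" if "i \<in> I" for i
          using G(3)[OF vH[OF that]] eq[OF that] by simp
        \<comment> \<open>Parseval along \<open>v\<close> for the lift \<open>G\<close>, which has
          the norm of \<open>g\<close>, is the frame identity.\<close>
        have "((\<lambda>i. (cmod (ip G (v i)))\<^sup>2) has_sum (Hs.nrm G)\<^sup>2) I"
          by (rule Hs.parseval[OF v G(1) dense[OF full G(1)]])
        from iffD1[OF has_sum_cong[OF *] this]
        show "((\<lambda>i. (cmod (ip' g (\<lambda>x. sqrt (\<sigma> i) *\<^sub>R component_fun (f i) j x)))\<^sup>2) has_sum (ip_norm ip' g)\<^sup>2) I"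
          by (simp add: G(2))
      qed
    qed
    have pw: "orthonormal_family H ip I (\<lambda>i x. sqrt (\<sigma> i) *\<^sub>R f i x)" if "pointwise_eigenfamily M K I f \<sigma>"
      by (rule ortho) (simp add: fun_eq_iff facts(4)[OF that] scaled)
    show ?thesis using sums unif pw basis frame by blast
  qed
  show ?thesis using mercer_family_exists main by blast
qed

end
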